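(* For any interval $I\subseteq[0,\frac{\pi}{4}]$ and any $r,\delta>0$, one has $$\varepsilon^r\int_I\tilde R_\varepsilon^r(\omega)\,d\omega=c_r\int_I(\sin x+\cos x)^r\,dx+O_{r,\delta}\big(\varepsilon^{\frac18-\delta}\big)\qquad\text{as }\varepsilon\to0^+,$$ where $$c_r=\frac{12}{\pi^2}\int_0^{1/2}\left( x\big(x^{r-1}+(1-x)^{r-1}\big)+\frac{1-(1-x)^r}{rx(1-x)}-\frac{1-(1-x)^{r+1}}{(r+1)x(1-x)}\right)dx .$$
   Context: For $0<\varepsilon<\frac12$, consider the billiard table obtained from the unit square $[0,1]^2$ by removing pockets in the form of quarter discs of radius $\varepsilon$ at the four corners. A point-like particle starts at the corner $O=(0,0)$ in direction (angle) $\omega$, is reflected specularly in the side cushions, and stops when it reaches one of the pockets (after having left the pocket in which it started). $\tilde R_\varepsilon(\omega)$ denotes the number of reflections in the side cushions before it stops. Equivalently, after unfolding: with $$\tilde\tau_\varepsilon(\omega)=\inf\{\tau>0:(\tau\cos\omega,\tau\sin\omega)\in D_\varepsilon+(\mathbb{Z}^2\setminus\{(0,0)\})\},\qquad D_\varepsilon=\{(x,y)\in\mathbb{R}^2:x^2+y^2=\varepsilon^2\},$$ $\tilde R_\varepsilon(\omega)$ is, for $\omega\in(0,\frac{\pi}{4}]$, the number of $\tau\in(0,\tilde\tau_\varepsilon(\omega))$ with $\tau\cos\omega\in\mathbb{Z}$ plus the number of $\tau\in(0,\tilde\tau_\varepsilon(\omega))$ with $\tau\sin\omega\in\mathbb{Z}$.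 $\tilde R_\varepsilon^r(\omega)$ means $(\tilde R_\varepsilon(\omega))^r$. The notation $F=O_{r,\delta}(G)$ as $\varepsilon\to0^+$ means $|F|\le C\,G$ for all sufficiently small $\varepsilon>0$, where the constant $C$ depends only on $r$ and $\delta$. *)

theory Defs
  imports "HOL-Analysis.Analysis" "HOL-Library.Set_Algebras"
begin

definition pocket_circle :: "real \<Rightarrow> (real \<times> real) set" where
  "pocket_circle \<epsilon> = {(x, y). x\<^sup>2 + y\<^sup>2 = \<epsilon>\<^sup>2}"

text \<open>The sum of sets below is the Minkowski sum of HOL-Library.Set_Algebras. For \<open>\<epsilon> > 0\<close> the
  set of hitting times is nonempty in every direction, so \<open>Inf\<close> is a genuine infimum.\<close>

definition exit_time :: "real \<Rightarrow> real \<Rightarrow> real" where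
  "exit_time \<epsilon> \<omega> =
     Inf {\<tau>. \<tau> > 0 \<and> (\<tau> * cos \<omega>, \<tau> * sin \<omega>) \<in> pocket_circle \<epsilon> + (\<int> \<times> \<int> - {(0, 0)})}"

text \<open>The number of reflections in the side cushions, read off the unfolded trajectory as the number
  of crossings of the lines \<open>x \<in> \<int>\<close> and \<open>y \<in> \<int>\<close>; meaningful for \<open>0 < \<omega> \<le> \<pi>/4\<close>, where both
  sets are finite. (At the single direction \<open>\<omega> = 0\<close> the second set is infinite for \<open>\<epsilon> < 1\<close> and
  \<open>card\<close> returns 0; this does not affect integrals.)\<close>

definition reflections :: "real \<Rightarrow> real \<Rightarrow> nat" where
  "reflections \<epsilon> \<omega> =
     card {\<tau> \<in> {0<..<exit_time \<epsilon> \<omega>}. \<tau> * cos \<omega> \<in> \<int>} +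
     card {\<tau> \<in> {0<..<exit_time \<epsilon> \<omega>}. \<tau> * sin \<omega> \<in> \<int>}"

definition moment_const :: "real \<Rightarrow> real" where
  "moment_const r = 12 / pi\<^sup>2 * (LINT x:{0..1/2}|lborel.
      x * (x powr (r - 1) + (1 - x) powr (r - 1))
      + (1 - (1 - x) powr r) / (r * x * (1 - x))
      - (1 - (1 - x) powr (r + 1)) / ((r + 1) * x * (1 - x)))"

end

theory Submission
  imports Defs "HOL-Number_Theory.Number_Theory" "HOL-Computational_Algebra.Squarefree"
    "HOL-Real_Asymp.Real_Asymp"
begin

text \<open>
  Unfold the billiard and put \<open>t = tan \<omega>\<close>. The ray of direction \<open>\<omega>\<close> meets the circle of radius
  \<open>\<epsilon>\<close> about a lattice point \<open>(m, n)\<close> ahead of it exactly when \<open>\<bar>m t - n\<bar> \<le> \<epsilon> / cos \<omega>\<close>, and on its way there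
  it crosses \<open>m + n = m (1 + t) + O(1)\<close> grid lines. So the number \<open>R\<close> of reflections is, up to a
  bounded error, \<open>1 + t\<close> times the least \<open>m \<ge> 1\<close> for which \<open>m t\<close> is within \<open>\<epsilon> / cos \<omega>\<close> of an integer; the two
  halves of this statement are \<open>hit_gives_exit\<close> and \<open>exit_gives_hit\<close>.

  First let the tolerance be a constant \<open>\<eta>\<close>, and let \<open>near T \<eta>\<close> be the set of slopes for which some
  \<open>m \<le> T\<close> works. The Farey fractions of order \<open>T\<close> cut \<open>[0, 1)\<close> into cells, and inside the cell from
  \<open>a/q\<close> to \<open>a'/q'\<close> only its two end points matter (\<open>near_in_cell_iff\<close>), so the part of the cell that
  lies in \<open>near T \<eta>\<close> has length \<open>(1/q + 1/q') min \<eta> (1/(q + q'))\<close>. This is the integral over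
  \<open>0 \<le> x \<le> \<eta>\<close> of \<open>1/q + 1/q'\<close> times the indicator of \<open>x (q + q') \<le> 1\<close>. It therefore suffices to add
  \<open>1/q + 1/q'\<close> over the cells to the left of a point \<open>b\<close> that satisfy \<open>q + q' \<le> 1/x\<close>. For fixed \<open>q\<close> the
  cells starting at a fraction with denominator \<open>q\<close> are the pairs \<open>(q', a)\<close> with \<open>a q' \<equiv> -1\<close> modulo
  \<open>q\<close> in a box: \<open>q'\<close> runs through an interval of length at most \<open>q\<close>, and \<open>0 \<le> a < b q\<close>. Points of a
  modular hyperbola are equidistributed in boxes with an error \<open>q\<close> to the power \<open>3/4 + \<delta>\<close>
  (\<open>hyperbola_box_count\<close>, \<open>hyperbola_error_bound\<close>). The bound for Kloosterman sums behind this is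
  Kloosterman's own: the fourth moment over all frequencies counts solutions of a congruence that
  factors as \<open>u v w \<equiv> 0\<close>, and each sum occurs in that moment once for every unit modulo \<open>q\<close>, up to a gcd. Together
  with the mean value \<open>6/\<pi>\<^sup>2\<close> of \<open>\<phi>(q)/q\<close> one obtains
  \<open>\<bar>near T \<eta> \<inter> [0, b)\<bar> = b F(\<eta> T) + O(\<eta> T powr (3/4 + \<delta>))\<close> with an explicit distribution function \<open>F\<close>
  (\<open>near_equidistributed\<close>), hence an error \<open>\<eta> powr (1/4 - \<delta>)\<close> in the range \<open>T = O(1/\<eta>)\<close>.

  The true tolerance \<open>\<epsilon> / cos \<omega>\<close> varies with \<open>\<omega>\<close>. Cut the range of directions into \<open>\<epsilon> powr (-1/8)\<close>
  pieces and replace \<open>cos \<omega>\<close> and \<open>tan \<omega>\<close> on each piece by their extreme values: this costs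
  \<open>\<epsilon> powr (1/8)\<close> in total, while the errors of the pieces add up to \<open>\<epsilon> powr (1/8 - \<delta>)\<close>. The outcome is
  that the measure of the directions in an interval with \<open>\<epsilon> R \<le> y\<close> is the integral of
  \<open>F(y / (sin \<omega> + cos \<omega>))\<close> up to \<open>O(\<epsilon> powr (1/8 - \<delta>))\<close>, uniformly in \<open>y\<close> and in the interval
  (\<open>distribution_of_reflections\<close>).

  Moments follow by integrating the distribution functions over the threshold, with Fubini's
  theorem; \<open>\<epsilon> R\<close> is bounded, so a uniform error suffices. The constant comes out as the \<open>r\<close>-th moment
  of \<open>F\<close>, which an integration by parts identifies with \<open>moment_const r\<close>.
\<close>

section \<open>Additive characters modulo q\<close>

definition unit_root :: "nat \<Rightarrow> int \<Rightarrow> complex" where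
  "unit_root q k = cis (2 * pi * of_int k / of_nat q)"

lemma unit_root_add: "unit_root q (j + k) = unit_root q j * unit_root q k"
  by (simp add: unit_root_def cis_mult add_divide_distrib algebra_simps)

lemma unit_root_0 [simp]: "unit_root q 0 = 1"
  by (simp add: unit_root_def)

lemma norm_unit_root [simp]: "norm (unit_root q k) = 1"
  by (simp add: unit_root_def)

lemma cnj_unit_root: "cnj (unit_root q k) = unit_root q (- k)"
  by (simp add: unit_root_def cis_cnj)

lemma unit_root_power: "unit_root q (int m * k) = unit_root q k ^ m"
proof -
  have "2 * pi * of_int (int m * k) / real q = real m * (2 * pi * of_int k / real q)"
    by simp
  then show ?thesis unfolding unit_root_def by (metis Complex.DeMoivre)
qed

lemma unit_root_eq_1_iff:
  assumes "q > 0"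
  shows "unit_root q k = 1 \<longleftrightarrow> int q dvd k"
proof
  assume "unit_root q k = 1"
  then have "cos (2 * pi * of_int k / real q) = 1"
    by (simp add: unit_root_def complex_eq_iff)
  then obtain n :: int where n: "2 * pi * of_int k / real q = of_int n * 2 * pi"
    by (auto simp: cos_one_2pi_int)
  then have "of_int k = (of_int n * real q :: real)"
    using assms by (simp add: field_simps)
  then have "k = n * int q"
    by (metis of_int_eq_iff of_int_mult of_int_of_nat_eq)
  then show "int q dvd k" by simp
next
  assume "int q dvd k"
  then obtain n where n: "k = int q * n" by (auto elim: dvdE)
  have "2 * pi * of_int k / real q = 2 * pi * of_int n"
    using assms n by (simp add: field_simps)
  then show "unit_root q k = 1"
    by (simp add: unit_root_def)
qed

lemma unit_root_cong:
  assumes "q > 0" "[j = k] (mod int q)"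
  shows "unit_root q j = unit_root q k"
proof -
  have "int q dvd j - k" using assms(2) by (simp add: cong_iff_dvd_diff)
  then have "unit_root q (j - k) = 1" using unit_root_eq_1_iff[OF assms(1)] by simp
  then show ?thesis using unit_root_add[of q "j - k" k] by simp
qed

lemma sum_unit_root:
  assumes "q > 0"
  shows "(\<Sum>m<q. unit_root q (int m * k)) = (if int q dvd k then of_nat q else 0)"
proof (cases "int q dvd k")
  case True
  then have "unit_root q k = 1" using unit_root_eq_1_iff[OF assms] by simp
  then show ?thesis using True by (simp add: unit_root_power)
next
  case False
  then have ne: "unit_root q k \<noteq> 1" using unit_root_eq_1_iff[OF assms] by simp
  have "unit_root q k ^ q = 1"
    using unit_root_eq_1_iff[OF assms, of "int q * k"] by (simp add: unit_root_power)
  then show ?thesis using False ne by (simp add: unit_root_power geometric_sum)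
qed

lemma sum_swap_pairs:
  "(\<Sum>m\<in>A. \<Sum>n\<in>B. \<Sum>i\<in>C. \<Sum>j\<in>D. f m n i j) = (\<Sum>i\<in>C. \<Sum>j\<in>D. \<Sum>m\<in>A. \<Sum>n\<in>B. f m n i j)"
proof -
  have "(\<Sum>m\<in>A. \<Sum>n\<in>B. \<Sum>i\<in>C. \<Sum>j\<in>D. f m n i j) = (\<Sum>m\<in>A. \<Sum>i\<in>C. \<Sum>n\<in>B. \<Sum>j\<in>D. f m n i j)"
    by (intro sum.cong refl sum.swap)
  also have "\<dots> = (\<Sum>i\<in>C. \<Sum>m\<in>A. \<Sum>j\<in>D. \<Sum>n\<in>B. f m n i j)"
    by (subst sum.swap) (intro sum.cong refl sum.swap)
  also have "\<dots> = (\<Sum>i\<in>C. \<Sum>j\<in>D. \<Sum>m\<in>A. \<Sum>n\<in>B. f m n i j)"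
    by (intro sum.cong refl sum.swap)
  finally show ?thesis .
qed

text \<open>Orthogonality in both variables leaves only the pairs \<open>(i, j)\<close> with equal frequencies.\<close>

lemma parseval_unit_root:
  fixes s t :: "'i \<Rightarrow> int"
  assumes "q > 0" "finite S"
  shows "(\<Sum>m<q. \<Sum>n<q. (norm (\<Sum>i\<in>S. unit_root q (int m * s i + int n * t i)))\<^sup>2) =
           real q ^ 2 * card {(i, j). i \<in> S \<and> j \<in> S \<and> [s i = s j] (mod int q) \<and> [t i = t j] (mod int q)}"
proof -
  let ?E = "\<lambda>m n i. unit_root q (int m * s i + int n * t i)"
  let ?P = "{(i, j). i \<in> S \<and> j \<in> S \<and> [s i = s j] (mod int q) \<and> [t i = t j] (mod int q)}"
  have pair_sum: "(\<Sum>i\<in>S. \<Sum>j\<in>S. if (i, j) \<in> P then x else 0) = (\<Sum>p\<in>S \<times> S. if p \<in> P then x else 0)"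
    for P and x :: complex
    by (simp only: sum.cartesian_product split_def prod.collapse)
  have sq: "complex_of_real ((norm (\<Sum>i\<in>S. ?E m n i))\<^sup>2) =
      (\<Sum>i\<in>S. \<Sum>j\<in>S. unit_root q (int m * (s i - s j)) * unit_root q (int n * (t i - t j)))" for m n
  proof -
    have "complex_of_real ((norm (\<Sum>i\<in>S. ?E m n i))\<^sup>2) = (\<Sum>i\<in>S. ?E m n i) * cnj (\<Sum>j\<in>S. ?E m n j)"
      by (simp only: complex_norm_square)
    also have "\<dots> = (\<Sum>i\<in>S. \<Sum>j\<in>S. ?E m n i * unit_root q (- (int m * s j + int n * t j)))"
      by (simp only: cnj_sum cnj_unit_root sum_product)
    also have "\<dots> = (\<Sum>i\<in>S. \<Sum>j\<in>S. unit_root q (int m * (s i - s j)) * unit_root q (int n * (t i - t j)))"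
      by (simp only: unit_root_add[symmetric]) (simp add: algebra_simps)
    finally show ?thesis .
  qed
  have "complex_of_real (\<Sum>m<q. \<Sum>n<q. (norm (\<Sum>i\<in>S. ?E m n i))\<^sup>2) =
     (\<Sum>m<q. \<Sum>n<q. \<Sum>i\<in>S. \<Sum>j\<in>S. unit_root q (int m * (s i - s j)) * unit_root q (int n * (t i - t j)))"
    by (simp only: of_real_sum sq)
  also have "\<dots> = (\<Sum>i\<in>S. \<Sum>j\<in>S. \<Sum>m<q. \<Sum>n<q. unit_root q (int m * (s i - s j)) * unit_root q (int n * (t i - t j)))"
    by (rule sum_swap_pairs)
  also have "\<dots> = (\<Sum>i\<in>S. \<Sum>j\<in>S. (\<Sum>m<q. unit_root q (int m * (s i - s j))) * (\<Sum>n<q. unit_root q (int n * (t i - t j))))"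
    by (simp only: sum_product)
  also have "\<dots> = (\<Sum>i\<in>S. \<Sum>j\<in>S. if (i, j) \<in> ?P then of_nat q ^ 2 else 0)"
    by (intro sum.cong refl) (auto simp: sum_unit_root[OF assms(1)] cong_iff_dvd_diff power2_eq_square)
  also have "\<dots> = (\<Sum>p\<in>S \<times> S. if p \<in> ?P then of_nat q ^ 2 else 0)"
    by (rule pair_sum)
  also have "\<dots> = (\<Sum>p\<in>(S \<times> S) \<inter> ?P. of_nat q ^ 2)"
    using assms(2) by (simp only: sum.inter_restrict finite_SigmaI)
  also have "\<dots> = (\<Sum>p\<in>?P. of_nat q ^ 2)"
    by (rule sum.cong) auto
  also have "\<dots> = complex_of_real (real q ^ 2 * card ?P)"
    by simp
  finally show ?thesis
    by (simp only: of_real_eq_iff)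
qed

section \<open>Kloosterman sums\<close>

text \<open>Unlike \<open>totatives\<close>, which lie in \<open>{0<..q}\<close>, these representatives are values of \<open>_ mod q\<close>
  also for \<open>q = 1\<close>.\<close>

definition units_mod :: "nat \<Rightarrow> nat set" where
  "units_mod q = {x. x < q \<and> coprime x q}"

definition ndivs :: "nat \<Rightarrow> nat" where
  "ndivs q = card {d. d dvd q}"

lemma finite_units_mod [simp]: "finite (units_mod q)"
  by (simp add: units_mod_def)

lemma card_units_mod:
  assumes "q > 0" shows "card (units_mod q) = totient q"
proof (cases "q = 1")
  case True
  have "units_mod 1 = {0}" by (auto simp: units_mod_def)
  then show ?thesis using True by simp
next
  case False
  have "units_mod q = totatives q"
  proof (intro equalityI subsetI)
    fix x assume x: "x \<in> units_mod q"
    have "x \<noteq> 0"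
    proof
      assume "x = 0"
      then have "coprime 0 q" using x by (simp add: units_mod_def)
      then show False using False by simp
    qed
    then show "x \<in> totatives q" using x by (auto simp: units_mod_def totatives_def intro: Nat.gr0I)
  next
    fix x assume x: "x \<in> totatives q"
    then have "x \<noteq> q" using False by (auto simp: totatives_def)
    then show "x \<in> units_mod q" using x by (simp add: units_mod_def totatives_def)
  qed
  then show ?thesis by (simp add: totient_def)
qed

text \<open>The point of the modular hyperbola \<open>x y \<equiv> c\<close> above \<open>x\<close>. In the application \<open>c = -1\<close> and \<open>c = 1\<close>
  link the denominator of one end of a Farey cell with the numerator of the other.\<close>

definition partner :: "nat \<Rightarrow> int \<Rightarrow> nat \<Rightarrow> nat" where
  "partner q c x = (SOME y. y \<in> units_mod q \<and> [int x * int y = c] (mod int q))"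

lemma partner:
  assumes "q > 0" "coprime c (int q)" "x \<in> units_mod q"
  shows "partner q c x \<in> units_mod q" "[int x * int (partner q c x) = c] (mod int q)"
proof -
  have "coprime (int x) (int q)" using assms(3) by (simp add: units_mod_def)
  then obtain z where z: "[int x * z = 1] (mod int q)"
    using cong_solve_coprime_int by blast
  let ?y = "nat ((c * z) mod int q)"
  have y: "int ?y = (c * z) mod int q" using assms(1) by simp
  have c: "[int x * int ?y = c] (mod int q)"
  proof -
    have "[int x * int ?y = int x * (c * z)] (mod int q)"
      unfolding y by (intro cong_mult cong_refl) (simp add: cong_def)
    also have "[int x * (c * z) = c * (int x * z)] (mod int q)" by (simp add: mult_ac)
    also have "[c * (int x * z) = c * 1] (mod int q)" by (intro cong_mult cong_refl z)
    finally show ?thesis by simp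
  qed
  have "coprime (int x * int ?y) (int q)"
    using assms(2) c cong_imp_coprime cong_sym by blast
  then have "coprime (int ?y) (int q)" by (simp only: coprime_mult_left_iff)
  then have "coprime ?y q" by (simp only: coprime_int_iff)
  moreover have "?y < q" using assms(1) by (simp add: nat_less_iff)
  ultimately have "\<exists>y. y \<in> units_mod q \<and> [int x * int y = c] (mod int q)"
    using c by (auto simp: units_mod_def)
  from someI_ex[OF this]
  show "partner q c x \<in> units_mod q" "[int x * int (partner q c x) = c] (mod int q)"
    by (simp_all add: partner_def)
qed

lemma cong_less_unique:
  assumes "[int x = int y] (mod int q)" "x < q" "y < q"
  shows "x = y"
  using assms by (simp add: cong_int_iff cong_less_modulus_unique_nat)

lemma partner_unique:
  assumes "q > 0" "coprime c (int q)" "x \<in> units_mod q" "[int x * y = c] (mod int q)"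
  shows "[y = int (partner q c x)] (mod int q)"
proof -
  have "[int x * y = int x * int (partner q c x)] (mod int q)"
    using partner(2)[OF assms(1-3)] assms(4) cong_sym cong_trans by blast
  moreover have "coprime (int x) (int q)" using assms(3) by (simp add: units_mod_def)
  ultimately show ?thesis using cong_mult_lcancel by blast
qed

lemma partner_partner:
  assumes "q > 0" "coprime c (int q)" "x \<in> units_mod q"
  shows "partner q c (partner q c x) = x"
proof -
  note p = partner[OF assms]
  have "[int (partner q c x) * int x = c] (mod int q)"
    using p(2) by (simp add: mult.commute)
  then have "[int x = int (partner q c (partner q c x))] (mod int q)"
    using partner_unique[OF assms(1,2) p(1)] by blast
  then show ?thesis
    using cong_less_unique partner(1)[OF assms(1,2) p(1)] assms(3)
    by (metis (no_types, lifting) mem_Collect_eq units_mod_def)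
qed

definition kloosterman :: "nat \<Rightarrow> int \<Rightarrow> nat \<Rightarrow> nat \<Rightarrow> complex" where
  "kloosterman q c m n =
     (\<Sum>x\<in>units_mod q. unit_root q (int m * int x + int n * int (partner q c x)))"

lemma kloosterman_commute:
  assumes "q > 0" "coprime c (int q)"
  shows "kloosterman q c m n = kloosterman q c n m"
  unfolding kloosterman_def
  by (rule sum.reindex_bij_witness[where i = "partner q c" and j = "partner q c"])
     (auto simp: partner_partner[OF assms] partner[OF assms] add.commute)

text \<open>Substituting \<open>v x\<close> for \<open>x\<close> turns the partner \<open>y\<close> into \<open>y / v\<close>. Thus the sum is constant on the orbit of
  all frequencies \<open>(m v, n / v)\<close>, which makes a moment over all frequencies say something about each
  single one.\<close>

lemma kloosterman_twist:
  assumes "q > 0" "coprime c (int q)" "v \<in> units_mod q"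
  shows "kloosterman q c ((m * v) mod q) ((n * partner q 1 v) mod q) = kloosterman q c m n"
proof -
  let ?w = "partner q 1 v"
  have w: "?w \<in> units_mod q" "[int v * int ?w = 1] (mod int q)"
    using partner[of q 1 v] assms by auto
  let ?f = "\<lambda>x. (v * x) mod q"
  have fU: "?f x \<in> units_mod q" if "x \<in> units_mod q" for x
    using that assms by (auto simp: units_mod_def)
  have inj: "inj_on ?f (units_mod q)"
  proof (rule inj_onI)
    fix x y assume xy: "x \<in> units_mod q" "y \<in> units_mod q" "?f x = ?f y"
    then have "[v * x = v * y] (mod q)" by (simp add: cong_def)
    moreover have "coprime v q" using assms(3) by (simp add: units_mod_def)
    ultimately have "[x = y] (mod q)" using cong_mult_lcancel_nat by blast
    then show "x = y" using xy by (simp add: units_mod_def cong_less_modulus_unique_nat)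
  qed
  have bij: "?f ` units_mod q = units_mod q"
    by (rule card_subset_eq) (use fU inj in \<open>auto simp: card_image\<close>)
  have py: "[int (partner q c (?f x)) = int ?w * int (partner q c x)] (mod int q)"
    if x: "x \<in> units_mod q" for x
  proof -
    have "[int (?f x) * (int ?w * int (partner q c x)) =
        (int v * int x) * (int ?w * int (partner q c x))] (mod int q)"
      by (intro cong_mult cong_refl) (simp add: cong_def zmod_int)
    also have "[(int v * int x) * (int ?w * int (partner q c x)) =
        (int v * int ?w) * (int x * int (partner q c x))] (mod int q)" by (simp add: mult_ac)
    also have "[(int v * int ?w) * (int x * int (partner q c x)) = 1 * c] (mod int q)"
      by (intro cong_mult w partner(2) assms x)
    finally show ?thesis
      using partner_unique[OF assms(1,2) fU[OF x]] cong_sym by auto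
  qed
  have "kloosterman q c m n = (\<Sum>x\<in>units_mod q. unit_root q (int m * int (?f x) + int n * int (partner q c (?f x))))"
    unfolding kloosterman_def using sum.reindex[OF inj, unfolded bij] by (simp add: o_def)
  also have "\<dots> = (\<Sum>x\<in>units_mod q. unit_root q (int ((m * v) mod q) * int x + int ((n * ?w) mod q) * int (partner q c x)))"
  proof (intro sum.cong refl unit_root_cong assms cong_add)
    fix x assume x: "x \<in> units_mod q"
    have "[int m * int (?f x) = int m * (int v * int x)] (mod int q)"
      by (intro cong_mult cong_refl) (simp add: cong_def zmod_int)
    also have "[int m * (int v * int x) = (int m * int v) * int x] (mod int q)" by (simp add: mult_ac)
    also have "[(int m * int v) * int x = int ((m * v) mod q) * int x] (mod int q)"
      by (intro cong_mult cong_refl) (simp add: cong_def zmod_int)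
    finally show "[int m * int (?f x) = int ((m * v) mod q) * int x] (mod int q)" .
    have "[int n * int (partner q c (?f x)) = int n * (int ?w * int (partner q c x))] (mod int q)"
      by (intro cong_mult cong_refl py x)
    also have "[int n * (int ?w * int (partner q c x)) = (int n * int ?w) * int (partner q c x)] (mod int q)"
      by (simp add: mult_ac)
    also have "[(int n * int ?w) * int (partner q c x) = int ((n * ?w) mod q) * int (partner q c x)] (mod int q)"
      by (intro cong_mult cong_refl) (simp add: cong_def zmod_int)
    finally show "[int n * int (partner q c (?f x)) = int ((n * ?w) mod q) * int (partner q c x)] (mod int q)" .
  qed
  finally show ?thesis by (simp add: kloosterman_def)
qed

lemma finite_divisors: "q > 0 \<Longrightarrow> finite {d::nat. d dvd q}"
  by (rule finite_subset[of _ "{..q}"]) (auto dest: dvd_imp_le)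

lemma card_multiples_less:
  assumes "d dvd q" "q > (0::nat)"
  shows "card {u. u < q \<and> d dvd u} = q div d"
proof -
  obtain k where k: "q = d * k" using assms by (auto elim: dvdE)
  have d: "d > 0" using assms k by auto
  have "{u. u < q \<and> d dvd u} = (\<lambda>i. d * i) ` {..<k}"
    using d k by (auto elim!: dvdE)
  moreover have "inj_on (\<lambda>i. d * i) {..<k}" using d by (auto simp: inj_on_def)
  ultimately show ?thesis using d k by (simp add: card_image)
qed

lemma gcd_le_sum_divisors:
  fixes u q :: nat
  assumes "q > 0"
  shows "gcd u q \<le> (\<Sum>d | d dvd q. if d dvd u then d else 0)"
proof -
  have "(\<Sum>d\<in>{gcd u q}. if d dvd u then d else 0) \<le> (\<Sum>d | d dvd q. if d dvd u then d else 0)"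
    by (rule sum_mono2) (use finite_divisors[OF assms] in auto)
  then show ?thesis by simp
qed

lemma sum_gcd_le:
  assumes "q > 0"
  shows "(\<Sum>u<q. gcd u q) \<le> q * ndivs q"
proof -
  have "(\<Sum>u<q. gcd u q) \<le> (\<Sum>u<q. \<Sum>d | d dvd q. if d dvd u then d else 0)"
    by (intro sum_mono gcd_le_sum_divisors assms)
  also have "\<dots> = (\<Sum>d | d dvd q. \<Sum>u<q. if d dvd u then d else 0)"
    by (rule sum.swap)
  also have "\<dots> = (\<Sum>d | d dvd q. q)"
  proof (rule sum.cong[OF refl])
    fix d assume "d \<in> {d. d dvd q}"
    then have d: "d dvd q" by simp
    have "(\<Sum>u<q. if d dvd u then d else 0) = d * card {u. u < q \<and> d dvd u}"
      by (simp add: sum.If_cases Int_def mult.commute)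
    then show "(\<Sum>u<q. if d dvd u then d else 0) = q"
      using d card_multiples_less[OF d assms] by simp
  qed
  finally show ?thesis by (simp add: ndivs_def mult.commute)
qed

text \<open>Two solutions differ by a multiple of \<open>h = q / gcd m q\<close>, so they are told apart by their quotients
  by \<open>h\<close>.\<close>

lemma card_linear_cong_le:
  fixes m q :: nat
  assumes "q > 0"
  shows "card {v. v < q \<and> [m * v = k] (mod q)} \<le> gcd m q"
proof -
  let ?g = "gcd m q" and ?S = "{v. v < q \<and> [m * v = k] (mod q)}"
  have g: "?g > 0" using assms by simp
  obtain h where h: "q = ?g * h" by (meson dvdE gcd_dvd2)
  have hpos: "h > 0" using assms h by (cases h) auto
  have "inj_on (\<lambda>v. v div h) ?S"
  proof (rule inj_onI)
    fix v w assume v: "v \<in> ?S" and w: "w \<in> ?S" and eq: "v div h = w div h"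
    have "[m * v = m * w] (mod q)" using v w cong_sym cong_trans by blast
    then have "[int (m * v) = int (m * w)] (mod int q)" by (simp only: cong_int_iff)
    then have "int q dvd int m * (int v - int w)"
      by (simp add: cong_iff_dvd_diff right_diff_distrib)
    moreover have "int m * (int v - int w) = int ?g * (int (m div ?g) * (int v - int w))"
      by (metis dvd_mult_div_cancel gcd_dvd1 mult.assoc of_nat_mult)
    moreover have "int q = int ?g * int h" using h by (metis of_nat_mult)
    ultimately have "int h dvd int (m div ?g) * (int v - int w)"
      by (metis dvd_mult_cancel_left g of_nat_0_less_iff order_less_irrefl)
    moreover have "coprime h (m div ?g)"
      using div_gcd_coprime[of m q] h g assms
      by (metis coprime_commute nonzero_mult_div_cancel_left not_gr_zero)
    ultimately have "int h dvd int v - int w"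
      by (simp add: coprime_dvd_mult_right_iff)
    then have "[v = w] (mod h)"
      by (simp add: cong_iff_dvd_diff[symmetric] cong_int_iff)
    then show "v = w" using eq unfolding cong_def by (metis div_mod_decomp)
  qed
  moreover have "(\<lambda>v. v div h) ` ?S \<subseteq> {..<?g}"
    using hpos h by (auto simp: div_less_iff_less_mult)
  ultimately show ?thesis using card_inj_on_le[of _ ?S "{..<?g}"] by simp
qed

lemma gcd_mult_le: 
  assumes "q > (0::nat)" shows "gcd (u * v) q \<le> gcd u q * gcd v q"
proof -
  have "gcd (u * v) q dvd gcd u q * gcd v q"
  proof -
    have "gcd u q * gcd v q = gcd (gcd (u * v) (u * q)) (gcd (q * v) (q * q))"
      by (simp add: gcd_mult_distrib_nat gcd.assoc gcd.commute gcd.left_commute mult.commute)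
    moreover have "gcd (u * v) q dvd gcd (gcd (u * v) (u * q)) (gcd (q * v) (q * q))"
      by (intro gcd_greatest gcd_dvd1 dvd_mult2 dvd_mult gcd_dvd2)
    ultimately show ?thesis by simp
  qed
  then show ?thesis using assms by (simp add: dvd_imp_le)
qed

text \<open>Given \<open>u\<close> and \<open>v\<close>, the third factor solves a linear congruence with at most
  \<open>gcd u q * gcd v q\<close> solutions.\<close>

lemma card_product_zero_le:
  assumes "q > 0"
  shows "card {(u, v, w). u < q \<and> v < q \<and> w < q \<and> q dvd u * v * w} \<le> (q * ndivs q)\<^sup>2"
proof -
  have eq: "{(u, v, w). u < q \<and> v < q \<and> w < q \<and> q dvd u * v * w} =
     (SIGMA u:{..<q}. SIGMA v:{..<q}. {w. w < q \<and> [u * v * w = 0] (mod q)})"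
    by (auto simp: cong_0_iff)
  have "card {(u, v, w). u < q \<and> v < q \<and> w < q \<and> q dvd u * v * w} =
     (\<Sum>u<q. \<Sum>v<q. card {w. w < q \<and> [u * v * w = 0] (mod q)})"
    unfolding eq by (simp add: card_SigmaI)
  also have "\<dots> \<le> (\<Sum>u<q. \<Sum>v<q. gcd u q * gcd v q)"
    by (intro sum_mono order_trans[OF card_linear_cong_le[OF assms] gcd_mult_le[OF assms]])
  also have "\<dots> = (\<Sum>u<q. gcd u q) * (\<Sum>v<q. gcd v q)" by (simp only: sum_product)
  also have "\<dots> \<le> (q * ndivs q) * (q * ndivs q)" by (intro mult_mono sum_gcd_le assms) auto
  finally show ?thesis by (simp add: power2_eq_square)
qed

text \<open>By Parseval for the square of the sum, the fourth moment counts the quadruples of units with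
  \<open>x\<^sub>1 + x\<^sub>2 \<equiv> x\<^sub>3 + x\<^sub>4\<close> and the same relation for the partners. Multiplying the second relation by
  \<open>x\<^sub>1 x\<^sub>2 x\<^sub>3 x\<^sub>4\<close> and eliminating \<open>x\<^sub>4\<close> gives \<open>(x\<^sub>3 - x\<^sub>1) (x\<^sub>3 - x\<^sub>2) (x\<^sub>1 + x\<^sub>2) \<equiv> 0\<close>. The three factors
  add up to \<open>2 x\<^sub>3\<close>, which leaves at most two possibilities for \<open>x\<^sub>3\<close>, and with it they determine the
  quadruple.\<close>

lemma kloosterman_fourth_moment:
  assumes "q > 0" "coprime c (int q)"
  shows "(\<Sum>m<q. \<Sum>n<q. norm (kloosterman q c m n) ^ 4) \<le> 2 * real q ^ 4 * real (ndivs q) ^ 2"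
proof -
  let ?U = "units_mod q" and ?y = "partner q c"
  let ?S = "?U \<times> ?U"
  let ?s = "\<lambda>p::nat\<times>nat. int (fst p) + int (snd p)"
  let ?t = "\<lambda>p::nat\<times>nat. int (?y (fst p)) + int (?y (snd p))"
  let ?N = "{(i, j). i \<in> ?S \<and> j \<in> ?S \<and> [?s i = ?s j] (mod int q) \<and> [?t i = ?t j] (mod int q)}"
  let ?Z = "{(u, v, w). u < q \<and> v < q \<and> w < q \<and> q dvd u * v * w}"
  have sq: "norm (kloosterman q c m n) ^ 4 = (norm (\<Sum>p\<in>?S. unit_root q (int m * ?s p + int n * ?t p)))\<^sup>2" for m n
  proof -
    have "kloosterman q c m n ^ 2 = (\<Sum>p\<in>?S. unit_root q (int m * ?s p + int n * ?t p))"
      unfolding power2_eq_square kloosterman_def sum_product unit_root_add[symmetric] sum.cartesian_product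
      by (simp add: split_def algebra_simps)
    then have "norm (kloosterman q c m n) ^ 2 = norm (\<Sum>p\<in>?S. unit_root q (int m * ?s p + int n * ?t p))"
      by (metis norm_power)
    then have "(norm (kloosterman q c m n) ^ 2)\<^sup>2 = (norm (\<Sum>p\<in>?S. unit_root q (int m * ?s p + int n * ?t p)))\<^sup>2"
      by simp
    then show ?thesis by (simp flip: power_mult)
  qed
  let ?r = "\<lambda>k. nat (k mod int q)"
  \<comment> \<open>the extra bit tells the two solutions \<open>x3\<close> of \<open>2 x3 \<equiv> k\<close> apart\<close>
  let ?F = "\<lambda>((x1::nat, x2::nat), (x3::nat, x4::nat)).
     ((?r (int x3 - int x1), ?r (int x3 - int x2), ?r (int x1 + int x2)), 2 * x3 < q)"
  have r: "int (?r k) = k mod int q" for k using assms(1) by simp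
  have inj: "inj_on ?F ?N"
  proof (rule inj_onI)
    fix P Q assume PQ: "P \<in> ?N" "Q \<in> ?N" "?F P = ?F Q"
    obtain x1 x2 x3 x4 where P: "P = ((x1, x2), (x3, x4))" by (metis prod.collapse)
    obtain z1 z2 z3 z4 where Q: "Q = ((z1, z2), (z3, z4))" by (metis prod.collapse)
    have lt: "x1 < q" "x2 < q" "x3 < q" "x4 < q" "z1 < q" "z2 < q" "z3 < q" "z4 < q"
      using PQ(1,2) unfolding P Q by (auto simp: units_mod_def)
    have sx: "[int x1 + int x2 = int x3 + int x4] (mod int q)"
      and sz: "[int z1 + int z2 = int z3 + int z4] (mod int q)"
      using PQ(1,2) unfolding P Q by auto
    have e: "?r (int x3 - int x1) = ?r (int z3 - int z1)" "?r (int x3 - int x2) = ?r (int z3 - int z2)"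
      "?r (int x1 + int x2) = ?r (int z1 + int z2)" and b: "(2 * x3 < q) = (2 * z3 < q)"
      using PQ(3) unfolding P Q by auto
    have e1: "[int x3 - int x1 = int z3 - int z1] (mod int q)"
      and e2: "[int x3 - int x2 = int z3 - int z2] (mod int q)"
      and e3: "[int x1 + int x2 = int z1 + int z2] (mod int q)"
      using e by (metis r cong_def)+
    have "[(int x3 - int x1) + (int x3 - int x2) + (int x1 + int x2) =
        (int z3 - int z1) + (int z3 - int z2) + (int z1 + int z2)] (mod int q)"
      by (intro cong_add e1 e2 e3)
    then have "[2 * int x3 = 2 * int z3] (mod int q)" by simp
    then have "int q dvd 2 * (int x3 - int z3)" by (simp add: cong_iff_dvd_diff)
    moreover have "\<bar>2 * (int x3 - int z3)\<bar> < int q"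
    proof (cases "2 * x3 < q")
      case True
      then have "2 * z3 < q" using b by simp
      then have "2 * int x3 < int q" "2 * int z3 < int q" using True by linarith+
      then show ?thesis
        unfolding abs_less_iff by (auto simp: algebra_simps intro: order_le_less_trans[rotated])
    next
      case False
      then have "\<not> 2 * z3 < q" using b by simp
      then have "2 * int x3 \<ge> int q" "2 * int z3 \<ge> int q" "int x3 < int q" "int z3 < int q"
        using False lt by linarith+
      then show ?thesis unfolding abs_less_iff by auto
    qed
    ultimately have x3: "x3 = z3"
      using dvd_imp_le_int[of "2 * (int x3 - int z3)" "int q"] by auto
    have x1: "x1 = z1" using cong_diff[OF cong_refl[of "int x3"] e1] lt x3 by (auto intro: cong_less_unique)
    have x2: "x2 = z2" using cong_diff[OF cong_refl[of "int x3"] e2] lt x3 by (auto intro: cong_less_unique)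
    have "[int x3 + int x4 = int z3 + int z4] (mod int q)"
      using sx sz x1 x2 by (metis cong_sym cong_trans)
    then have "[int x4 = int z4] (mod int q)" using x3 by (simp add: cong_add_lcancel)
    then have "x4 = z4" using lt by (auto intro: cong_less_unique)
    then show "P = Q" using P Q x1 x2 x3 by simp
  qed
  have maps: "?F ` ?N \<subseteq> ?Z \<times> UNIV"
  proof (rule image_subsetI)
    fix P assume PN: "P \<in> ?N"
    obtain x1 x2 x3 x4 where P: "P = ((x1, x2), (x3, x4))" by (metis prod.collapse)
    have xU: "x1 \<in> ?U" "x2 \<in> ?U" "x3 \<in> ?U" "x4 \<in> ?U"
      using PN unfolding P by auto
    have sx: "[int x1 + int x2 = int x3 + int x4] (mod int q)"
      and sy: "[int (?y x1) + int (?y x2) = int (?y x3) + int (?y x4)] (mod int q)"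
      using PN unfolding P by auto
    note py = partner(2)[OF assms]
    have zero: "int q dvd (int x3 - int x1) * (int x3 - int x2) * (int x1 + int x2)"
    proof -
      define X1 X2 X3 X4 Y1 Y2 Y3 Y4 where d: "X1 = int x1" "X2 = int x2" "X3 = int x3" "X4 = int x4"
        "Y1 = int (?y x1)" "Y2 = int (?y x2)" "Y3 = int (?y x3)" "Y4 = int (?y x4)"
      have p: "int q dvd X1 * Y1 - c" "int q dvd X2 * Y2 - c" "int q dvd X3 * Y3 - c" "int q dvd X4 * Y4 - c"
        using py[OF xU(1)] py[OF xU(2)] py[OF xU(3)] py[OF xU(4)] unfolding d by (simp_all add: cong_iff_dvd_diff)
      have s: "int q dvd (X1 + X2) - (X3 + X4)" and t: "int q dvd (Y1 + Y2) - (Y3 + Y4)"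
        using sx sy unfolding d by (simp_all add: cong_iff_dvd_diff)
      \<comment> \<open>the partner relation times \<open>X1 X2 X3 X4\<close>, with every \<open>Xi Yi\<close> replaced by \<open>c\<close> and \<open>X4\<close> by \<open>X1 + X2 - X3\<close>\<close>
      have "int q dvd ((Y1 + Y2) - (Y3 + Y4)) * (X1 * X2 * X3 * X4)
          - (X1 * Y1 - c) * (X2 * X3 * X4) - (X2 * Y2 - c) * (X1 * X3 * X4)
          + (X3 * Y3 - c) * (X1 * X2 * X4) + (X4 * Y4 - c) * (X1 * X2 * X3)
          - ((X1 + X2) - (X3 + X4)) * (c * X1 * X2) + ((X1 + X2) - (X3 + X4)) * (c * (X1 + X2) * X3)"
        by (intro dvd_add dvd_diff dvd_mult2[OF t] dvd_mult2[OF s] dvd_mult2[OF p(1)]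
             dvd_mult2[OF p(2)] dvd_mult2[OF p(3)] dvd_mult2[OF p(4)])
      also have "\<dots> = c * ((X3 - X1) * (X3 - X2) * (X1 + X2)) * (- 1)"
        by (simp add: algebra_simps power2_eq_square)
      finally have "int q dvd c * ((X3 - X1) * (X3 - X2) * (X1 + X2))" by simp
      then show ?thesis using assms(2) unfolding d
        by (simp add: coprime_commute coprime_dvd_mult_right_iff)
    qed
    have "[int (?r (int x3 - int x1)) * int (?r (int x3 - int x2)) * int (?r (int x1 + int x2)) =
        (int x3 - int x1) * (int x3 - int x2) * (int x1 + int x2)] (mod int q)"
      unfolding r by (intro cong_mult) (simp_all add: cong_def)
    then have "int q dvd int (?r (int x3 - int x1)) * int (?r (int x3 - int x2)) * int (?r (int x1 + int x2))"
      using zero by (simp add: cong_dvd_iff)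
    then have "q dvd ?r (int x3 - int x1) * ?r (int x3 - int x2) * ?r (int x1 + int x2)"
      by (metis int_dvd_int_iff of_nat_mult)
    moreover have "?r k < q" for k using assms(1) by (simp add: nat_less_iff)
    ultimately show "?F P \<in> ?Z \<times> UNIV" unfolding P by simp
  qed
  have finZ: "finite ?Z"
    by (rule finite_subset[of _ "{..<q} \<times> {..<q} \<times> {..<q}"]) auto
  have "card ?N \<le> card (?Z \<times> (UNIV :: bool set))"
    by (rule card_inj_on_le[OF inj maps]) (use finZ in simp)
  also have "\<dots> = card ?Z * 2" by (simp add: card_cartesian_product)
  also have "\<dots> \<le> (q * ndivs q)\<^sup>2 * 2" by (intro mult_right_mono card_product_zero_le assms) simp
  finally have N: "real (card ?N) \<le> real ((q * ndivs q)\<^sup>2 * 2)" by (simp only: of_nat_le_iff)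
  have "(\<Sum>m<q. \<Sum>n<q. norm (kloosterman q c m n) ^ 4) = real q ^ 2 * card ?N"
    unfolding sq by (rule parseval_unit_root[OF assms(1)]) simp
  also have "\<dots> \<le> real q ^ 2 * real ((q * ndivs q)\<^sup>2 * 2)"
    by (intro mult_left_mono N) simp
  also have "\<dots> = 2 * real q ^ 4 * real (ndivs q) ^ 2"
    by (simp add: power_mult_distrib power2_eq_square power4_eq_xxxx)
  finally show ?thesis .
qed

text \<open>The orbit of \<open>(m, n)\<close> contributes \<open>\<phi>(q)\<close> equal terms to the fourth moment. A pair of frequencies
  is reached from at most \<open>gcd m q\<close> units \<open>v\<close>, because \<open>m v\<close> determines \<open>v\<close> up to that many choices.\<close>

lemma kloosterman_bound_gcd:
  assumes "q > 0" "coprime c (int q)" "m < q"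
  shows "real (totient q) * norm (kloosterman q c m n) ^ 4 \<le> real (gcd m q) * (2 * real q ^ 4 * real (ndivs q) ^ 2)"
proof -
  let ?U = "units_mod q"
  let ?a = "\<lambda>v. ((m * v) mod q, (n * partner q 1 v) mod q)"
  let ?g = "\<lambda>p. norm (kloosterman q c (fst p) (snd p)) ^ 4"
  have "real (totient q) * norm (kloosterman q c m n) ^ 4 = (\<Sum>v\<in>?U. ?g (?a v))"
    using kloosterman_twist[OF assms(1,2)] by (simp add: card_units_mod[OF assms(1)])
  also have "\<dots> = (\<Sum>p\<in>?a ` ?U. real (card {v \<in> ?U. ?a v = p}) * ?g p)"
    by (subst sum.image_gen[where g = ?a]) (auto intro!: sum.cong simp: mult.commute)
  also have "\<dots> \<le> (\<Sum>p\<in>?a ` ?U. real (gcd m q) * ?g p)"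
  proof (intro sum_mono mult_right_mono)
    fix p
    have "{v \<in> ?U. ?a v = p} \<subseteq> {v. v < q \<and> [m * v = fst p] (mod q)}"
      by (auto simp: units_mod_def cong_def)
    then have "card {v \<in> ?U. ?a v = p} \<le> card {v. v < q \<and> [m * v = fst p] (mod q)}"
      by (intro card_mono) auto
    also have "\<dots> \<le> gcd m q" by (rule card_linear_cong_le[OF assms(1)])
    finally show "real (card {v \<in> ?U. ?a v = p}) \<le> real (gcd m q)" by simp
  qed simp
  also have "\<dots> \<le> (\<Sum>p\<in>{..<q} \<times> {..<q}. real (gcd m q) * ?g p)"
    by (rule sum_mono2) (use assms(1) in auto)
  also have "\<dots> = real (gcd m q) * (\<Sum>m<q. \<Sum>n<q. norm (kloosterman q c m n) ^ 4)"
    by (simp add: sum_distrib_left[symmetric] sum.cartesian_product split_def)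
  also have "\<dots> \<le> real (gcd m q) * (2 * real q ^ 4 * real (ndivs q) ^ 2)"
    by (intro mult_left_mono kloosterman_fourth_moment assms) simp
  finally show ?thesis .
qed

lemma totient_times_ndivs_ge:
  assumes "q > 0" shows "q \<le> totient q * ndivs q"
proof -
  have "q = (\<Sum>d | d dvd q. totient d)" by (rule totient_divisor_sum[symmetric])
  also have "\<dots> \<le> (\<Sum>d | d dvd q. totient q)"
    by (intro sum_mono dvd_imp_le) (use assms in \<open>auto intro: totient_dvd\<close>)
  finally show ?thesis by (simp add: ndivs_def mult.commute)
qed

lemma fourth_root_power: "x \<ge> 0 \<Longrightarrow> (x powr (1 / 4)) ^ 4 = (x :: real)"
  by (cases "x = 0") (simp_all flip: powr_realpow add: powr_powr)

text \<open>This is \<open>q\<close> to the power \<open>3/4 + o(1)\<close>. In \<open>kloosterman_bound\<close> the fourth root of the gcd is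
  weakened to the gcd itself: summed against the Fourier coefficients of an interval it still costs
  only a divisor function and a logarithm.\<close>

definition kloosterman_size :: "nat \<Rightarrow> real" where
  "kloosterman_size q = (2 * real q ^ 3 * real (ndivs q) ^ 3) powr (1 / 4)"

lemma kloosterman_bound:
  assumes "q > 0" "coprime c (int q)" "m < q"
  shows "norm (kloosterman q c m n) \<le> real (gcd m q) * kloosterman_size q"
proof -
  let ?K = "norm (kloosterman q c m n)"
  have g: "real (gcd m q) \<ge> 1" using assms(1) by (simp add: Suc_le_eq)
  have "real q * ?K ^ 4 \<le> real (totient q * ndivs q) * ?K ^ 4"
    using totient_times_ndivs_ge[OF assms(1)] by (intro mult_right_mono) (simp_all only: of_nat_le_iff, simp)
  also have "\<dots> = real (ndivs q) * (real (totient q) * ?K ^ 4)" by simp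
  also have "\<dots> \<le> real (ndivs q) * (real (gcd m q) * (2 * real q ^ 4 * real (ndivs q) ^ 2))"
    by (intro mult_left_mono kloosterman_bound_gcd assms) simp
  also have "\<dots> = real q * (real (gcd m q) * (2 * real q ^ 3 * real (ndivs q) ^ 3))"
    by (simp add: power_numeral_reduce)
  finally have "?K ^ 4 \<le> real (gcd m q) * (2 * real q ^ 3 * real (ndivs q) ^ 3)"
    using assms(1) by simp
  also have "\<dots> \<le> real (gcd m q) ^ 4 * (2 * real q ^ 3 * real (ndivs q) ^ 3)"
    using g by (intro mult_right_mono) (auto simp: self_le_power)
  also have "\<dots> = (real (gcd m q) * kloosterman_size q) ^ 4"
    using fourth_root_power[of "2 * real q ^ 3 * real (ndivs q) ^ 3"]
    by (simp add: kloosterman_size_def power_mult_distrib)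
  finally show ?thesis
    by (rule power_le_imp_le_base[of _ 3, simplified]) (simp add: kloosterman_size_def)
qed

section \<open>Points on a modular hyperbola in a box\<close>

lemma half_le_sin:
  fixes x :: real
  assumes "0 \<le> x" "x \<le> pi / 2"
  shows "x / 2 \<le> sin x"
proof (cases "x \<le> pi / 3")
  case True
  have "(\<lambda>x. sin x - x / 2) 0 \<le> (\<lambda>x. sin x - x / 2) x"
  proof (rule DERIV_nonneg_imp_nondecreasing[OF assms(1)])
    fix z assume z: "0 \<le> z" "z \<le> x"
    have "cos (pi / 3) \<le> cos z" using z True by (intro cos_monotone_0_pi_le) auto
    then show "\<exists>y. ((\<lambda>x. sin x - x / 2) has_real_derivative y) (at z) \<and> 0 \<le> y"
      by (intro exI[of _ "cos z - 1 / 2"]) (auto intro!: derivative_eq_intros simp: cos_60)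
  qed
  then show ?thesis by simp
next
  case False
  have "sin (pi / 3) \<le> sin x" using assms False by (intro sin_monotone_2pi_le) auto
  moreover have "sqrt 3 / 2 \<ge> (17 / 20 :: real)" 
    using real_le_rsqrt[of "17/10" 3] by (simp add: power2_eq_square)
  moreover have "pi / 4 \<le> 17 / 20" using pi_approx by simp
  ultimately show ?thesis using assms(2) by (simp add: sin_60)
qed

text \<open>The geometric series has the denominator \<open>2 sin (\<pi> m / q)\<close>, which is at least of the order of the
  distance from \<open>m / q\<close> to the nearest integer. The sum of two reciprocals stands for the larger one.\<close>

lemma norm_sum_unit_root_le:
  fixes m q :: nat
  assumes "0 < m" "m < q"
  shows "norm (\<Sum>k<L. unit_root q (- int m * (u0 + int k))) \<le> real q * (1 / real m + 1 / real (q - m))"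
proof -
  let ?w = "unit_root q (- int m)"
  define th where "th = pi * real m / real q"
  have q: "real q > 0" "real m > 0" "real (q - m) > 0" using assms by auto
  have th: "0 < th" "th < pi" using assms by (auto simp: th_def field_simps)
  have nw: "norm (?w - 1) = 2 * sin th"
  proof -
    have "?w = cis (2 * (- th))" by (simp add: unit_root_def th_def mult.assoc)
    also have "\<dots> - 1 = cis (- th) * (cis (- th) - cis th)"
      by (simp add: cis_mult right_diff_distrib)
    finally have "norm (?w - 1) = norm (cis (- th) - cis th)" by (simp add: norm_mult)
    also have "cis (- th) - cis th = - (2 * sin th) * \<i>" by (simp add: complex_eq_iff)
    also have "norm \<dots> = 2 * \<bar>sin th\<bar>" by (simp add: norm_mult)
    also have "\<bar>sin th\<bar> = sin th" using th by (simp add: sin_ge_zero)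
    finally show ?thesis .
  qed
  have sin_pos: "sin th > 0" using th by (rule sin_gt_zero)
  then have ne: "?w \<noteq> 1" using nw by auto
  have "(\<Sum>k<L. unit_root q (- int m * (u0 + int k))) = unit_root q (- int m * u0) * (\<Sum>k<L. ?w ^ k)"
    unfolding sum_distrib_left
  proof (rule sum.cong[OF refl])
    fix k
    have "- int m * (u0 + int k) = - int m * u0 + int k * (- int m)" by (simp add: algebra_simps)
    then show "unit_root q (- int m * (u0 + int k)) = unit_root q (- int m * u0) * ?w ^ k"
      by (simp only: unit_root_add unit_root_power)
  qed
  also have "(\<Sum>k<L. ?w ^ k) = (?w ^ L - 1) / (?w - 1)" by (rule geometric_sum[OF ne])
  finally have "norm (\<Sum>k<L. unit_root q (- int m * (u0 + int k))) = norm (?w ^ L - 1) / (2 * sin th)"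
    by (simp only: norm_mult norm_divide nw norm_unit_root mult_1)
  also have "\<dots> \<le> 2 / (2 * sin th)"
  proof (intro divide_right_mono)
    have "norm (?w ^ L - 1) \<le> norm (?w ^ L) + norm (1 :: complex)" by (rule norm_triangle_ineq4)
    then show "norm (?w ^ L - 1) \<le> 2" by (simp add: norm_power)
  qed (use sin_pos in simp)
  also have "\<dots> = 1 / sin th" by simp
  also have "\<dots> \<le> real q * (1 / real m + 1 / real (q - m))"
  proof (cases "2 * m \<le> q")
    case True
    then have "th \<le> pi / 2" using q by (simp add: th_def field_simps)
    then have "th / 2 \<le> sin th" using th by (intro half_le_sin) auto
    moreover have "real m / real q \<le> th / 2"
      unfolding th_def using q pi_ge_two by (simp add: field_simps)
    ultimately have "real m / real q \<le> sin th" by linarith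
    then have "1 / sin th \<le> 1 / (real m / real q)" using q sin_pos by (intro divide_left_mono) auto
    also have "\<dots> = real q * (1 / real m)" by simp
    also have "\<dots> \<le> real q * (1 / real m + 1 / real (q - m))" using q by (intro mult_left_mono) auto
    finally show ?thesis .
  next
    case False
    have e: "pi - th = pi * real (q - m) / real q" using assms q by (simp add: th_def of_nat_diff field_simps)
    have "pi * real q \<le> pi * (2 * real m)" using False by (intro mult_left_mono) auto
    then have "pi - th \<le> pi / 2" using q by (simp add: th_def field_simps)
    then have "(pi - th) / 2 \<le> sin (pi - th)" using th by (intro half_le_sin) auto
    moreover have "1 * (real (q - m) / real q) \<le> pi / 2 * (real (q - m) / real q)"
      using pi_ge_two by (intro mult_right_mono) auto
    moreover have "pi / 2 * (real (q - m) / real q) = (pi - th) / 2"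
      unfolding e by simp
    moreover have "sin (pi - th) = sin th" by simp
    ultimately have "real (q - m) / real q \<le> sin th" by linarith
    then have "1 / sin th \<le> 1 / (real (q - m) / real q)" using q sin_pos by (intro divide_left_mono) auto
    also have "\<dots> = real q * (1 / real (q - m))" by simp
    also have "\<dots> \<le> real q * (1 / real m + 1 / real (q - m))" using q by (intro mult_left_mono) auto
    finally show ?thesis .
  qed
  finally show ?thesis .
qed

lemma harm_le_ln: "0 < n \<Longrightarrow> (\<Sum>k=1..n. 1 / real k) \<le> 1 + ln (real n)"
proof (induction n rule: nat_induct_non_zero)
  case (Suc n)
  have "1 / real (Suc n) \<le> ln (real (Suc n)) - ln (real n)"
  proof -
    have "ln (real n / real (Suc n)) \<le> real n / real (Suc n) - 1"
      using Suc by (intro ln_le_minus_one) auto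
    also have "\<dots> = - (1 / real (Suc n))" by (simp add: field_simps)
    finally show ?thesis using Suc by (simp add: ln_div)
  qed
  then show ?case using Suc.IH by simp
qed simp

text \<open>The symmetry \<open>m \<mapsto> q - m\<close> reduces the claim to the sum of \<open>gcd m q / m\<close>; replacing the gcd by the
  sum of all common divisors and summing over \<open>m\<close> first leaves one harmonic sum per divisor of \<open>q\<close>.\<close>

lemma sum_gcd_over_le:
  assumes "q > 0"
  shows "(\<Sum>m=1..<q. real (gcd m q) * (1 / real m + 1 / real (q - m))) \<le> 2 * real (ndivs q) * (1 + ln (real q))"
proof -
  let ?h = "\<lambda>m. real (gcd m q) / real m"
  have gcd_diff: "gcd (q - m) q = gcd m q" if "m < q" for m
  proof -
    have "gcd (q - m) q = gcd (q - m) ((q - m) + m)" using that by simp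
    also have "\<dots> = gcd (q - m) m" by (rule gcd_add2)
    also have "\<dots> = gcd q m" using that by (intro gcd_diff1_nat) simp
    finally show ?thesis by (simp add: gcd.commute)
  qed
  have "(\<Sum>m=1..<q. real (gcd m q) / real (q - m)) = (\<Sum>m=1..<q. ?h m)"
    by (rule sum.reindex_bij_witness[where i = "\<lambda>m. q - m" and j = "\<lambda>m. q - m"])
       (auto simp: gcd_diff)
  then have "(\<Sum>m=1..<q. real (gcd m q) * (1 / real m + 1 / real (q - m))) = 2 * (\<Sum>m=1..<q. ?h m)"
    by (simp add: distrib_left sum.distrib)
  also have "(\<Sum>m=1..<q. ?h m) \<le> (\<Sum>m=1..<q. (\<Sum>d | d dvd q. if d dvd m then real d else 0) / real m)"
  proof (intro sum_mono divide_right_mono)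
    fix m
    have "real (gcd m q) \<le> real (\<Sum>d | d dvd q. if d dvd m then d else 0)"
      using gcd_le_sum_divisors[OF assms, of m] by (simp only: of_nat_le_iff)
    then show "real (gcd m q) \<le> (\<Sum>d | d dvd q. if d dvd m then real d else 0)"
      by (simp add: if_distrib cong: if_cong)
  qed simp
  also have "\<dots> = (\<Sum>d | d dvd q. \<Sum>m=1..<q. (if d dvd m then real d else 0) / real m)"
    by (simp add: sum_divide_distrib) (rule sum.swap)
  also have "\<dots> \<le> (\<Sum>d | d dvd q. 1 + ln (real q))"
  proof (rule sum_mono)
    fix d assume "d \<in> {d. d dvd q}"
    then have d: "d dvd q" "d > 0" using assms by (auto intro: Nat.gr0I)
    have "(\<Sum>m=1..<q. (if d dvd m then real d else 0) / real m) = (\<Sum>m\<in>{m\<in>{1..<q}. d dvd m}. real d / real m)"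
      by (subst sum.inter_filter) (auto intro!: sum.cong)
    also have "\<dots> = (\<Sum>k\<in>(\<lambda>m. m div d) ` {m\<in>{1..<q}. d dvd m}. 1 / real k)"
      by (subst sum.reindex) (use d in \<open>auto simp: inj_on_def elim!: dvdE intro!: sum.cong\<close>)
    also have "\<dots> \<le> (\<Sum>k\<in>{1..q}. 1 / real k)"
    proof (rule sum_mono2)
      show "(\<lambda>m. m div d) ` {m\<in>{1..<q}. d dvd m} \<subseteq> {1..q}"
        using d(2) by (auto elim!: dvdE simp: Suc_le_eq intro: order_trans[OF _ less_imp_le])
           (metis One_nat_def Suc_leI less_or_eq_imp_le le_trans mult_le_mono1 mult_1)
    qed auto
    also have "\<dots> \<le> 1 + ln (real q)" by (rule harm_le_ln[OF assms])
    finally show "(\<Sum>m=1..<q. (if d dvd m then real d else 0) / real m) \<le> 1 + ln (real q)" .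
  qed
  also have "\<dots> = real (ndivs q) * (1 + ln (real q))" by (simp add: ndivs_def)
  finally show ?thesis by simp
qed

text \<open>The factor \<open>G\<close> bounds the sum of the nonzero Fourier coefficients of an interval, weighted by the gcd with
  the modulus and divided by \<open>q\<close>.\<close>

definition hyperbola_error :: "nat \<Rightarrow> real" where
  "hyperbola_error q = (let G = 2 * real (ndivs q) * (1 + ln (real q)) in kloosterman_size q * (G * (2 + G)))"

text \<open>Expand the conditions \<open>x \<equiv> u\<close> and \<open>y \<equiv> v\<close> into additive characters. The pair of zero frequencies
  yields the expected number of points, the others a Kloosterman sum times the Fourier coefficients
  of the two sides of the box.\<close>

lemma hyperbola_box_count:
  fixes u0 v0 c :: int and L A q :: nat
  assumes "q > 0" "coprime c (int q)" "L \<le> q" "A \<le> q"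
  defines "N \<equiv> card {(u, v). u \<in> {u0..<u0 + int L} \<and> v \<in> {v0..<v0 + int A} \<and> [u * v = c] (mod int q)}"
  shows "\<bar>real N - real (totient q) / real q ^ 2 * real L * real A\<bar> \<le> hyperbola_error q"
proof -
  let ?U = "units_mod q" and ?y = "partner q c"
  let ?uh = "\<lambda>m. (\<Sum>k<L. unit_root q (- int m * (u0 + int k)))"
  let ?vh = "\<lambda>n. (\<Sum>l<A. unit_root q (- int n * (v0 + int l)))"
  let ?K = "kloosterman q c"
  let ?P = "{(k, l). k < L \<and> l < A \<and> [(u0 + int k) * (v0 + int l) = c] (mod int q)}"
  have N: "N = card ?P"
    unfolding N_def
    by (rule bij_betw_same_card[of "\<lambda>(u, v). (nat (u - u0), nat (v - v0))"])
       (rule bij_betwI[where g = "\<lambda>(k, l). (u0 + int k, v0 + int l)"], auto)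
  have finP: "finite ?P" by (rule finite_subset[of _ "{..<L} \<times> {..<A}"]) auto
  have point: "(\<Sum>x\<in>?U. (\<Sum>m<q. unit_root q (int m * (int x - u))) * (\<Sum>n<q. unit_root q (int n * (int (?y x) - v))))
      = (if [u * v = c] (mod int q) then of_nat q ^ 2 else 0)" for u v
  proof -
    have "(\<Sum>x\<in>?U. (\<Sum>m<q. unit_root q (int m * (int x - u))) * (\<Sum>n<q. unit_root q (int n * (int (?y x) - v))))
      = (\<Sum>x\<in>?U. if [int x = u] (mod int q) \<and> [int (?y x) = v] (mod int q) then of_nat q ^ 2 else 0)"
      by (intro sum.cong refl) (simp add: sum_unit_root[OF assms(1)] cong_iff_dvd_diff power2_eq_square)
    also have "\<dots> = (\<Sum>x\<in>{x\<in>?U. [int x = u] (mod int q) \<and> [int (?y x) = v] (mod int q)}. of_nat q ^ 2)"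
      by (rule sum.inter_filter[symmetric]) simp
    also have "{x\<in>?U. [int x = u] (mod int q) \<and> [int (?y x) = v] (mod int q)} =
       (if [u * v = c] (mod int q) then {nat (u mod int q)} else {})" (is "?X = ?Y")
    proof (intro equalityI subsetI)
      fix x assume x: "x \<in> ?X"
      then have "[u * v = int x * int (?y x)] (mod int q)" by (intro cong_mult) (auto simp: cong_sym_eq)
      then have "[u * v = c] (mod int q)" using partner(2)[OF assms(1,2)] x cong_trans by blast
      moreover have "x = nat (u mod int q)"
        using x by (auto simp: cong_def units_mod_def)
      ultimately show "x \<in> ?Y" by simp
    next
      fix x assume x: "x \<in> ?Y"
      then have uv: "[u * v = c] (mod int q)" and xu: "x = nat (u mod int q)" by (auto split: if_splits)
      have ix: "int x = u mod int q" using xu assms(1) by simp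
      have cx: "[int x = u] (mod int q)" unfolding ix by (simp add: cong_def)
      have "coprime (u * v) (int q)" using assms(2) uv cong_imp_coprime cong_sym by blast
      then have "coprime u (int q)" by simp
      then have "coprime (int x) (int q)" using cx cong_imp_coprime cong_sym by blast
      then have "coprime x q" by (simp only: coprime_int_iff)
      moreover have "x < q" using xu assms(1) by (simp add: nat_less_iff)
      ultimately have xU: "x \<in> ?U" by (simp add: units_mod_def)
      have "[int x * v = u * v] (mod int q)" by (intro cong_mult cx cong_refl)
      then have "[int x * v = c] (mod int q)" using uv cong_trans by blast
      then have "[v = int (?y x)] (mod int q)" using partner_unique[OF assms(1,2) xU] by blast
      then show "x \<in> ?X" using xU cx by (simp add: cong_sym_eq)
    qed
    finally show ?thesis by simp
  qed
  have id: "(\<Sum>m<q. \<Sum>n<q. ?K m n * ?uh m * ?vh n) = of_nat q ^ 2 * of_nat N"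
  proof -
    have "(\<Sum>m<q. \<Sum>n<q. ?K m n * ?uh m * ?vh n) =
      (\<Sum>m<q. \<Sum>n<q. \<Sum>x\<in>?U. (\<Sum>k<L. unit_root q (int m * (int x - (u0 + int k)))) * (\<Sum>l<A. unit_root q (int n * (int (?y x) - (v0 + int l)))))"
    proof (intro sum.cong refl)
      fix m n
      have "?K m n * ?uh m * ?vh n = (\<Sum>x\<in>?U. (unit_root q (int m * int x) * ?uh m) * (unit_root q (int n * int (?y x)) * ?vh n))"
        unfolding kloosterman_def unit_root_add sum_distrib_right by (simp only: mult_ac)
      also have "\<dots> = (\<Sum>x\<in>?U. (\<Sum>k<L. unit_root q (int m * (int x - (u0 + int k)))) * (\<Sum>l<A. unit_root q (int n * (int (?y x) - (v0 + int l)))))"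
        by (intro sum.cong refl arg_cong2[where f = "(*)"]; simp only: sum_distrib_left unit_root_add[symmetric]; intro sum.cong refl arg_cong[where f = "unit_root q"]; simp add: algebra_simps)
      finally show "?K m n * ?uh m * ?vh n = \<dots>" .
    qed
    also have "\<dots> = (\<Sum>m<q. \<Sum>n<q. \<Sum>x\<in>?U. \<Sum>k<L. \<Sum>l<A. unit_root q (int m * (int x - (u0 + int k))) * unit_root q (int n * (int (?y x) - (v0 + int l))))"
      by (simp only: sum_product)
    also have "\<dots> = (\<Sum>x\<in>?U. \<Sum>m<q. \<Sum>n<q. \<Sum>k<L. \<Sum>l<A. unit_root q (int m * (int x - (u0 + int k))) * unit_root q (int n * (int (?y x) - (v0 + int l))))"
      by (rule trans[OF sum.cong[OF refl sum.swap] sum.swap])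
    also have "\<dots> = (\<Sum>x\<in>?U. \<Sum>k<L. \<Sum>l<A. \<Sum>m<q. \<Sum>n<q. unit_root q (int m * (int x - (u0 + int k))) * unit_root q (int n * (int (?y x) - (v0 + int l))))"
      by (intro sum.cong refl sum_swap_pairs)
    also have "\<dots> = (\<Sum>k<L. \<Sum>l<A. \<Sum>x\<in>?U. (\<Sum>m<q. unit_root q (int m * (int x - (u0 + int k)))) * (\<Sum>n<q. unit_root q (int n * (int (?y x) - (v0 + int l)))))"
      by (subst sum.swap, rule sum.cong[OF refl], subst sum.swap, simp only: sum_product)
    also have "\<dots> = (\<Sum>k<L. \<Sum>l<A. if (k, l) \<in> ?P then of_nat q ^ 2 else 0)"
      unfolding point by (intro sum.cong refl) auto
    also have "\<dots> = (\<Sum>p\<in>({..<L} \<times> {..<A}) \<inter> ?P. of_nat q ^ 2)"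
      unfolding sum.cartesian_product split_def prod.collapse by (subst sum.inter_restrict) simp_all
    also have "\<dots> = (\<Sum>p\<in>?P. of_nat q ^ 2)" by (rule sum.cong) auto
    also have "\<dots> = of_nat q ^ 2 * of_nat N" by (simp add: N)
    finally show ?thesis .
  qed
  define G where "G = 2 * real (ndivs q) * (1 + ln (real q))"
  let ?B = "kloosterman_size q" and ?w = "\<lambda>m. 1 / real m + 1 / real (q - m)"
  have B: "?B \<ge> 0" by (simp add: kloosterman_size_def)
  have qp: "real q > 0" using assms(1) by simp
  have sG: "(\<Sum>m=1..<q. real (gcd m q) * ?w m) \<le> G"
    unfolding G_def by (rule sum_gcd_over_le[OF assms(1)])
  have G0: "G \<ge> 0" using assms(1) by (simp add: G_def)
  have uh0: "norm (?uh 0) \<le> real q" and vh0: "norm (?vh 0) \<le> real q" using assms(3,4) by simp_all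
  have uh: "norm (?uh m) \<le> real q * ?w m" and vh: "norm (?vh m) \<le> real q * ?w m" if "m \<in> {1..<q}" for m
    using that norm_sum_unit_root_le[of m q] by auto
  have w0: "?w m \<ge> 0" for m by simp
  have split: "(\<Sum>m<q. f m) = f 0 + (\<Sum>m=1..<q. f m)" for f :: "nat \<Rightarrow> 'z::comm_monoid_add"
    using assms(1) by (metis atLeast0LessThan One_nat_def sum.atLeast_Suc_lessThan)
  have vsum: "(\<Sum>n<q. norm (?vh n)) \<le> real q * (1 + G)"
  proof -
    have "(\<Sum>n=1..<q. norm (?vh n)) \<le> (\<Sum>n=1..<q. real q * (real (gcd n q) * ?w n))"
    proof (rule sum_mono)
      fix n assume n: "n \<in> {1..<q}"
      have "1 * ?w n \<le> real (gcd n q) * ?w n" using assms(1) by (intro mult_right_mono w0) (simp add: Suc_le_eq)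
      then have "real q * ?w n \<le> real q * (real (gcd n q) * ?w n)" by (intro mult_left_mono) auto
      then show "norm (?vh n) \<le> real q * (real (gcd n q) * ?w n)" using vh[OF n] by linarith
    qed
    also have "\<dots> \<le> real q * G" unfolding sum_distrib_left[symmetric] using sG by (intro mult_left_mono) auto
    finally show ?thesis unfolding split using vh0 by (simp add: distrib_left)
  qed
  have row0: "norm (\<Sum>n=1..<q. ?K 0 n * ?uh 0 * ?vh n) \<le> real q ^ 2 * (?B * G)"
  proof -
    have "norm (\<Sum>n=1..<q. ?K 0 n * ?uh 0 * ?vh n) \<le> (\<Sum>n=1..<q. (real (gcd n q) * ?B) * real q * (real q * ?w n))"
    proof (rule sum_norm_le)
      fix n assume n: "n \<in> {1..<q}"
      have "norm (?K 0 n) \<le> real (gcd n q) * ?B"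
        using kloosterman_bound[OF assms(1,2), of n 0] n kloosterman_commute[OF assms(1,2), of 0 n] by simp
      then show "norm (?K 0 n * ?uh 0 * ?vh n) \<le> (real (gcd n q) * ?B) * real q * (real q * ?w n)"
        unfolding norm_mult by (intro mult_mono uh0 vh n) (use B in auto)
    qed
    also have "\<dots> = real q ^ 2 * ?B * (\<Sum>n=1..<q. real (gcd n q) * ?w n)"
      unfolding sum_distrib_left by (intro sum.cong refl) (simp add: power2_eq_square mult_ac)
    also have "\<dots> \<le> real q ^ 2 * ?B * G" using sG B by (intro mult_left_mono) auto
    finally show ?thesis by (simp add: mult_ac)
  qed
  have rows: "norm (\<Sum>m=1..<q. \<Sum>n<q. ?K m n * ?uh m * ?vh n) \<le> real q ^ 2 * (?B * (G * (1 + G)))"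
  proof -
    have "norm (\<Sum>m=1..<q. \<Sum>n<q. ?K m n * ?uh m * ?vh n) \<le> (\<Sum>m=1..<q. (real (gcd m q) * ?B) * (real q * ?w m) * (real q * (1 + G)))"
    proof (rule sum_norm_le)
      fix m assume m: "m \<in> {1..<q}"
      have "norm (\<Sum>n<q. ?K m n * ?uh m * ?vh n) \<le> (\<Sum>n<q. (real (gcd m q) * ?B) * (real q * ?w m) * norm (?vh n))"
      proof (rule sum_norm_le)
        fix n assume "n \<in> {..<q}"
        have "norm (?K m n) \<le> real (gcd m q) * ?B" using kloosterman_bound[OF assms(1,2), of m n] m by simp
        then show "norm (?K m n * ?uh m * ?vh n) \<le> (real (gcd m q) * ?B) * (real q * ?w m) * norm (?vh n)"
          unfolding norm_mult by (intro mult_mono uh m order_refl) (use B in auto)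
      qed
      also have "\<dots> = (real (gcd m q) * ?B) * (real q * ?w m) * (\<Sum>n<q. norm (?vh n))"
        by (simp only: sum_distrib_left)
      also have "\<dots> \<le> (real (gcd m q) * ?B) * (real q * ?w m) * (real q * (1 + G))"
        by (intro mult_left_mono vsum) (use B in auto)
      finally show "norm (\<Sum>n<q. ?K m n * ?uh m * ?vh n) \<le> \<dots>" .
    qed
    also have "\<dots> = real q ^ 2 * ?B * (1 + G) * (\<Sum>m=1..<q. real (gcd m q) * ?w m)"
      unfolding sum_distrib_left by (intro sum.cong refl) (simp add: power2_eq_square mult_ac)
    also have "\<dots> \<le> real q ^ 2 * ?B * (1 + G) * G" using sG B G0 by (intro mult_left_mono) auto
    finally show ?thesis by (simp add: mult_ac)
  qed
  have main: "?K 0 0 * ?uh 0 * ?vh 0 = of_real (real (totient q) * real L * real A)"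
    by (simp add: kloosterman_def card_units_mod[OF assms(1)])
  have "of_nat q ^ 2 * of_nat N - complex_of_real (real (totient q) * real L * real A) =
     (\<Sum>n=1..<q. ?K 0 n * ?uh 0 * ?vh n) + (\<Sum>m=1..<q. \<Sum>n<q. ?K m n * ?uh m * ?vh n)"
    unfolding id[symmetric] main[symmetric] split[of "\<lambda>m. \<Sum>n<q. ?K m n * ?uh m * ?vh n"]
      split[of "\<lambda>n. ?K 0 n * ?uh 0 * ?vh n"] by simp
  then have "norm (complex_of_real (real q ^ 2 * real N - real (totient q) * real L * real A)) \<le>
     real q ^ 2 * (?B * G) + real q ^ 2 * (?B * (G * (1 + G)))"
    using norm_triangle_mono[OF row0 rows] by simp
  then have "\<bar>real q ^ 2 * real N - real (totient q) * real L * real A\<bar> \<le> real q ^ 2 * (?B * (G * (2 + G)))"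
    unfolding norm_of_real by (simp add: algebra_simps)
  moreover have "\<bar>real q ^ 2 * real N - real (totient q) * real L * real A\<bar> =
     real q ^ 2 * \<bar>real N - real (totient q) / real q ^ 2 * real L * real A\<bar>"
  proof -
    have "real q ^ 2 * real N - real (totient q) * real L * real A =
       real q ^ 2 * (real N - real (totient q) / real q ^ 2 * real L * real A)"
      using qp by (simp add: field_simps)
    then show ?thesis by (simp add: abs_mult)
  qed
  ultimately show ?thesis using qp by (simp add: hyperbola_error_def G_def[symmetric] Let_def)
qed

section \<open>The divisor bound\<close>

lemma ndivs_mult_le:
  assumes "a > 0" "b > 0"
  shows "ndivs (a * b) \<le> ndivs a * ndivs b"
proof -
  have "{d. d dvd a * b} \<subseteq> (\<lambda>(x, y). x * y) ` ({d. d dvd a} \<times> {d. d dvd b})"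
  proof
    fix d assume "d \<in> {d. d dvd a * b}"
    then obtain x y where "d = x * y" "x dvd a" "y dvd b"
      using division_decomp[of d a b] by auto
    then show "d \<in> (\<lambda>(x, y). x * y) ` ({d. d dvd a} \<times> {d. d dvd b})" by force
  qed
  then have "ndivs (a * b) \<le> card ((\<lambda>(x, y). x * y) ` ({d. d dvd a} \<times> {d. d dvd b}))"
    unfolding ndivs_def by (intro card_mono finite_imageI finite_cartesian_product finite_divisors assms)
  also have "\<dots> \<le> card ({d. d dvd a} \<times> {d. d dvd b})"
    by (intro card_image_le finite_cartesian_product finite_divisors assms)
  finally show ?thesis by (simp add: ndivs_def card_cartesian_product)
qed

lemma ndivs_prime_power: "prime p \<Longrightarrow> ndivs (p ^ k) \<le> k + 1"
proof -
  assume p: "prime p"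
  have "{d. d dvd p ^ k} = (\<lambda>i. p ^ i) ` {..k}"
    using divides_primepow_nat[OF p] by auto
  then show ?thesis unfolding ndivs_def using card_image_le[of "{..k}" "\<lambda>i. p ^ i"] by simp
qed

text \<open>If \<open>p\<^sup>e\<close> is the exact power of \<open>p\<close> dividing \<open>n\<close>, then it contributes the factor \<open>e + 1\<close>. For
  \<open>p \<ge> 2 powr (1 / \<delta>)\<close> this is at most \<open>2\<^sup>e \<le> (p\<^sup>e) powr \<delta>\<close>; each of the finitely many smaller primes
  costs a further constant \<open>D\<close>.\<close>

lemma ndivs_bound:
  fixes \<delta> :: real
  assumes "\<delta> > 0"
  obtains C where "C \<ge> 1" "\<And>n. n > 0 \<Longrightarrow> real (ndivs n) \<le> C * real n powr \<delta>"
proof -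
  \<comment> \<open>from \<open>P\<close> on, \<open>p powr \<delta> \<ge> 2\<close>; the constant \<open>D\<close> comes from \<open>1 + \<delta> e ln 2 \<le> 2 powr (\<delta> e)\<close>\<close>
  define P where "P = nat \<lceil>2 powr (1 / \<delta>)\<rceil>"
  define D where "D = 1 + 1 / (\<delta> * ln 2)"
  have dl: "\<delta> * ln 2 > 0" using assms by simp
  have D1: "D \<ge> 1" using dl by (simp add: D_def)
  have large: "real e + 1 \<le> real (p ^ e) powr \<delta>" if "p \<ge> P" "prime p" for p e
  proof -
    have "2 powr (1 / \<delta>) \<le> real p" using that by (simp add: P_def nat_le_iff ceiling_le_iff)
    then have "(2 powr (1 / \<delta>)) powr \<delta> \<le> real p powr \<delta>" using assms by (intro powr_mono2) auto
    then have p2: "2 \<le> real p powr \<delta>" using assms by (simp add: powr_powr)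
    have "real e + 1 \<le> 2 ^ e" using of_nat_mono[OF Suc_leI[OF less_exp[of e]], where 'a = real] by simp
    also have "\<dots> \<le> (real p powr \<delta>) ^ e" using p2 by (intro power_mono) auto
    also have "\<dots> = real (p ^ e) powr \<delta>"
      using prime_gt_0_nat[OF that(2)] by (simp add: powr_powr powr_realpow[symmetric] mult.commute)
    finally show ?thesis .
  qed
  have small: "real e + 1 \<le> D * real (p ^ e) powr \<delta>" if "prime p" for p e
  proof -
    have "real e + 1 \<le> D * (1 + \<delta> * ln 2 * real e)"
      using assms dl by (simp add: D_def distrib_right distrib_left)
    also have "\<dots> \<le> D * exp (\<delta> * ln 2 * real e)" using D1 by (intro mult_left_mono exp_ge_add_one_self) auto
    also have "exp (\<delta> * ln 2 * real e) = real (2 ^ e) powr \<delta>"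
      by (simp add: powr_def ln_realpow mult_ac)
    also have "D * real (2 ^ e) powr \<delta> \<le> D * real (p ^ e) powr \<delta>"
      using D1 assms prime_ge_2_nat[OF that] by (intro mult_left_mono powr_mono2 of_nat_mono power_mono) auto
    finally show ?thesis .
  qed
  define s where "s n = card {p. prime p \<and> p dvd n \<and> p < P}" for n :: nat
  have fin: "finite {p. prime p \<and> p dvd n \<and> p < P}" for n :: nat
    by (rule finite_subset[of _ "{..<P}"]) auto
  have main: "real (ndivs n) \<le> D ^ s n * real n powr \<delta>" if "n > 0" for n
    using that
  proof (induction n rule: less_induct)
    case (less n)
    show ?case
    proof (cases "n = 1")
      case True
      then show ?thesis using D1 by (simp add: ndivs_def s_def)
    next
      case False
      then obtain p where p: "prime p" "p dvd n" using prime_factor_nat by blast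
      obtain m where m: "n = p ^ multiplicity p n * m" and pm: "\<not> p dvd m"
        using multiplicity_decompose'[of n p] less.prems p by (metis not_prime_unit less_numeral_extra(3) mult.commute)
      define e where "e = multiplicity p n"
      have n: "n = p ^ e * m" using m by (simp add: e_def)
      have e0: "e \<noteq> 0" using n p pm by (intro notI) simp
      have m0: "m > 0" using n less.prems by (intro Nat.gr0I) auto
      have "1 < p ^ e" using p e0 prime_gt_1_nat by (intro one_less_power) auto
      then have "m < n" unfolding n using m0 by simp
      then have IH: "real (ndivs m) \<le> D ^ s m * real m powr \<delta>" using less.IH m0 by blast
      have "real (ndivs n) \<le> real ((e + 1) * ndivs m)"
        unfolding n using ndivs_mult_le[of "p ^ e" m] ndivs_prime_power[OF p(1), of e] m0 prime_gt_0_nat[OF p(1)]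
        by (intro of_nat_mono order_trans[OF ndivs_mult_le] mult_right_mono) auto
      also have "\<dots> = (real e + 1) * real (ndivs m)" by (simp add: distrib_right)
      also have "\<dots> \<le> D ^ s n * (real (p ^ e) powr \<delta> * real m powr \<delta>)"
      proof (cases "p < P")
        case True
        have "x dvd n \<longleftrightarrow> x = p \<or> x dvd m" if "prime x" for x
          using that p(1) e0 primes_dvd_imp_eq[OF that p(1)] unfolding n
          by (auto simp: prime_dvd_mult_iff prime_dvd_power_iff)
        then have "{x. prime x \<and> x dvd n \<and> x < P} = insert p {x. prime x \<and> x dvd m \<and> x < P}"
          using p(1) True by auto
        then have "s n = s m + 1" unfolding s_def using fin[of m] pm by simp
        moreover have "(real e + 1) * real (ndivs m) \<le> (D * real (p ^ e) powr \<delta>) * (D ^ s m * real m powr \<delta>)"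
          by (intro mult_mono small p IH) (use D1 in auto)
        ultimately show ?thesis by (simp add: mult_ac)
      next
        case False
        have "s m \<le> s n" unfolding s_def by (intro card_mono fin) (use n in auto)
        then have "D ^ s m \<le> D ^ s n" using D1 by (intro power_increasing)
        moreover have "(real e + 1) * real (ndivs m) \<le> real (p ^ e) powr \<delta> * (D ^ s m * real m powr \<delta>)"
          by (intro mult_mono large p IH) (use D1 False in auto)
        ultimately show ?thesis
          using mult_right_mono[of "D ^ s m" "D ^ s n" "real (p ^ e) powr \<delta> * real m powr \<delta>"] by (simp add: mult_ac)
      qed
      also have "\<dots> = D ^ s n * real n powr \<delta>" unfolding n by (simp add: powr_mult)
      finally show ?thesis .
    qed
  qed
  have "real (ndivs n) \<le> D ^ P * real n powr \<delta>" if "n > 0" for n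
  proof -
    have "s n \<le> card {..<P}" unfolding s_def by (intro card_mono) auto
    then have "D ^ s n \<le> D ^ P" using D1 by (intro power_increasing) auto
    then show ?thesis using main[OF that] mult_right_mono[of "D ^ s n" "D ^ P" "real n powr \<delta>"] by simp
  qed
  moreover have "D ^ P \<ge> 1" using D1 by simp
  ultimately show thesis using that by blast
qed

lemma ndivs_ge_1: "q > 0 \<Longrightarrow> ndivs q \<ge> 1"
  using finite_divisors[of q] card_gt_0_iff[of "{d. d dvd q}"] by (auto simp: ndivs_def Suc_le_eq)

lemma one_plus_ln_le:
  fixes x a :: real
  assumes "1 \<le> x" "0 < a"
  shows "1 + ln x \<le> (1 + 1 / a) * x powr a"
proof -
  have "ln x \<le> x powr a / a" by (rule ln_powr_bound[OF assms])
  moreover have "1 \<le> x powr a" using assms by (simp add: ge_one_powr_ge_zero)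
  ultimately show ?thesis by (simp add: distrib_right)
qed

lemma cube_powr_quarter:
  fixes x :: real
  assumes "x > 0" shows "(x ^ 3) powr (1 / 4) = x powr (3 / 4)"
proof -
  have "x ^ 3 = x powr 3" using assms by simp
  then have "(x ^ 3) powr (1 / 4) = x powr (3 * (1 / 4))" by (simp only: powr_powr)
  then show ?thesis by simp
qed

lemma hyperbola_error_bound:
  fixes \<delta> :: real
  assumes "\<delta> > 0"
  obtains C where "C \<ge> 0" "\<And>q. q > 0 \<Longrightarrow> hyperbola_error q \<le> C * real q powr (3 / 4 + \<delta>)"
proof -
  define a where "a = \<delta> / 5"
  have a: "a > 0" using assms by (simp add: a_def)
  obtain D where D: "D \<ge> 1" "\<And>n. n > 0 \<Longrightarrow> real (ndivs n) \<le> D * real n powr a"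
    using ndivs_bound[OF a] by blast
  define E where "E = 1 + 1 / a"
  have E: "E \<ge> 1" using a by (simp add: E_def)
  have "hyperbola_error q \<le> (16 * D ^ 3 * E ^ 2) * real q powr (3 / 4 + \<delta>)" if q: "q > 0" for q
  proof -
    define d where "d = real (ndivs q)"
    define l where "l = 1 + ln (real q)"
    have d1: "d \<ge> 1" using ndivs_ge_1[OF q] by (simp add: d_def)
    have l1: "l \<ge> 1" using q by (simp add: l_def)
    have "kloosterman_size q = 2 powr (1 / 4) * ((real q ^ 3) powr (1 / 4) * (d ^ 3) powr (1 / 4))"
      unfolding kloosterman_size_def d_def by (simp add: powr_mult)
    also have "(real q ^ 3) powr (1 / 4) = real q powr (3 / 4)"
      using q by (simp add: cube_powr_quarter)
    also have "(d ^ 3) powr (1 / 4) = d powr (3 / 4)"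
      using d1 by (simp add: cube_powr_quarter)
    also have "2 powr (1 / 4) * (real q powr (3 / 4) * d powr (3 / 4)) \<le> 2 powr 1 * (real q powr (3 / 4) * d powr 1)"
      using d1 q by (intro mult_mono powr_mono) auto
    finally have k: "kloosterman_size q \<le> 2 * (real q powr (3 / 4) * d)" using d1 by simp
    have dl: "d * l \<ge> 1" using d1 l1 mult_mono[of 1 d 1 l] by simp
    have "hyperbola_error q = kloosterman_size q * (2 * (d * l) * (2 + 2 * (d * l)))"
      by (simp add: hyperbola_error_def Let_def d_def l_def mult_ac)
    also have "\<dots> \<le> (2 * (real q powr (3 / 4) * d)) * (2 * (d * l) * (2 * (d * l) + 2 * (d * l)))"
      using k dl d1 l1 q by (intro mult_mono) auto
    also have "\<dots> = 16 * real q powr (3 / 4) * d ^ 3 * l ^ 2" by (simp add: power2_eq_square power3_eq_cube)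
    also have "\<dots> \<le> 16 * real q powr (3 / 4) * (D * real q powr a) ^ 3 * (E * real q powr a) ^ 2"
      using D(2)[OF q] one_plus_ln_le[of "real q" a] q a d1 l1
      by (intro mult_mono power_mono) (auto simp: d_def l_def E_def)
    also have "\<dots> = (16 * D ^ 3 * E ^ 2) * (real q powr (3 / 4) * (real q powr a) ^ 5)"
      by (simp add: power_mult_distrib power2_eq_square power3_eq_cube power_numeral_reduce)
    also have "(real q powr a) ^ 5 = real q powr \<delta>"
      using q by (simp add: a_def powr_power)
    also have "real q powr (3 / 4) * real q powr \<delta> = real q powr (3 / 4 + \<delta>)"
      by (simp add: powr_add)
    finally show ?thesis .
  qed
  moreover have "16 * D ^ 3 * E ^ 2 \<ge> 0" using D E by simp
  ultimately show thesis using that by blast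
qed

section \<open>Mean values of Euler's totient\<close>

definition moebius_mu :: "nat \<Rightarrow> int" where
  "moebius_mu n = (if squarefree n then (- 1) ^ card (prime_factors n) else 0)"

lemma abs_moebius_mu_le: "\<bar>moebius_mu n\<bar> \<le> 1"
  by (simp add: moebius_mu_def power_abs)

lemma moebius_prime_mult:
  assumes "prime p" "\<not> p dvd d" "d > 0"
  shows "moebius_mu (p * d) = - moebius_mu d"
proof -
  have cop: "coprime p d" using assms prime_imp_coprime by blast
  have sq: "squarefree (p * d) \<longleftrightarrow> squarefree d"
    using cop squarefree_mult_coprime squarefree_prime[OF assms(1)] squarefree_multD by blast
  have "prime_factors (p * d) = insert p (prime_factors d)"
    using assms by (subst prime_factors_product) (auto simp: prime_prime_factors)
  moreover have "p \<notin> prime_factors d" using assms(2) by auto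
  ultimately show ?thesis using sq by (simp add: moebius_mu_def)
qed

text \<open>For a prime \<open>p\<close> dividing \<open>n\<close>, the squarefree divisors are paired as \<open>d\<close> and \<open>p d\<close>, with opposite
  signs.\<close>

lemma sum_moebius_divisors:
  assumes "n > 0"
  shows "(\<Sum>d | d dvd n. moebius_mu d) = (if n = 1 then 1 else 0)"
proof (cases "n = 1")
  case True
  then show ?thesis by (simp add: moebius_mu_def)
next
  case False
  then obtain p where p: "prime p" "p dvd n" using prime_factor_nat by blast
  let ?A = "{d. d dvd n \<and> squarefree d \<and> \<not> p dvd d}" and ?B = "{d. d dvd n \<and> squarefree d \<and> p dvd d}"
  have fin: "finite ?A" "finite ?B" using finite_divisors[OF assms] by (auto intro: finite_subset)
  have "(\<Sum>d | d dvd n. moebius_mu d) = (\<Sum>d\<in>?A \<union> ?B. moebius_mu d)"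
    by (rule sum.mono_neutral_right) (use finite_divisors[OF assms] in \<open>auto simp: moebius_mu_def\<close>)
  also have "\<dots> = (\<Sum>d\<in>?A. moebius_mu d) + (\<Sum>d\<in>?B. moebius_mu d)"
    by (rule sum.union_disjoint) (use fin in auto)
  also have "(\<Sum>d\<in>?B. moebius_mu d) = (\<Sum>d\<in>?A. moebius_mu (p * d))"
  proof (rule sum.reindex_bij_witness[where i = "\<lambda>d. p * d" and j = "\<lambda>d. d div p"])
    fix b assume b: "b \<in> ?B"
    then obtain k where k: "b = p * k" by (auto elim: dvdE)
    have "\<not> p dvd k"
    proof
      assume "p dvd k"
      then have "p ^ 2 dvd b" using k by (simp add: power2_eq_square)
      then have "is_unit p" using b squarefreeD by blast
      then show False using p not_prime_unit by blast
    qed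
    then show "b div p \<in> ?A" using b k p(1) prime_gt_0_nat[OF p(1)]
      by (auto intro: dvd_mult_right dest: squarefree_multD)
    show "p * (b div p) = b" using k prime_gt_0_nat[OF p(1)] by simp
    then show "moebius_mu (p * (b div p)) = moebius_mu b" by simp
  next
    fix a assume a: "a \<in> ?A"
    then have c: "coprime p a" using p prime_imp_coprime by blast
    have "p * a dvd n" using a p c by (simp add: divides_mult)
    moreover have "squarefree (p * a)" using a c p by (intro squarefree_mult_coprime) (auto simp: squarefree_prime)
    ultimately show "p * a \<in> ?B" by simp
    show "p * a div p = a" using prime_gt_0_nat[OF p(1)] by simp
  qed
  also have "\<dots> = (\<Sum>d\<in>?A. - moebius_mu d)"
    by (intro sum.cong refl moebius_prime_mult p) (use assms in \<open>auto intro: Nat.gr0I\<close>)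
  finally show ?thesis using False by (simp add: sum_negf)
qed

text \<open>Detect coprimality to \<open>n\<close> by the sum of \<open>moebius_mu\<close> over common divisors, and count multiples.\<close>

lemma totient_over_eq:
  assumes "n > 0"
  shows "real (totient n) / real n = (\<Sum>d | d dvd n. real_of_int (moebius_mu d) / real d)"
proof -
  have "int (totient n) = (\<Sum>k\<in>{1..n}. if gcd k n = 1 then 1 else 0)"
  proof -
    have "totatives n = {k\<in>{1..n}. gcd k n = 1}"
      unfolding totatives_def coprime_iff_gcd_eq_1 by auto
    then show ?thesis by (simp add: totient_def sum.If_cases Int_def)
  qed
  also have "\<dots> = (\<Sum>k\<in>{1..n}. \<Sum>d | d dvd gcd k n. moebius_mu d)"
  proof -
    have "(if gcd k n = 1 then 1 else 0) = (\<Sum>d | d dvd gcd k n. moebius_mu d)" for k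
      using sum_moebius_divisors[of "gcd k n"] assms by (simp split: if_splits)
    then show ?thesis by simp
  qed
  also have "\<dots> = (\<Sum>k\<in>{1..n}. \<Sum>d | d dvd n. if d dvd k then moebius_mu d else 0)"
  proof (rule sum.cong[OF refl])
    fix k
    have "{d. d dvd gcd k n} = {d \<in> {d. d dvd n}. d dvd k}" by auto
    then show "(\<Sum>d | d dvd gcd k n. moebius_mu d) = (\<Sum>d | d dvd n. if d dvd k then moebius_mu d else 0)"
      using finite_divisors[OF assms] by (simp only: sum.inter_filter)
  qed
  also have "\<dots> = (\<Sum>d | d dvd n. \<Sum>k\<in>{1..n}. if d dvd k then moebius_mu d else 0)" by (rule sum.swap)
  also have "\<dots> = (\<Sum>d | d dvd n. moebius_mu d * int (n div d))"
  proof (intro sum.cong refl)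
    fix d assume "d \<in> {d. d dvd n}"
    then have d: "d dvd n" "d > 0" using assms by (auto intro: Nat.gr0I)
    have "card {k\<in>{1..n}. d dvd k} = n div d"
    proof -
      have "{k\<in>{1..n}. d dvd k} = (\<lambda>i. d * i) ` {1..n div d}"
        using d by (auto elim!: dvdE simp: Suc_le_eq)
      moreover have "inj_on (\<lambda>i. d * i) {1..n div d}" using d by (auto simp: inj_on_def)
      ultimately show ?thesis by (simp add: card_image)
    qed
    then show "(\<Sum>k\<in>{1..n}. if d dvd k then moebius_mu d else 0) = moebius_mu d * int (n div d)"
      by (simp add: sum.If_cases Int_def)
  qed
  finally have "real_of_int (int (totient n)) = real_of_int (\<Sum>d | d dvd n. moebius_mu d * int (n div d))" by simp
  then have "real (totient n) = (\<Sum>d | d dvd n. real_of_int (moebius_mu d) * real (n div d))" by simp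
  also have "\<dots> = (\<Sum>d | d dvd n. real n * (real_of_int (moebius_mu d) / real d))"
    by (intro sum.cong refl) (simp add: real_of_nat_div)
  also have "\<dots> = real n * (\<Sum>d | d dvd n. real_of_int (moebius_mu d) / real d)"
    by (simp only: sum_distrib_left)
  finally show ?thesis using assms by simp
qed

text \<open>The partial sums increase to \<open>\<pi>\<^sup>2/6\<close>, and the partial sums plus \<open>1/m\<close> decrease to it.\<close>

lemma zeta2_partial:
  assumes "m > 0"
  shows "\<bar>(\<Sum>k=1..m. 1 / real k ^ 2) - pi ^ 2 / 6\<bar> \<le> 1 / real m"
proof -
  have s: "(\<lambda>n. 1 / (real n + 1) ^ 2) sums (pi ^ 2 / 6)"
    using inverse_squares_sums by (simp add: add.commute)
  define Z where "Z n = (\<Sum>k=1..n. 1 / real k ^ 2)" for n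
  have Zeq: "Z n = (\<Sum>k<n. 1 / (real k + 1) ^ 2)" for n
    by (induction n) (simp_all add: Z_def add.commute)
  have lim: "Z \<longlonglongrightarrow> pi ^ 2 / 6" using s unfolding sums_def Zeq[abs_def, symmetric] by (simp add: Zeq)
  have up: "Z m \<le> pi ^ 2 / 6"
    by (rule incseq_le[OF _ lim]) (auto simp: incseq_Suc_iff Z_def)
  have lim': "(\<lambda>n. Z (Suc n) + 1 / real (Suc n)) \<longlonglongrightarrow> pi ^ 2 / 6 + 0"
    by (intro tendsto_add LIMSEQ_Suc[OF lim] lim_1_over_n[THEN LIMSEQ_Suc])
  have dec: "decseq (\<lambda>n. Z (Suc n) + 1 / real (Suc n))"
  proof (rule decseq_SucI)
    fix n
    have "1 / real (Suc (Suc n)) ^ 2 \<le> 1 / real (Suc n) - 1 / real (Suc (Suc n))"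
    proof -
      have "1 / real (Suc n) - 1 / real (Suc (Suc n)) = 1 / (real (Suc n) * real (Suc (Suc n)))"
        by (simp add: field_simps)
      also have "\<dots> \<ge> 1 / real (Suc (Suc n)) ^ 2"
        unfolding power2_eq_square by (intro divide_left_mono mult_right_mono) auto
      finally show ?thesis .
    qed
    then show "Z (Suc (Suc n)) + 1 / real (Suc (Suc n)) \<le> Z (Suc n) + 1 / real (Suc n)"
      by (simp add: Z_def)
  qed
  have "pi ^ 2 / 6 + 0 \<le> Z (Suc (m - 1)) + 1 / real (Suc (m - 1))"
    by (rule decseq_ge[OF dec lim'])
  then have "pi ^ 2 / 6 \<le> Z m + 1 / real m" using assms by simp
  with up show ?thesis unfolding Z_def by linarith
qed

lemma sum_by_divisors:
  fixes f :: "nat \<Rightarrow> nat \<Rightarrow> real"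
  shows "(\<Sum>n=1..N. \<Sum>d | d dvd n. f d (n div d)) = (\<Sum>d=1..N. \<Sum>k=1..N div d. f d k)"
proof -
  have "(\<Sum>n=1..N. \<Sum>d | d dvd n. f d (n div d)) = (\<Sum>(n, d)\<in>(SIGMA n:{1..N}. {d. d dvd n}). f d (n div d))"
    by (rule sum.Sigma) (auto intro: finite_divisors)
  also have "\<dots> = (\<Sum>(d, k)\<in>(SIGMA d:{1..N}. {1..N div d}). f d k)"
    by (rule sum.reindex_bij_witness[where i = "\<lambda>(d, k). (d * k, d)" and j = "\<lambda>(n, d). (d, n div d)"])
       (auto simp: div_le_mono less_eq_div_iff_mult_less_eq Suc_le_eq mult.commute dvd_imp_le div_greater_zero_iff
             intro: order_trans[OF dvd_imp_le] dvd_pos_nat)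
  also have "\<dots> = (\<Sum>d=1..N. \<Sum>k=1..N div d. f d k)"
    by (rule sum.Sigma[symmetric]) auto
  finally show ?thesis .
qed

text \<open>A finite form of \<open>\<zeta>(2) \<Sum> \<mu>(d) / d\<^sup>2 = 1\<close>: collecting the terms \<open>\<mu>(d) / (d k)\<^sup>2\<close> with \<open>d k = n \<le> N\<close>
  gives exactly \<open>1\<close>, while for fixed \<open>d\<close> the sum over \<open>k \<le> N / d\<close> is \<open>\<zeta>(2) + O(d / N)\<close>. The error is
  good enough to be used directly, without the infinite series.\<close>

lemma sum_moebius_over_squares:
  assumes "N > 0"
  shows "\<bar>(\<Sum>d=1..N. real_of_int (moebius_mu d) / real d ^ 2) - 6 / pi ^ 2\<bar> \<le> 2 * (1 + ln (real N)) / real N"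
proof -
  let ?M = "\<lambda>d. real_of_int (moebius_mu d) / real d ^ 2"
  let ?Z = "\<lambda>m. \<Sum>k=1..m. 1 / real k ^ 2"
  have M: "\<bar>?M d\<bar> \<le> 1 / real d ^ 2" for d
    using abs_moebius_mu_le[of d] by (simp add: abs_divide divide_right_mono flip: of_int_abs)
  have "(\<Sum>n=1..N. \<Sum>d | d dvd n. ?M d * (1 / real (n div d) ^ 2)) = 1"
  proof -
    have "(\<Sum>n=1..N. \<Sum>d | d dvd n. ?M d * (1 / real (n div d) ^ 2)) = (\<Sum>n=1..N. if n = 1 then 1 else 0)"
    proof (intro sum.cong refl)
      fix n assume n: "n \<in> {1..N}"
      have "(\<Sum>d | d dvd n. ?M d * (1 / real (n div d) ^ 2)) = (\<Sum>d | d dvd n. real_of_int (moebius_mu d) / real n ^ 2)"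
        by (intro sum.cong refl) (use n in \<open>auto simp: real_of_nat_div power_divide field_simps dest: dvd_pos_nat\<close>)
      also have "\<dots> = real_of_int (\<Sum>d | d dvd n. moebius_mu d) / real n ^ 2"
        by (simp add: sum_divide_distrib)
      also have "\<dots> = (if n = 1 then 1 else 0)" using n by (subst sum_moebius_divisors) auto
      finally show "(\<Sum>d | d dvd n. ?M d * (1 / real (n div d) ^ 2)) = (if n = 1 then 1 else 0)" .
    qed
    also have "\<dots> = 1" using assms by simp
    finally show ?thesis .
  qed
  then have one: "(\<Sum>d=1..N. ?M d * ?Z (N div d)) = 1"
    using sum_by_divisors[of "\<lambda>d k. ?M d * (1 / real k ^ 2)" N] by (simp only: sum_distrib_left)
  have "\<bar>1 - pi ^ 2 / 6 * (\<Sum>d=1..N. ?M d)\<bar> = \<bar>\<Sum>d=1..N. ?M d * (?Z (N div d) - pi ^ 2 / 6)\<bar>"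
  proof -
    have "(\<Sum>d=1..N. ?M d * (?Z (N div d) - pi ^ 2 / 6)) = (\<Sum>d=1..N. ?M d * ?Z (N div d)) - (\<Sum>d=1..N. ?M d) * (pi ^ 2 / 6)"
      unfolding sum_distrib_right sum_subtractf[symmetric] by (simp only: right_diff_distrib)
    then show ?thesis unfolding one by (simp only: mult.commute)
  qed
  also have "\<dots> \<le> (\<Sum>d=1..N. 2 / real N * (1 / real d))"
  proof (rule order_trans[OF sum_abs sum_mono])
    fix d assume d: "d \<in> {1..N}"
    then have m: "N div d > 0" by (simp add: div_greater_zero_iff)
    have "real N < real d * (real (N div d) + 1)"
    proof -
      have "N < d + d * (N div d)" using d by (intro dividend_less_times_div) auto
      then have "real N < real (d + d * (N div d))" by (simp only: of_nat_less_iff)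
      then show ?thesis by (simp add: distrib_left)
    qed
    also have "\<dots> \<le> real d * (2 * real (N div d))" using m by (intro mult_left_mono) auto
    finally have "1 / real (N div d) \<le> 2 * real d / real N" using m assms by (simp add: field_simps)
    then have z: "\<bar>?Z (N div d) - pi ^ 2 / 6\<bar> \<le> 2 * real d / real N" using zeta2_partial[OF m] by linarith
    have "\<bar>?M d * (?Z (N div d) - pi ^ 2 / 6)\<bar> \<le> 1 / real d ^ 2 * (2 * real d / real N)"
      unfolding abs_mult by (intro mult_mono M z) auto
    also have "\<dots> = 2 / real N * (1 / real d)" using d by (simp add: power2_eq_square)
    finally show "\<bar>?M d * (?Z (N div d) - pi ^ 2 / 6)\<bar> \<le> 2 / real N * (1 / real d)" .
  qed
  also have "\<dots> \<le> 2 / real N * (1 + ln (real N))"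
    unfolding sum_distrib_left[symmetric] by (intro mult_left_mono harm_le_ln assms) simp
  finally have *: "\<bar>1 - pi ^ 2 / 6 * (\<Sum>d=1..N. ?M d)\<bar> \<le> 2 * (1 + ln (real N)) / real N" by simp
  have "(\<Sum>d=1..N. ?M d) - 6 / pi ^ 2 = - (6 / pi ^ 2) * (1 - pi ^ 2 / 6 * (\<Sum>d=1..N. ?M d))"
    by (simp add: field_simps)
  then have "\<bar>(\<Sum>d=1..N. ?M d) - 6 / pi ^ 2\<bar> = \<bar>- (6 / pi ^ 2)\<bar> * \<bar>1 - pi ^ 2 / 6 * (\<Sum>d=1..N. ?M d)\<bar>"
    by (simp only: abs_mult)
  also have "\<bar>- (6 / pi ^ 2)\<bar> = 6 / pi ^ 2" by simp
  also have "6 / pi ^ 2 * \<bar>1 - pi ^ 2 / 6 * (\<Sum>d=1..N. ?M d)\<bar> \<le> 1 * \<bar>1 - pi ^ 2 / 6 * (\<Sum>d=1..N. ?M d)\<bar>"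
  proof (intro mult_right_mono)
    have "3 * 3 \<le> pi * pi" using pi_gt3 by (intro mult_mono) auto
    then show "6 / pi ^ 2 \<le> 1" by (simp add: power2_eq_square)
  qed simp
  finally have "\<bar>(\<Sum>d=1..N. ?M d) - 6 / pi ^ 2\<bar> \<le> 1 * \<bar>1 - pi ^ 2 / 6 * (\<Sum>d=1..N. ?M d)\<bar>" .
  from order_trans[OF this[unfolded mult_1] *] show ?thesis .
qed

lemma sum_totient_over:
  assumes "N > 0"
  shows "\<bar>(\<Sum>q=1..N. real (totient q) / real q) - 6 / pi ^ 2 * real N\<bar> \<le> 3 * (1 + ln (real N))"
proof -
  let ?M = "\<lambda>d. real_of_int (moebius_mu d) / real d ^ 2"
  have "(\<Sum>q=1..N. real (totient q) / real q) = (\<Sum>q=1..N. \<Sum>d | d dvd q. real_of_int (moebius_mu d) / real d)"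
    by (intro sum.cong refl totient_over_eq) auto
  also have "\<dots> = (\<Sum>d=1..N. \<Sum>k=1..N div d. real_of_int (moebius_mu d) / real d)"
    by (rule sum_by_divisors[of "\<lambda>d k. real_of_int (moebius_mu d) / real d"])
  also have "\<dots> = (\<Sum>d=1..N. real (N div d) * (real_of_int (moebius_mu d) / real d))" by simp
  finally have P: "(\<Sum>q=1..N. real (totient q) / real q) = \<dots>" .
  have "\<bar>(\<Sum>q=1..N. real (totient q) / real q) - real N * (\<Sum>d=1..N. ?M d)\<bar> =
      \<bar>\<Sum>d=1..N. (real (N div d) - real N / real d) * (real_of_int (moebius_mu d) / real d)\<bar>"
    unfolding P sum_distrib_left sum_subtractf[symmetric]
    by (intro arg_cong[where f = abs] sum.cong refl) (simp add: left_diff_distrib diff_divide_distrib power2_eq_square)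
  also have "\<dots> \<le> (\<Sum>d=1..N. 1 / real d)"
  proof (rule order_trans[OF sum_abs sum_mono])
    fix d assume d: "d \<in> {1..N}"
    have "\<bar>real (N div d) - real N / real d\<bar> \<le> 1"
    proof -
      have "N < d + d * (N div d)" using d by (intro dividend_less_times_div) auto
      then have "real N < real (d + d * (N div d))" by (simp only: of_nat_less_iff)
      then have "real N / real d < 1 + real (N div d)" using d by (simp add: field_simps)
      moreover have "real (d * (N div d)) \<le> real N" by (simp only: of_nat_le_iff times_div_less_eq_dividend)
      then have "real (N div d) \<le> real N / real d" using d by (simp add: field_simps)
      ultimately show ?thesis by linarith
    qed
    moreover have "\<bar>real_of_int (moebius_mu d) / real d\<bar> \<le> 1 / real d"
      using abs_moebius_mu_le[of d] by (simp add: abs_divide divide_right_mono flip: of_int_abs)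
    ultimately show "\<bar>(real (N div d) - real N / real d) * (real_of_int (moebius_mu d) / real d)\<bar> \<le> 1 / real d"
      unfolding abs_mult using mult_mono[of "\<bar>real (N div d) - real N / real d\<bar>" 1 "\<bar>real_of_int (moebius_mu d) / real d\<bar>" "1 / real d"] by simp
  qed
  also have "\<dots> \<le> 1 + ln (real N)" by (rule harm_le_ln[OF assms])
  finally have 1: "\<bar>(\<Sum>q=1..N. real (totient q) / real q) - real N * (\<Sum>d=1..N. ?M d)\<bar> \<le> 1 + ln (real N)" .
  have "\<bar>real N * (\<Sum>d=1..N. ?M d) - real N * (6 / pi ^ 2)\<bar> = real N * \<bar>(\<Sum>d=1..N. ?M d) - 6 / pi ^ 2\<bar>"
    by (simp only: abs_mult abs_of_nat flip: right_diff_distrib)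
  also have "\<dots> \<le> real N * (2 * (1 + ln (real N)) / real N)"
    by (intro mult_left_mono sum_moebius_over_squares assms) simp
  also have "\<dots> = 2 * (1 + ln (real N))" using assms by simp
  finally show ?thesis using 1 by (simp add: mult.commute)
qed

text \<open>Summation by parts: the differences of a decreasing weight telescope.\<close>

lemma abel_monotone_bound:
  fixes c f :: "nat \<Rightarrow> real"
  assumes "n > 0"
    and partial: "\<And>j. 1 \<le> j \<Longrightarrow> j \<le> n \<Longrightarrow> \<bar>\<Sum>k=1..j. c k\<bar> \<le> B"
    and dec: "\<And>k. 1 \<le> k \<Longrightarrow> k < n \<Longrightarrow> f (Suc k) \<le> f k" and "f n \<ge> 0"
  shows "\<bar>\<Sum>k=1..n. c k * f k\<bar> \<le> B * f 1"
proof -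
  define s where "s j = (\<Sum>k=1..j. c k)" for j
  have parts: "(\<Sum>k=1..m. c k * f k) = s m * f m + (\<Sum>k=1..<m. s k * (f k - f (Suc k)))" if "m > 0" for m
    using that by (induction m rule: nat_induct_non_zero) (simp_all add: s_def algebra_simps)
  have B: "B \<ge> 0" using partial[of n] assms(1) by force
  have tel: "(\<Sum>k=1..<n. f k - f (Suc k)) = f 1 - f n"
    using assms(1) sum_Suc_diff'[of 1 n "\<lambda>k. - f k"] by simp
  have "\<bar>\<Sum>k=1..n. c k * f k\<bar> \<le> \<bar>s n * f n\<bar> + \<bar>\<Sum>k=1..<n. s k * (f k - f (Suc k))\<bar>"
    unfolding parts[OF assms(1)] by (rule abs_triangle_ineq)
  also have "\<dots> \<le> B * f n + (\<Sum>k=1..<n. B * (f k - f (Suc k)))"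
  proof (intro add_mono order_trans[OF sum_abs sum_mono])
    show "\<bar>s n * f n\<bar> \<le> B * f n" unfolding abs_mult s_def
      using partial[of n] assms(1,4) by (intro mult_mono) auto
    fix k assume "k \<in> {1..<n}"
    then show "\<bar>s k * (f k - f (Suc k))\<bar> \<le> B * (f k - f (Suc k))"
      unfolding abs_mult s_def using partial[of k] dec[of k] B by (intro mult_mono) auto
  qed
  also have "\<dots> = B * f 1" unfolding sum_distrib_left[symmetric] tel by (simp add: algebra_simps)
  finally show ?thesis .
qed

text \<open>For \<open>T, L \<ge> 0\<close> this is \<open>\<integral>\<^sub>0\<^sup>T min 1 (L / x) dx\<close>.\<close>

definition clipped_log :: "real \<Rightarrow> real \<Rightarrow> real" where
  "clipped_log T L = (if T \<le> L then T else if L \<le> 0 then 0 else L + L * ln (T / L))"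

text \<open>The integrand \<open>min 1 (L / x)\<close> decreases, so its integral over \<open>[q - 1, q]\<close> lies between its values
  at the two ends, the value at \<open>0\<close> being \<open>1\<close>.\<close>

lemma clipped_log_step:
  fixes L :: real and q :: nat
  assumes "L > 0" "q > 0"
  shows "min 1 (L / real q) \<le> clipped_log (real q) L - clipped_log (real q - 1) L"
    and "clipped_log (real q) L - clipped_log (real q - 1) L \<le> (if q = 1 then 1 else min 1 (L / (real q - 1)))"
proof -
  let ?q = "real q"
  have q: "?q \<ge> 1" using assms by simp
  have ln_lower: "1 - 1 / x \<le> ln x" if "x > 0" for x :: real
    using ln_le_minus_one[of "1 / x"] that by (simp add: ln_div)
  have "min 1 (L / real q) \<le> clipped_log (real q) L - clipped_log (real q - 1) L \<and>
     clipped_log (real q) L - clipped_log (real q - 1) L \<le> (if q = 1 then 1 else min 1 (L / (real q - 1)))"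
  proof -
    consider "?q \<le> L" | "?q - 1 \<le> L" "L < ?q" | "L < ?q - 1" by linarith
    then show ?thesis
    proof cases
      case 1
      then show ?thesis using assms by (auto simp: clipped_log_def field_simps)
    next
      case 2
      have e: "clipped_log ?q L - clipped_log (?q - 1) L = L + L * ln (?q / L) - (?q - 1)"
        using 2 assms by (simp add: clipped_log_def)
      have "L * ln (?q / L) \<le> L * (?q / L - 1)" using assms by (intro mult_left_mono ln_le_minus_one) auto
      moreover have "L * (?q / L - 1) = ?q - L" using assms by (simp add: right_diff_distrib)
      ultimately have up: "L * ln (?q / L) \<le> ?q - L" by simp
      have "L * (1 - 1 / (?q / L)) \<le> L * ln (?q / L)" using assms by (intro mult_left_mono ln_lower) auto
      then have lo: "L - L * L / ?q \<le> L * ln (?q / L)" using assms by (simp add: right_diff_distrib)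
      have "0 \<le> (?q - L) * (1 - (?q - L))" using 2 by (intro mult_nonneg_nonneg) auto
      then have "L * ?q + L * ?q - (?q - 1) * ?q - L * L - L \<ge> 0" by (simp add: algebra_simps)
      then have "L / ?q \<le> L + (L - L * L / ?q) - (?q - 1)" using assms by (simp add: field_simps)
      then show ?thesis unfolding e using up lo 2 q by (auto simp: min_def field_simps)
    next
      case 3
      have q1: "?q - 1 > 0" "q \<noteq> 1" using 3 assms by auto
      have e: "clipped_log ?q L - clipped_log (?q - 1) L = L * ln (?q / (?q - 1))"
        using 3 assms q1 by (simp add: clipped_log_def ln_div algebra_simps)
      have "L * ln (?q / (?q - 1)) \<le> L * (?q / (?q - 1) - 1)" using assms q1 by (intro mult_left_mono ln_le_minus_one) auto
      also have "\<dots> = L / (?q - 1)" using q1 by (simp add: field_simps)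
      finally have up: "L * ln (?q / (?q - 1)) \<le> L / (?q - 1)" .
      have "L * (1 - 1 / (?q / (?q - 1))) \<le> L * ln (?q / (?q - 1))" using assms q1 by (intro mult_left_mono ln_lower) auto
      moreover have "L * (1 - 1 / (?q / (?q - 1))) = L / ?q" using q1 by (simp add: field_simps)
      ultimately have lo: "L / ?q \<le> L * ln (?q / (?q - 1))" by simp
      show ?thesis unfolding e using up lo 3 q1 by (auto simp: min_def field_simps)
    qed
  qed
  then show "min 1 (L / real q) \<le> clipped_log (real q) L - clipped_log (real q - 1) L"
    and "clipped_log (real q) L - clipped_log (real q - 1) L \<le> (if q = 1 then 1 else min 1 (L / (real q - 1)))"
    by blast+
qed

lemma sum_min_clipped_log:
  fixes L :: real and T :: nat
  assumes "L > 0"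
  shows "\<bar>(\<Sum>q=1..T. min 1 (L / real q)) - clipped_log (real T) L\<bar> \<le> 1"
proof -
  have c0: "clipped_log 0 L = 0" using assms by (simp add: clipped_log_def)
  have "(\<Sum>q=1..T. min 1 (L / real q)) \<le> clipped_log (real T) L"
  proof (induction T)
    case (Suc T)
    then show ?case using clipped_log_step(1)[OF assms, of "Suc T"] by simp
  qed (simp add: c0)
  moreover have "clipped_log (real T) L \<le> 1 + (\<Sum>q=1..<T. min 1 (L / real q))"
  proof (induction T)
    case (Suc T)
    then show ?case using clipped_log_step(2)[OF assms, of "Suc T"] by (cases "T = 0") (auto simp: c0)
  qed (simp add: c0)
  moreover have "(\<Sum>q=1..<T. min 1 (L / real q)) \<le> (\<Sum>q=1..T. min 1 (L / real q))"
    by (rule sum_mono2) (use assms in auto)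
  ultimately show ?thesis by linarith
qed

lemma sum_totient_min:
  fixes L :: real and T :: nat
  assumes "T > 0"
  shows "\<bar>(\<Sum>q=1..T. real (totient q) / real q * max 0 (min 1 (L / real q))) - 6 / pi ^ 2 * clipped_log (real T) L\<bar> \<le> 4 * (1 + ln (real T))"
proof (cases "L > 0")
  case False
  then have "L / real q \<le> 0" for q :: nat by (simp add: divide_nonpos_nonneg)
  then have z: "max 0 (min 1 (L / real q)) = 0" for q :: nat by (simp add: min.coboundedI2)
  have "(\<Sum>q=1..T. real (totient q) / real q * max 0 (min 1 (L / real q))) = 0"
    unfolding z by simp
  moreover have "clipped_log (real T) L = 0" using False assms by (simp add: clipped_log_def)
  ultimately show ?thesis using assms by simp
next
  case True
  let ?f = "\<lambda>q. min 1 (L / real q)"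
  let ?c = "\<lambda>q. real (totient q) / real q - 6 / pi ^ 2"
  have mx: "max 0 (?f q) = ?f q" for q :: nat using True by simp
  have "\<bar>\<Sum>q=1..T. ?c q * ?f q\<bar> \<le> (3 * (1 + ln (real T))) * ?f 1"
  proof (rule abel_monotone_bound[OF assms])
    fix j assume j: "1 \<le> j" "j \<le> T"
    have "\<bar>\<Sum>k=1..j. ?c k\<bar> = \<bar>(\<Sum>q=1..j. real (totient q) / real q) - 6 / pi ^ 2 * real j\<bar>"
      by (simp add: sum_subtractf mult.commute)
    also have "\<dots> \<le> 3 * (1 + ln (real j))" using j by (intro sum_totient_over) auto
    also have "\<dots> \<le> 3 * (1 + ln (real T))" using j by simp
    finally show "\<bar>\<Sum>k=1..j. ?c k\<bar> \<le> 3 * (1 + ln (real T))" .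
  next
    fix k :: nat assume "1 \<le> k"
    then show "?f (Suc k) \<le> ?f k" using True by (intro min.mono divide_left_mono) auto
  qed (use True in auto)
  also have "\<dots> \<le> 3 * (1 + ln (real T)) * 1" using assms by (intro mult_left_mono) auto
  finally have 1: "\<bar>\<Sum>q=1..T. ?c q * ?f q\<bar> \<le> 3 * (1 + ln (real T))" by simp
  have 2: "\<bar>6 / pi ^ 2 * ((\<Sum>q=1..T. ?f q) - clipped_log (real T) L)\<bar> \<le> 1 * 1"
    unfolding abs_mult
  proof (intro mult_mono sum_min_clipped_log True)
    have "3 * 3 \<le> pi * pi" using pi_gt3 by (intro mult_mono) auto
    then show "\<bar>6 / pi ^ 2\<bar> \<le> 1" by (simp add: power2_eq_square)
  qed auto
  have "(\<Sum>q=1..T. real (totient q) / real q * max 0 (?f q)) - 6 / pi ^ 2 * clipped_log (real T) L =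
    (\<Sum>q=1..T. ?c q * ?f q) + 6 / pi ^ 2 * ((\<Sum>q=1..T. ?f q) - clipped_log (real T) L)"
    unfolding mx by (simp add: left_diff_distrib right_diff_distrib sum_subtractf sum_distrib_left)
  then have "\<bar>(\<Sum>q=1..T. real (totient q) / real q * max 0 (?f q)) - 6 / pi ^ 2 * clipped_log (real T) L\<bar> \<le>
    \<bar>\<Sum>q=1..T. ?c q * ?f q\<bar> + \<bar>6 / pi ^ 2 * ((\<Sum>q=1..T. ?f q) - clipped_log (real T) L)\<bar>"
    by (simp only: abs_triangle_ineq)
  moreover have "ln (real T) \<ge> 0" using assms by simp
  ultimately show ?thesis using 1 2 by argo
qed

section \<open>Farey cells\<close>

text \<open>The quadruple stands for two neighbours \<open>a/q < a'/q'\<close> among the fractions with denominators up to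
  \<open>T\<close> in \<open>[0, 1]\<close>: they form a basis of the lattice, and their mediant has a denominator exceeding
  \<open>T\<close>.\<close>

definition farey :: "nat \<Rightarrow> (nat \<times> nat \<times> nat \<times> nat) set" where
  "farey T = {(a, q, a', q'). 1 \<le> q \<and> q \<le> T \<and> 1 \<le> q' \<and> q' \<le> T \<and> T < q + q' \<and> a' * q = a * q' + 1 \<and> a < q}"

definition cell :: "nat \<times> nat \<times> nat \<times> nat \<Rightarrow> real set" where
  "cell = (\<lambda>(a, q, a', q'). {real a / real q..<real a' / real q'})"

lemma fareyD:
  assumes "(a, q, a', q') \<in> farey T"
  shows "0 < q" "q \<le> T" "0 < q'" "q' \<le> T" "T < q + q'" "a' * q = a * q' + 1" "a < q" "0 < a'" "a' \<le> q'"
proof -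
  show *: "0 < q" "q \<le> T" "0 < q'" "q' \<le> T" "T < q + q'" "a' * q = a * q' + 1" "a < q"
    using assms by (auto simp: farey_def)
  show "0 < a'" using *(6) by (intro Nat.gr0I) auto
  have "a' * q \<le> q' * q"
  proof -
    have "a * q' + q' \<le> q * q'" using *(7) by (metis Suc_leI add.commute mult_Suc mult_le_mono1)
    then show ?thesis using *(3,6) by (simp add: mult.commute)
  qed
  then show "a' \<le> q'" using *(1) by simp
qed

lemma farey_det:
  assumes "(a, q, a', q') \<in> farey T"
  shows "real a' * real q = real a * real q' + 1"
proof -
  have "real (a' * q) = real (a * q' + 1)" using fareyD(6)[OF assms] by (simp only:)
  then show ?thesis by simp
qed

lemma finite_farey [simp]: "finite (farey T)"
proof (rule finite_subset)
  show "farey T \<subseteq> {..T} \<times> {..T} \<times> {..T} \<times> {..T}"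
  proof
    fix p assume p: "p \<in> farey T"
    obtain a q a' q' where pe: "p = (a, q, a', q')" by (metis prod_cases4)
    from fareyD[OF p[unfolded pe]] show "p \<in> {..T} \<times> {..T} \<times> {..T} \<times> {..T}" unfolding pe by auto
  qed
qed simp

lemma cell_length:
  assumes "(a, q, a', q') \<in> farey T"
  shows "real a' / real q' - real a / real q = 1 / (real q * real q')"
  using fareyD(1,3)[OF assms] farey_det[OF assms] by (simp add: field_simps)

text \<open>Passing from order \<open>T\<close> to \<open>T + 1\<close> splits the cells with \<open>q + q' = T + 1\<close> at their mediants.\<close>

lemma farey_cover:
  assumes "T > 0" "0 \<le> t" "t < 1"
  shows "\<exists>p\<in>farey T. t \<in> cell p"
  using assms(1)
proof (induction T rule: nat_induct_non_zero)
  case 1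
  have "(0, 1, 1, 1) \<in> farey 1" by (simp add: farey_def)
  then show ?case using assms by (force simp: cell_def)
next
  case (Suc T)
  then obtain a q a' q' where p: "(a, q, a', q') \<in> farey T" and t: "t \<in> cell (a, q, a', q')"
    by (metis prod_cases4)
  note D = fareyD[OF p]
  show ?case
  proof (cases "Suc T < q + q'")
    case True
    then have "(a, q, a', q') \<in> farey (Suc T)" using p by (auto simp: farey_def)
    then show ?thesis using t by blast
  next
    case False
    then have e: "q + q' = Suc T" using D by simp
    have *: "(a + a') * q = a * (q + q') + 1" "a' * (q + q') = (a + a') * q' + 1"
      using D(6) by (simp_all add: algebra_simps)
    show ?thesis
    proof (cases "t < real (a + a') / real (q + q')")
      case True
      have "(a, q, a + a', q + q') \<in> farey (Suc T)" using D * e by (simp add: farey_def)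
      moreover have "t \<in> cell (a, q, a + a', q + q')" using True t by (simp add: cell_def)
      ultimately show ?thesis by blast
    next
      case False
      have "a + a' < q + q'" using D by linarith
      then have "(a + a', q + q', a', q') \<in> farey (Suc T)" using D * e by (simp add: farey_def)
      moreover have "t \<in> cell (a + a', q + q', a', q')" using False t by (simp add: cell_def)
      ultimately show ?thesis by blast
    qed
  qed
qed

text \<open>Coordinates of \<open>(m, n)\<close> with respect to the lattice basis \<open>(q, a)\<close>, \<open>(q', a')\<close>.\<close>

lemma lattice_basis:
  fixes m n :: int
  assumes "(a, q, a', q') \<in> farey T"
  defines "u \<equiv> int a' * m - int q' * n" and "v \<equiv> int q * n - int a * m"
  shows "m = u * int q + v * int q'" "n = u * int a + v * int a'"
    and "real_of_int m * t - real_of_int n = real_of_int u * (real q * t - real a) - real_of_int v * (real a' - real q' * t)"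
proof -
  have d: "int a' * int q = int a * int q' + 1"
    using fareyD(6)[OF assms(1)] by (metis of_nat_1 of_nat_add of_nat_mult)
  show m: "m = u * int q + v * int q'"
  proof -
    have "u * int q + v * int q' = m * (int a' * int q - int a * int q')" by (simp add: u_def v_def algebra_simps)
    then show ?thesis using d by simp
  qed
  show n: "n = u * int a + v * int a'"
  proof -
    have "u * int a + v * int a' = n * (int a' * int q - int a * int q')" by (simp add: u_def v_def algebra_simps)
    then show ?thesis using d by simp
  qed
  have "real_of_int m = real_of_int (u * int q + v * int q')" "real_of_int n = real_of_int (u * int a + v * int a')"
    using m n by (simp_all only:)
  then show "real_of_int m * t - real_of_int n = real_of_int u * (real q * t - real a) - real_of_int v * (real a' - real q' * t)"
    by (simp add: algebra_simps)
qed

text \<open>A lattice vector inside the cone spanned by the basis has abscissa at least \<open>q + q' > T\<close>.\<close>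

lemma short_vector_outside_cone:
  fixes u v :: int
  assumes "(a, q, a', q') \<in> farey T" "u * int q + v * int q' \<le> int T" "u \<ge> 1"
  shows "v \<le> 0"
proof (rule ccontr)
  assume "\<not> v \<le> 0"
  then have v: "v \<ge> 1" by simp
  have "1 * int q + 1 * int q' \<le> u * int q + v * int q'" using v assms(3) by (intro add_mono mult_right_mono) auto
  then show False using fareyD(5)[OF assms(1)] assms(2) by simp
qed

text \<open>The slopes \<open>t\<close> whose line passes within vertical distance \<open>\<eta>\<close> of a lattice point of abscissa
  at most \<open>T\<close>.\<close>

definition near :: "nat \<Rightarrow> real \<Rightarrow> real set" where
  "near T \<eta> = {t. \<exists>m n. 1 \<le> m \<and> m \<le> T \<and> \<bar>real m * t - real_of_int n\<bar> \<le> \<eta>}"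

text \<open>A lattice point \<open>(m, n)\<close> with \<open>m \<le> T\<close> lies outside the cone of the two end points, so one of its
  coordinates \<open>u, v\<close> is at least \<open>1\<close> and the other at most \<open>0\<close>. Since \<open>q t - a\<close> and \<open>a' - q' t\<close> are both
  nonnegative, \<open>m t - n = u (q t - a) - v (a' - q' t)\<close> has no cancellation and is in absolute value at
  least the deviation of one of the end points.\<close>

lemma near_in_cell_iff:
  assumes p: "(a, q, a', q') \<in> farey T" and t: "t \<in> cell (a, q, a', q')" and "\<eta> \<ge> 0"
  shows "t \<in> near T \<eta> \<longleftrightarrow> real q * t - real a \<le> \<eta> \<or> real a' - real q' * t \<le> \<eta>"
proof
  note D = fareyD[OF p]
  have x: "real q * t - real a \<ge> 0" "real a' - real q' * t > 0"
    using t D(1,3) by (simp_all add: cell_def field_simps)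
  {
    assume "t \<in> near T \<eta>"
    then obtain m n where m: "1 \<le> m" "m \<le> T" and h: "\<bar>real m * t - real_of_int n\<bar> \<le> \<eta>"
      by (auto simp: near_def)
    define u v where "u = int a' * int m - int q' * n" and "v = int q * n - int a * int m"
    have B1: "int m = u * int q + v * int q'"
      unfolding u_def v_def by (rule lattice_basis(1)[OF p])
    have B3: "real m * t - real_of_int n = real_of_int u * (real q * t - real a) - real_of_int v * (real a' - real q' * t)"
      using lattice_basis(3)[OF p, where m = "int m" and n = n and t = t] unfolding u_def v_def by simp
    have mT: "u * int q + v * int q' \<le> int T" using B1 m by simp
    have h': "\<bar>real_of_int u * (real q * t - real a) - real_of_int v * (real a' - real q' * t)\<bar> \<le> \<eta>"
      using h B3 by simp
    show "real q * t - real a \<le> \<eta> \<or> real a' - real q' * t \<le> \<eta>"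
    proof (cases "u \<ge> 1")
      case True
      then have "v \<le> 0" using short_vector_outside_cone[OF p mT] by blast
      then have "real_of_int v * (real a' - real q' * t) \<le> 0" using x by (intro mult_nonpos_nonneg) auto
      moreover have "1 * (real q * t - real a) \<le> real_of_int u * (real q * t - real a)"
        using True x by (intro mult_right_mono) auto
      ultimately have "real q * t - real a \<le> \<eta>" using h' by argo
      then show ?thesis ..
    next
      case False
      have "v \<ge> 1"
      proof (rule ccontr)
        assume "\<not> v \<ge> 1"
        then have "u * int q + v * int q' \<le> 0"
          using False by (intro add_nonpos_nonpos mult_nonpos_nonneg) auto
        then show False using B1 m by simp
      qed
      then have "1 * (real a' - real q' * t) \<le> real_of_int v * (real a' - real q' * t)"
        using x by (intro mult_right_mono) auto
      moreover have "real_of_int u * (real q * t - real a) \<le> 0" using False x by (intro mult_nonpos_nonneg) auto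
      ultimately have "real a' - real q' * t \<le> \<eta>" using h' by argo
      then show ?thesis ..
    qed
  }
  assume "real q * t - real a \<le> \<eta> \<or> real a' - real q' * t \<le> \<eta>"
  then show "t \<in> near T \<eta>"
  proof
    assume "real q * t - real a \<le> \<eta>"
    then show ?thesis unfolding near_def using D x by (auto intro!: exI[of _ q] exI[of _ "int a"])
  next
    assume "real a' - real q' * t \<le> \<eta>"
    then show ?thesis unfolding near_def using D x by (auto intro!: exI[of _ q'] exI[of _ "int a'"])
  qed
qed

lemma farey_coprime:
  assumes "(a, q, a', q') \<in> farey T"
  shows "coprime a q" "coprime a' q'"
proof -
  note e = fareyD(6)[OF assms]
  show "coprime a q"
  proof (rule coprimeI)
    fix d assume "d dvd a" "d dvd q"
    then have "d dvd a' * q" "d dvd a * q'" by auto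
    then show "is_unit d" unfolding e by (simp only: dvd_add_right_iff)
  qed
  show "coprime a' q'"
  proof (rule coprimeI)
    fix d assume "d dvd a'" "d dvd q'"
    then have "d dvd a' * q" "d dvd a * q'" by auto
    then show "is_unit d" unfolding e by (simp only: dvd_add_right_iff)
  qed
qed

lemma frac_eq_coprime:
  assumes "coprime a q" "coprime c s" "0 < q" "0 < s" "real a / real q = real c / real s"
  shows "a = c \<and> q = s"
proof -
  have "real a * real s = real c * real q" using assms(3-5) by (simp add: field_simps)
  then have "a * s = c * q" by (metis of_nat_eq_iff of_nat_mult)
  then have "a dvd c * q" "c dvd a * s" "q dvd a * s" "s dvd c * q" by (metis dvd_triv_left dvd_triv_right)+
  then have "a dvd c" "c dvd a" "q dvd s" "s dvd q"
    using assms(1,2) by (simp_all add: coprime_dvd_mult_left_iff coprime_dvd_mult_right_iff coprime_commute)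
  then show ?thesis by (simp add: dvd_antisym)
qed

text \<open>If two cells overlap, then the left end of the second is a short vector to the left of the right end
  of the first. Being outside the cone of the first cell, it is not to the right of its left end. The
  right ends are treated in the same way.\<close>

lemma farey_cell_order:
  assumes p: "(a, q, a', q') \<in> farey T" "t \<in> cell (a, q, a', q')"
    and r: "(c, s, c', s') \<in> farey T" "t \<in> cell (c, s, c', s')"
  shows "real c / real s \<le> real a / real q" "real a' / real q' \<le> real c' / real s'"
proof -
  note D = fareyD[OF p(1)] and E = fareyD[OF r(1)]
  have t: "real a / real q \<le> t" "t < real a' / real q'" "real c / real s \<le> t" "t < real c' / real s'"
    using p(2) r(2) by (auto simp: cell_def)
  have "real c / real s < real a' / real q'" using t by linarith
  then have "real c * real q' < real a' * real s" using D E by (simp add: field_simps)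
  then have u: "int a' * int s - int q' * int c \<ge> 1"
    by (metis int_one_le_iff_zero_less diff_gt_0_iff_gt mult.commute of_nat_less_iff of_nat_mult)
  have "int q * int c - int a * int s \<le> 0"
    by (rule short_vector_outside_cone[OF p(1) _ u])
       (use lattice_basis(1)[OF p(1), of "int s" "int c"] E in simp)
  then have "int q * int c \<le> int a * int s" by simp
  then have "real q * real c \<le> real a * real s" by (metis of_nat_le_iff of_nat_mult)
  then show "real c / real s \<le> real a / real q" using D E by (simp add: field_simps)
  have "real a / real q < real c' / real s'" using t by linarith
  then have "real a * real s' < real c' * real q" using D E by (simp add: field_simps)
  then have v: "int q * int c' - int a * int s' \<ge> 1"
    by (metis int_one_le_iff_zero_less diff_gt_0_iff_gt mult.commute of_nat_less_iff of_nat_mult)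
  have "\<not> int a' * int s' - int q' * int c' \<ge> 1"
  proof
    assume u: "int a' * int s' - int q' * int c' \<ge> 1"
    have "int q * int c' - int a * int s' \<le> 0"
      by (rule short_vector_outside_cone[OF p(1) _ u])
         (use lattice_basis(1)[OF p(1), of "int s'" "int c'"] E in simp)
    then show False using v by simp
  qed
  then have "int a' * int s' \<le> int q' * int c'" by simp
  then have "real a' * real s' \<le> real q' * real c'" by (metis of_nat_le_iff of_nat_mult)
  then show "real a' / real q' \<le> real c' / real s'" using D E by (simp add: field_simps)
qed

lemma farey_cell_unique:
  assumes "p \<in> farey T" "t \<in> cell p" "r \<in> farey T" "t \<in> cell r"
  shows "p = r"
proof -
  obtain a q a' q' where p: "p = (a, q, a', q')" by (metis prod_cases4)
  obtain c s c' s' where r: "r = (c, s, c', s')" by (metis prod_cases4)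
  note P = assms(1,2)[unfolded p] and R = assms(3,4)[unfolded r]
  have e: "real a / real q = real c / real s" "real a' / real q' = real c' / real s'"
    using farey_cell_order[OF P R] farey_cell_order[OF R P] by linarith+
  note cp = farey_coprime[OF P(1)] and cr = farey_coprime[OF R(1)]
  note dp = fareyD(1,3)[OF P(1)] and dr = fareyD(1,3)[OF R(1)]
  have "a = c \<and> q = s" by (rule frac_eq_coprime[OF cp(1) cr(1) dp(1) dr(1) e(1)])
  moreover have "a' = c' \<and> q' = s'" by (rule frac_eq_coprime[OF cp(2) cr(2) dp(2) dr(2) e(2)])
  ultimately show ?thesis using p r by simp
qed

section \<open>The length of the covered part of a cell\<close>

definition cell_weight :: "nat \<times> nat \<times> nat \<times> nat \<Rightarrow> real" where
  "cell_weight = (\<lambda>(a, q, a', q'). 1 / real q + 1 / real q')"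

definition denom_sum :: "nat \<times> nat \<times> nat \<times> nat \<Rightarrow> real" where
  "denom_sum = (\<lambda>(a, q, a', q'). real q + real q')"

lemma near_measurable [measurable]: "near T \<eta> \<in> sets borel"
proof -
  have "near T \<eta> = (\<Union>m\<in>{m. 1 \<le> m \<and> m \<le> T}. \<Union>n::int. {t. \<bar>real m * t - real_of_int n\<bar> \<le> \<eta>})"
    by (auto simp: near_def)
  also have "\<dots> \<in> sets borel"
    by (intro sets.countable_UN'' sets.countable_UN' countableI_type borel_closed closed_Collect_le continuous_intros) auto
  finally show ?thesis .
qed

lemma cell_measurable [measurable]: "cell p \<in> sets borel"
  by (cases p) (simp add: cell_def)

definition left_end :: "nat \<times> nat \<times> nat \<times> nat \<Rightarrow> real" where
  "left_end = (\<lambda>(a, q, a', q'). real a / real q)"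

definition right_end :: "nat \<times> nat \<times> nat \<times> nat \<Rightarrow> real" where
  "right_end = (\<lambda>(a, q, a', q'). real a' / real q')"

lemma cell_eq: "cell p = {left_end p..<right_end p}"
  by (cases p) (simp add: cell_def left_end_def right_end_def)

lemma emeasure_cell_finite: "emeasure lborel (cell p) < \<infinity>"
  unfolding cell_eq by (rule emeasure_bounded_finite, rule bounded_subset[OF bounded_closed_interval[of "left_end p" "right_end p"]]) auto

text \<open>What is left uncovered is the open interval between \<open>(a + \<eta>) / q\<close> and \<open>(a' - \<eta>) / q'\<close>, if it is
  not empty.\<close>

lemma measure_near_cell:
  assumes "p \<in> farey T" "\<eta> \<ge> 0"
  shows "measure lborel (near T \<eta> \<inter> cell p) = cell_weight p * min \<eta> (1 / denom_sum p)"
proof -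
  obtain a q a' q' where pe: "p = (a, q, a', q')" by (metis prod_cases4)
  note P = assms(1)[unfolded pe] note D = fareyD[OF P]
  have q: "real q > 0" "real q' > 0" using D by auto
  let ?l = "(real a + \<eta>) / real q" and ?r = "(real a' - \<eta>) / real q'"
  have eq: "near T \<eta> \<inter> cell p = cell p - (cell p \<inter> {?l<..<?r})"
    using near_in_cell_iff[OF P _ assms(2)] q unfolding pe
    by (auto simp: field_simps not_less)
  have sub: "cell p \<inter> {?l<..<?r} = {?l<..<?r}"
  proof -
    have "real a / real q \<le> ?l" "?r \<le> real a' / real q'" using assms(2) q by (simp_all add: divide_right_mono)
    then show ?thesis by (auto simp: pe cell_def)
  qed
  have len: "real a' / real q' - real a / real q = 1 / (real q * real q')" by (rule cell_length[OF P])
  have rl: "?r - ?l = (1 - \<eta> * (real q + real q')) / (real q * real q')"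
  proof -
    have "?r - ?l = (real a' / real q' - real a / real q) - \<eta> / real q - \<eta> / real q'" by (simp add: diff_divide_distrib add_divide_distrib)
    also have "\<dots> = (1 - \<eta> * (real q + real q')) / (real q * real q')" unfolding len using q by (simp add: field_simps)
    finally show ?thesis .
  qed
  have mcell: "measure lborel (cell p) = 1 / (real q * real q')"
  proof -
    have "0 < 1 / (real q * real q')" using q by simp
    then have "real a / real q \<le> real a' / real q'" using len by linarith
    then show ?thesis unfolding pe cell_def using len by (simp add: measure_def)
  qed
  have "measure lborel (near T \<eta> \<inter> cell p) = measure lborel (cell p) - measure lborel (cell p \<inter> {?l<..<?r})"
    unfolding eq by (rule measure_Diff) (use emeasure_cell_finite[of p] in auto)
  also have "\<dots> = 1 / (real q * real q') - max 0 (?r - ?l)"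
    unfolding sub mcell by (cases "?l \<le> ?r") (simp_all add: measure_def)
  also have "\<dots> = (1 / real q + 1 / real q') * min \<eta> (1 / (real q + real q'))"
  proof (cases "\<eta> * (real q + real q') \<le> 1")
    case True
    then have "\<eta> \<le> 1 / (real q + real q')" using q by (simp add: field_simps)
    moreover have "(1 - \<eta> * (real q + real q')) / (real q * real q') \<ge> 0" using True q by simp
    ultimately show ?thesis unfolding rl using q by (simp add: field_simps)
  next
    case False
    then have "\<not> \<eta> \<le> 1 / (real q + real q')" using q by (simp add: field_simps)
    moreover have "(1 - \<eta> * (real q + real q')) / (real q * real q') \<le> 0" using False q by (simp add: divide_nonpos_pos)
    ultimately show ?thesis unfolding rl using q by (simp add: field_simps)
  qed
  finally show ?thesis by (simp add: pe cell_weight_def denom_sum_def)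
qed

lemma left_less_right: "p \<in> farey T \<Longrightarrow> left_end p < right_end p"
proof -
  assume "p \<in> farey T"
  moreover obtain a q a' q' where pe: "p = (a, q, a', q')" by (metis prod_cases4)
  ultimately have P: "(a, q, a', q') \<in> farey T" by simp
  have "0 < 1 / (real q * real q')" using fareyD(1,3)[OF P] by simp
  then have "real a / real q < real a' / real q'" using cell_length[OF P] by linarith
  then show ?thesis unfolding pe left_end_def right_end_def by simp
qed

lemma card_straddling_le: "card {p \<in> farey T. left_end p < b \<and> b < right_end p} \<le> 1"
proof -
  let ?S = "{p \<in> farey T. left_end p < b \<and> b < right_end p}"
  have "x = y" if "x \<in> ?S" "y \<in> ?S" for x y
    using that farey_cell_unique[of x T b y] by (simp add: cell_eq)
  then show ?thesis using card_le_Suc0_iff_eq[of ?S] by simp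
qed

lemma cell_weight_bounds:
  assumes "p \<in> farey T" shows "0 \<le> cell_weight p" "cell_weight p \<le> 2" "denom_sum p > real T"
proof -
  obtain a q a' q' where pe: "p = (a, q, a', q')" by (metis prod_cases4)
  note D = fareyD[OF assms[unfolded pe]]
  have "1 / real q \<le> 1" "1 / real q' \<le> 1" using D by auto
  then show "0 \<le> cell_weight p" "cell_weight p \<le> 2" by (auto simp: pe cell_weight_def)
  show "denom_sum p > real T" using D(5) by (simp add: pe denom_sum_def flip: of_nat_add)
qed

text \<open>Only the cell that contains \<open>b\<close> in its interior is counted wrongly.\<close>

lemma measure_near_sum_cells:
  assumes "T > 0" "\<eta> \<ge> 0" "0 \<le> b" "b \<le> 1"
  shows "\<bar>measure lborel (near T \<eta> \<inter> {0..<b}) - (\<Sum>p | p \<in> farey T \<and> left_end p < b. cell_weight p * min \<eta> (1 / denom_sum p))\<bar> \<le> 2 * \<eta>"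
proof -
  let ?A = "\<lambda>p. near T \<eta> \<inter> cell p \<inter> {0..<b}"
  let ?g = "\<lambda>p. cell_weight p * min \<eta> (1 / denom_sum p)"
  let ?F = "{p \<in> farey T. left_end p < b}" and ?S = "{p \<in> farey T. left_end p < b \<and> b < right_end p}"
  have fin_cell: "emeasure lborel (near T \<eta> \<inter> cell p) < \<infinity>" for p
  proof -
    have "emeasure lborel (near T \<eta> \<inter> cell p) \<le> emeasure lborel (cell p)" by (rule emeasure_mono) auto
    also have "\<dots> < \<infinity>" by (rule emeasure_cell_finite)
    finally show ?thesis .
  qed
  have fin: "emeasure lborel (?A p) < \<infinity>" for p
    by (rule order_le_less_trans[OF emeasure_mono fin_cell[of p]]) auto
  have "near T \<eta> \<inter> {0..<b} = (\<Union>p\<in>farey T. ?A p)"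
  proof (intro equalityI subsetI)
    fix t assume t: "t \<in> near T \<eta> \<inter> {0..<b}"
    then obtain p where "p \<in> farey T" "t \<in> cell p" using farey_cover[OF assms(1), of t] assms by auto
    then show "t \<in> (\<Union>p\<in>farey T. ?A p)" using t by blast
  qed auto
  then have "measure lborel (near T \<eta> \<inter> {0..<b}) = measure lborel (\<Union>p\<in>farey T. ?A p)" by simp
  also have "\<dots> = (\<Sum>p\<in>farey T. measure lborel (?A p))"
  proof (rule measure_finite_Union)
    show "disjoint_family_on ?A (farey T)"
      unfolding disjoint_family_on_def using farey_cell_unique by blast
    show "emeasure lborel (?A p) \<noteq> \<infinity>" for p using fin[of p] by simp
  qed (auto simp: image_subset_iff)
  also have "\<dots> = (\<Sum>p\<in>?F. measure lborel (?A p))"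
  proof (rule sum.mono_neutral_right)
    show "\<forall>p\<in>farey T - ?F. measure lborel (?A p) = 0"
    proof
      fix p assume "p \<in> farey T - ?F"
      then have "?A p = {}" by (auto simp: cell_eq)
      then show "measure lborel (?A p) = 0" by simp
    qed
  qed auto
  finally have m: "measure lborel (near T \<eta> \<inter> {0..<b}) = (\<Sum>p\<in>?F. measure lborel (?A p))" .
  have le: "measure lborel (?A p) \<le> ?g p" if "p \<in> farey T" for p
    unfolding measure_near_cell[OF that assms(2), symmetric]
    by (rule measure_mono_fmeasurable) (auto intro: fmeasurableI fin_cell)
  have eq: "measure lborel (?A p) = ?g p" if "p \<in> farey T" "right_end p \<le> b" for p
  proof -
    have "left_end p \<ge> 0" by (cases p) (simp add: left_end_def)
    then have "?A p = near T \<eta> \<inter> cell p" using that by (auto simp: cell_eq)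
    then show ?thesis using measure_near_cell[OF that(1) assms(2)] by simp
  qed
  have "(\<Sum>p\<in>?F. ?g p) - measure lborel (near T \<eta> \<inter> {0..<b}) = (\<Sum>p\<in>?F. ?g p - measure lborel (?A p))"
    unfolding m by (simp add: sum_subtractf)
  also have "\<dots> = (\<Sum>p\<in>?S. ?g p - measure lborel (?A p))"
  proof (rule sum.mono_neutral_right)
    show "\<forall>p\<in>?F - ?S. ?g p - measure lborel (?A p) = 0"
    proof
      fix p assume "p \<in> ?F - ?S"
      then have "p \<in> farey T" "right_end p \<le> b" by (auto simp: not_less)
      then show "?g p - measure lborel (?A p) = 0" using eq[of p] by simp
    qed
  qed auto
  finally have d: "(\<Sum>p\<in>?F. ?g p) - measure lborel (near T \<eta> \<inter> {0..<b}) = (\<Sum>p\<in>?S. ?g p - measure lborel (?A p))" .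
  have "(\<Sum>p\<in>?S. ?g p - measure lborel (?A p)) \<ge> 0" by (rule sum_nonneg) (use le in auto)
  moreover have "(\<Sum>p\<in>?S. ?g p - measure lborel (?A p)) \<le> real (card ?S) * (2 * \<eta>)"
  proof (rule sum_bounded_above)
    fix p assume p: "p \<in> ?S"
    then have "?g p \<le> 2 * \<eta>" using cell_weight_bounds[of p T] assms(2)
      by (intro mult_mono) (auto simp: min_def)
    then show "?g p - measure lborel (?A p) \<le> 2 * \<eta>" using measure_nonneg[of lborel "?A p"] by linarith
  qed
  moreover have "real (card ?S) * (2 * \<eta>) \<le> 1 * (2 * \<eta>)"
    using card_straddling_le[of T b] assms(2) by (intro mult_right_mono) auto
  ultimately show ?thesis using d by auto
qed

section \<open>Counting cells\<close>

text \<open>For a fixed denominator \<open>q\<close>, the denominators \<open>q'\<close> of the neighbours satisfy \<open>T - q < q' \<le> T\<close>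
  and \<open>q' \<le> s - q\<close>. This is an interval of length at most \<open>q\<close>, as \<open>hyperbola_box_count\<close>
  demands; rounding its length and the length \<open>b q\<close> of the other side costs the constant \<open>2\<close>.\<close>

lemma neighbour_count:
  fixes b s :: real and c :: int and v0 A :: nat
  assumes q: "0 < q" "q \<le> T" and b: "0 \<le> b" "b \<le> 1"
    and c: "coprime c (int q)" and A: "A \<le> q" "\<bar>real A - b * real q\<bar> \<le> 1"
  defines "N \<equiv> card {(q', a). 1 \<le> q' \<and> q' \<le> T \<and> T < q + q' \<and> real q + real q' \<le> s \<and>
             a \<in> {v0..<v0 + A} \<and> [int q' * int a = c] (mod int q)}"
  shows "\<bar>real N - b * (real (totient q) / real q) * max 0 (min (real q) (s - real T))\<bar> \<le> hyperbola_error q + 2"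
proof -
  define L where "L = min q (nat \<lfloor>s - real T\<rfloor>)"
  have bq: "b * real q \<le> real q" "0 \<le> b * real q" using b mult_right_mono[of b 1 "real q"] by auto
  have L: "L \<le> q" by (simp add: L_def)
  let ?X = "{(q', a). 1 \<le> q' \<and> q' \<le> T \<and> T < q + q' \<and> real q + real q' \<le> s \<and>
             a \<in> {v0..<v0 + A} \<and> [int q' * int a = c] (mod int q)}"
  let ?u0 = "int T - int q + 1"
  let ?Y = "{(u, v). u \<in> {?u0..<?u0 + int L} \<and> v \<in> {int v0..<int v0 + int A} \<and> [u * v = c] (mod int q)}"
  have qv: "1 \<le> q' \<and> q' \<le> T \<and> T < q + q' \<and> real q + real q' \<le> s \<longleftrightarrow> int q' \<in> {?u0..<?u0 + int L}" for q'
  proof -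
    have "real q + real q' \<le> s \<longleftrightarrow> int q + int q' - int T \<le> \<lfloor>s - real T\<rfloor>"
      unfolding le_floor_iff by auto
    then show ?thesis using q unfolding L_def by (auto simp: min_def)
  qed
  have "bij_betw (\<lambda>(q', a). (int q', int a)) ?X ?Y"
  proof (rule bij_betwI[where g = "\<lambda>(u, v). (nat u, nat v)"])
    show "(\<lambda>(q', a). (int q', int a)) \<in> ?X \<rightarrow> ?Y"
    proof
      fix p assume p: "p \<in> ?X"
      obtain q' a where pe: "p = (q', a)" by fastforce
      have "int q' \<in> {?u0..<?u0 + int L}" using p qv[of q'] unfolding pe by blast
      then show "(\<lambda>(q', a). (int q', int a)) p \<in> ?Y" using p unfolding pe by auto
    qed
    show "(\<lambda>(u, v). (nat u, nat v)) \<in> ?Y \<rightarrow> ?X"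
    proof
      fix p assume p: "p \<in> ?Y"
      obtain u v where pe: "p = (u, v)" by fastforce
      have nn: "u \<ge> 0" "v \<ge> 0" using p q unfolding pe by auto
      have "int (nat u) \<in> {?u0..<?u0 + int L}" using p nn unfolding pe by auto
      then have "1 \<le> nat u \<and> nat u \<le> T \<and> T < q + nat u \<and> real q + real (nat u) \<le> s"
        using qv[of "nat u"] by blast
      moreover have "nat v \<in> {v0..<v0 + A}" "[int (nat u) * int (nat v) = c] (mod int q)"
        using p nn unfolding pe by auto
      ultimately show "(\<lambda>(u, v). (nat u, nat v)) p \<in> ?X"
        unfolding pe by (simp only: prod.case mem_Collect_eq)
    qed
  qed (use q in auto)
  then have N: "N = card ?Y" unfolding N_def by (rule bij_betw_same_card)
  have box: "\<bar>real N - real (totient q) / real q ^ 2 * real L * real A\<bar> \<le> hyperbola_error q"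
    unfolding N by (rule hyperbola_box_count) (use q A L c in auto)
  let ?M = "max 0 (min (real q) (s - real T))"
  have LM: "\<bar>real L - ?M\<bar> \<le> 1"
  proof (cases "s - real T \<ge> 0")
    case True
    then have "real (nat \<lfloor>s - real T\<rfloor>) = real_of_int \<lfloor>s - real T\<rfloor>" by simp
    then have fl: "real (nat \<lfloor>s - real T\<rfloor>) \<le> s - real T" "s - real T < real (nat \<lfloor>s - real T\<rfloor>) + 1" by linarith+
    have "\<bar>min Q k - max 0 (min Q x)\<bar> \<le> 1" if "k \<le> x" "x < k + 1" "0 \<le> x" "0 < Q" for Q k x :: real
      using that by (auto simp: min_def max_def)
    from this[OF fl True] show ?thesis unfolding L_def of_nat_min using q by simp
  next
    case False
    then show ?thesis unfolding L_def by (auto simp: min_def max_def)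
  qed
  have tq: "real (totient q) \<le> real q" by (simp add: totient_le)
  have "real (totient q) / real q ^ 2 * real L * real A - b * (real (totient q) / real q) * ?M =
      real (totient q) / real q ^ 2 * (real L * (real A - b * real q) + b * real q * (real L - ?M))"
    using q by (simp add: field_simps power2_eq_square)
  then have "\<bar>real (totient q) / real q ^ 2 * real L * real A - b * (real (totient q) / real q) * ?M\<bar> =
      real (totient q) / real q ^ 2 * \<bar>real L * (real A - b * real q) + b * real q * (real L - ?M)\<bar>"
    by (simp add: abs_mult)
  also have "\<dots> \<le> real q / real q ^ 2 * (real q * 1 + real q * 1)"
  proof (intro mult_mono divide_right_mono tq)
    have "\<bar>real L * (real A - b * real q)\<bar> \<le> real q * 1"
      unfolding abs_mult using L A by (intro mult_mono) auto
    moreover have "\<bar>b * real q * (real L - ?M)\<bar> \<le> real q * 1"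
      unfolding abs_mult[of "b * real q"] using bq LM by (intro mult_mono) auto
    ultimately show "\<bar>real L * (real A - b * real q) + b * real q * (real L - ?M)\<bar> \<le> real q * 1 + real q * 1"
      by linarith
  qed auto
  also have "\<dots> = 2" using q by (simp add: power2_eq_square)
  finally show ?thesis using box by argo
qed

text \<open>Here \<open>a / q\<close> is the left end of the cell; the numerator \<open>(a q' + 1) / q\<close> of the right end is
  determined by \<open>a\<close> and \<open>q'\<close>.\<close>

lemma left_neighbour_count:
  fixes b s :: real
  assumes q: "0 < q" "q \<le> T" and b: "0 \<le> b" "b \<le> 1"
  shows "\<bar>real (card {(q', a). 1 \<le> q' \<and> q' \<le> T \<and> T < q + q' \<and> real q + real q' \<le> s \<and> real a < b * real q \<and> q dvd a * q' + 1})
     - b * (real (totient q) / real q) * max 0 (min (real q) (s - real T))\<bar> \<le> hyperbola_error q + 2"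
proof -
  define A where "A = nat \<lceil>b * real q\<rceil>"
  have bq: "b * real q \<le> real q" "0 \<le> b * real q" using b mult_right_mono[of b 1 "real q"] by auto
  have A: "A \<le> q" unfolding A_def using bq by (simp add: nat_le_iff ceiling_le_iff)
  have "real A = real_of_int \<lceil>b * real q\<rceil>" using bq by (simp add: A_def)
  then have AM: "\<bar>real A - b * real q\<bar> \<le> 1" by linarith
  have dv: "q dvd a * q' + 1 \<longleftrightarrow> [int q' * int a = - 1] (mod int q)" for a q'
  proof -
    have "q dvd a * q' + 1 \<longleftrightarrow> int q dvd int (a * q' + 1)" by (simp only: int_dvd_int_iff)
    also have "\<dots> \<longleftrightarrow> [int q' * int a = - 1] (mod int q)" by (simp add: cong_iff_dvd_diff mult.commute add.commute)
    finally show ?thesis .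
  qed
  have av: "real a < b * real q \<longleftrightarrow> a \<in> {0..<0 + A}" for a
    unfolding A_def using bq by (simp add: less_ceiling_iff zless_nat_eq_int_zless)
  show ?thesis unfolding av dv
    by (rule neighbour_count) (use q b A AM in auto)
qed

text \<open>Here \<open>a / q\<close> is the right end of the cell; the numerator \<open>(a q' - 1) / q\<close> of the left end is
  determined by \<open>a\<close> and \<open>q'\<close>.\<close>

lemma right_neighbour_count:
  fixes b s :: real
  assumes q: "0 < q" "q \<le> T" and b: "0 \<le> b" "b \<le> 1"
  shows "\<bar>real (card {(q', a). 1 \<le> q' \<and> q' \<le> T \<and> T < q + q' \<and> real q + real q' \<le> s \<and> (1 \<le> a \<and> real a \<le> b * real q) \<and> [a * q' = 1] (mod q)})
     - b * (real (totient q) / real q) * max 0 (min (real q) (s - real T))\<bar> \<le> hyperbola_error q + 2"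
proof -
  define A where "A = nat \<lfloor>b * real q\<rfloor>"
  have bq: "b * real q \<le> real q" "0 \<le> b * real q" using b mult_right_mono[of b 1 "real q"] by auto
  have A: "A \<le> q" unfolding A_def using bq by (simp add: nat_le_iff floor_le_iff)
  have "real A = real_of_int \<lfloor>b * real q\<rfloor>" using bq by (simp add: A_def)
  then have AM: "\<bar>real A - b * real q\<bar> \<le> 1" by linarith
  have dv: "[a * q' = 1] (mod q) \<longleftrightarrow> [int q' * int a = 1] (mod int q)" for a q'
    using cong_int_iff[of "a * q'" 1 q] by (simp add: mult.commute)
  have av: "1 \<le> a \<and> real a \<le> b * real q \<longleftrightarrow> a \<in> {1..<1 + A}" for a
  proof -
    have "real a \<le> b * real q \<longleftrightarrow> a \<le> A"
      unfolding A_def using bq by (simp add: le_nat_iff le_floor_iff)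
    then show ?thesis by auto
  qed
  show ?thesis unfolding av dv
    by (rule neighbour_count) (use q b A AM in auto)
qed

section \<open>Weighted sums over cells\<close>

lemma farey_left_sum:
  fixes b s :: real
  assumes "b \<le> 1"
  shows "(\<Sum>p\<in>{p \<in> farey T. left_end p < b \<and> denom_sum p \<le> s}. 1 / real (fst (snd p))) =
    (\<Sum>q=1..T. real (card {(q', a). 1 \<le> q' \<and> q' \<le> T \<and> T < q + q' \<and> real q + real q' \<le> s \<and> real a < b * real q \<and> q dvd a * q' + 1}) * (1 / real q))"
proof -
  let ?X = "\<lambda>q. {(q', a). 1 \<le> q' \<and> q' \<le> T \<and> T < q + q' \<and> real q + real q' \<le> s \<and> real a < b * real q \<and> q dvd a * q' + 1}"
  have less: "a < q" if "real a < b * real q" for a q :: nat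
  proof -
    have "b * real q \<le> 1 * real q" using assms by (intro mult_right_mono) auto
    then show ?thesis using that by simp
  qed
  have fin: "finite (?X q)" for q
    by (rule finite_subset[of _ "{..T} \<times> {..<q}"]) (auto intro: less)
  have "(\<Sum>p\<in>{p \<in> farey T. left_end p < b \<and> denom_sum p \<le> s}. 1 / real (fst (snd p))) =
     (\<Sum>(q, x)\<in>(SIGMA q:{1..T}. ?X q). 1 / real q)"
  proof (rule sum.reindex_bij_witness[where
        i = "\<lambda>(q, (q', a)). (a, q, (a * q' + 1) div q, q')" and j = "\<lambda>(a, q, a', q'). (q, (q', a))"])
    fix p assume "p \<in> {p \<in> farey T. left_end p < b \<and> denom_sum p \<le> s}"
    moreover obtain a q a' q' where pe: "p = (a, q, a', q')" by (metis prod_cases4)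
    ultimately have P: "(a, q, a', q') \<in> farey T" and le: "real a / real q < b" and s: "real q + real q' \<le> s"
      by (auto simp: left_end_def denom_sum_def)
    note D = fareyD[OF P]
    have "(a * q' + 1) div q = a'" using D(1,6) by (metis nonzero_mult_div_cancel_right not_less0)
    then show "(\<lambda>(q, (q', a)). (a, q, (a * q' + 1) div q, q')) ((\<lambda>(a, q, a', q'). (q, (q', a))) p) = p"
      unfolding pe by simp
    have "real a < b * real q" using le D(1) by (simp add: field_simps)
    moreover have "q dvd a * q' + 1" using D(6) by (metis dvd_triv_right)
    ultimately show "(\<lambda>(a, q, a', q'). (q, (q', a))) p \<in> (SIGMA q:{1..T}. ?X q)" unfolding pe using D s by simp
    show "(case (\<lambda>(a, q, a', q'). (q, (q', a))) p of (q, x) \<Rightarrow> 1 / real q) = 1 / real (fst (snd p))" unfolding pe by simp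
  next
    fix y assume "y \<in> (SIGMA q:{1..T}. ?X q)"
    moreover obtain q q' a where ye: "y = (q, (q', a))" by (metis prod_cases3)
    ultimately have y: "1 \<le> q" "q \<le> T" "1 \<le> q'" "q' \<le> T" "T < q + q'" "real q + real q' \<le> s" "real a < b * real q" "q dvd a * q' + 1"
      by auto
    have aq: "a < q" by (rule less[OF y(7)])
    have "(a * q' + 1) div q * q = a * q' + 1" using y(8) by simp
    then have "(a, q, (a * q' + 1) div q, q') \<in> farey T" using y aq by (simp add: farey_def)
    moreover have "real a / real q < b" using y by (simp add: field_simps)
    ultimately show "(\<lambda>(q, (q', a)). (a, q, (a * q' + 1) div q, q')) y \<in> {p \<in> farey T. left_end p < b \<and> denom_sum p \<le> s}"
      unfolding ye using y by (simp add: left_end_def denom_sum_def)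
    show "(\<lambda>(a, q, a', q'). (q, (q', a))) ((\<lambda>(q, (q', a)). (a, q, (a * q' + 1) div q, q')) y) = y" unfolding ye by simp
  qed
  also have "\<dots> = (\<Sum>q=1..T. \<Sum>x\<in>?X q. 1 / real q)"
    by (rule sum.Sigma[symmetric], simp, intro ballI fin)
  finally show ?thesis by simp
qed

lemma farey_right_sum:
  fixes b s :: real
  assumes "b \<le> 1"
  shows "(\<Sum>p\<in>{p \<in> farey T. right_end p \<le> b \<and> denom_sum p \<le> s}. 1 / real (snd (snd (snd p)))) =
    (\<Sum>q=1..T. real (card {(q', a). 1 \<le> q' \<and> q' \<le> T \<and> T < q + q' \<and> real q + real q' \<le> s \<and> (1 \<le> a \<and> real a \<le> b * real q) \<and> [a * q' = 1] (mod q)}) * (1 / real q))"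
proof -
  let ?X = "\<lambda>q. {(q', a). 1 \<le> q' \<and> q' \<le> T \<and> T < q + q' \<and> real q + real q' \<le> s \<and> (1 \<le> a \<and> real a \<le> b * real q) \<and> [a * q' = 1] (mod q)}"
  have le: "a \<le> q" if "real a \<le> b * real q" for a q :: nat
  proof -
    have "b * real q \<le> 1 * real q" using assms by (intro mult_right_mono) auto
    then show ?thesis using that by simp
  qed
  have fin: "finite (?X q)" for q
    by (rule finite_subset[of _ "{..T} \<times> {..q}"]) (auto intro: le)
  have "(\<Sum>p\<in>{p \<in> farey T. right_end p \<le> b \<and> denom_sum p \<le> s}. 1 / real (snd (snd (snd p)))) =
     (\<Sum>(q, x)\<in>(SIGMA q:{1..T}. ?X q). 1 / real q)"
  proof (rule sum.reindex_bij_witness[where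
        i = "\<lambda>(q', (q, a')). ((a' * q - 1) div q', q, a', q')" and j = "\<lambda>(a, q, a', q'). (q', (q, a'))"])
    fix p assume "p \<in> {p \<in> farey T. right_end p \<le> b \<and> denom_sum p \<le> s}"
    moreover obtain a q a' q' where pe: "p = (a, q, a', q')" by (metis prod_cases4)
    ultimately have P: "(a, q, a', q') \<in> farey T" and re: "real a' / real q' \<le> b" and s: "real q + real q' \<le> s"
      by (auto simp: right_end_def denom_sum_def)
    note D = fareyD[OF P]
    have "(a' * q - 1) div q' = a" unfolding D(6) using D(3) by simp
    then show "(\<lambda>(q', (q, a')). ((a' * q - 1) div q', q, a', q')) ((\<lambda>(a, q, a', q'). (q', (q, a'))) p) = p"
      unfolding pe by simp
    have "real a' \<le> b * real q'" using re D(3) by (simp add: field_simps)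
    moreover have "[a' * q = 1] (mod q')" unfolding D(6) by (simp only: cong_def mod_mult_self3)
    ultimately show "(\<lambda>(a, q, a', q'). (q', (q, a'))) p \<in> (SIGMA q:{1..T}. ?X q)" unfolding pe using D s by simp
    show "(case (\<lambda>(a, q, a', q'). (q', (q, a'))) p of (q, x) \<Rightarrow> 1 / real q) = 1 / real (snd (snd (snd p)))" unfolding pe by simp
  next
    fix y assume "y \<in> (SIGMA q:{1..T}. ?X q)"
    moreover obtain q' q a' where ye: "y = (q', (q, a'))" by (metis prod_cases3)
    ultimately have y: "1 \<le> q'" "q' \<le> T" "1 \<le> q" "q \<le> T" "T < q + q'" "real q + real q' \<le> s" "1 \<le> a'" "real a' \<le> b * real q'" "[a' * q = 1] (mod q')"
      by (auto simp: add.commute)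
    have aq: "a' \<le> q'" by (rule le[OF y(8)])
    have ge: "1 \<le> a' * q" using y by simp
    have "q' dvd a' * q - 1" using y(9) unfolding cong_def mod_eq_dvd_iff_nat[OF ge] .
    then have e: "(a' * q - 1) div q' * q' = a' * q - 1" by simp
    then have d: "a' * q = (a' * q - 1) div q' * q' + 1" using ge by simp
    have "(a' * q - 1) div q' < q"
    proof (rule ccontr)
      assume "\<not> ?thesis"
      then have "q * q' \<le> (a' * q - 1) div q' * q'" by (intro mult_right_mono) auto
      then have "q * q' + 1 \<le> a' * q" using d by linarith
      moreover have "a' * q \<le> q' * q" using aq by simp
      ultimately show False by (simp add: mult.commute)
    qed
    then have "((a' * q - 1) div q', q, a', q') \<in> farey T" using y d by (simp add: farey_def)
    moreover have "real a' / real q' \<le> b" using y by (simp add: field_simps)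
    ultimately show "(\<lambda>(q', (q, a')). ((a' * q - 1) div q', q, a', q')) y \<in> {p \<in> farey T. right_end p \<le> b \<and> denom_sum p \<le> s}"
      unfolding ye using y by (simp add: right_end_def denom_sum_def)
    show "(\<lambda>(a, q, a', q'). (q', (q, a'))) ((\<lambda>(q', (q, a')). ((a' * q - 1) div q', q, a', q')) y) = y" unfolding ye by simp
  qed
  also have "\<dots> = (\<Sum>q=1..T. \<Sum>x\<in>?X q. 1 / real q)"
    by (rule sum.Sigma[symmetric], simp, intro ballI fin)
  finally show ?thesis by simp
qed

lemma weighted_count_sum:
  fixes N :: "nat \<Rightarrow> real"
  assumes "T > 0" "0 \<le> b" "b \<le> 1"
    and "\<And>q. 0 < q \<Longrightarrow> q \<le> T \<Longrightarrow> \<bar>N q - b * (real (totient q) / real q) * max 0 (min (real q) (s - real T))\<bar> \<le> hyperbola_error q + 2"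
  shows "\<bar>(\<Sum>q=1..T. N q * (1 / real q)) - b * (6 / pi ^ 2) * clipped_log (real T) (s - real T)\<bar> \<le>
     (\<Sum>q=1..T. hyperbola_error q * (1 / real q)) + 6 * (1 + ln (real T))"
proof -
  let ?L = "s - real T"
  let ?m = "\<lambda>q. real (totient q) / real q * max 0 (min 1 (?L / real q))"
  have "\<bar>(\<Sum>q=1..T. N q * (1 / real q)) - b * (\<Sum>q=1..T. ?m q)\<bar> = \<bar>\<Sum>q=1..T. N q * (1 / real q) - b * ?m q\<bar>"
    by (simp only: sum_subtractf sum_distrib_left)
  also have "\<dots> \<le> (\<Sum>q=1..T. (hyperbola_error q + 2) * (1 / real q))"
  proof (rule order_trans[OF sum_abs sum_mono])
    fix q assume q: "q \<in> {1..T}"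
    then have qp: "real q > 0" by simp
    have "max 0 (min (real q) ?L) = real q * max 0 (min 1 (?L / real q))"
      using qp by (auto simp: max_def min_def field_simps)
    then have "N q * (1 / real q) - b * ?m q = (N q - b * (real (totient q) / real q) * max 0 (min (real q) ?L)) * (1 / real q)"
      using qp by (simp add: field_simps)
    then have "\<bar>N q * (1 / real q) - b * ?m q\<bar> = \<bar>N q - b * (real (totient q) / real q) * max 0 (min (real q) ?L)\<bar> * (1 / real q)"
      using qp by (simp only: abs_mult) simp
    also have "\<dots> \<le> (hyperbola_error q + 2) * (1 / real q)"
      using assms(4)[of q] q by (intro mult_right_mono) auto
    finally show "\<bar>N q * (1 / real q) - b * ?m q\<bar> \<le> (hyperbola_error q + 2) * (1 / real q)" .
  qed
  also have "\<dots> = (\<Sum>q=1..T. hyperbola_error q * (1 / real q)) + 2 * (\<Sum>q=1..T. 1 / real q)"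
    by (simp add: distrib_right sum.distrib sum_distrib_left add_divide_distrib)
  also have "\<dots> \<le> (\<Sum>q=1..T. hyperbola_error q * (1 / real q)) + 2 * (1 + ln (real T))"
    using harm_le_ln[OF assms(1)] by simp
  finally have 1: "\<bar>(\<Sum>q=1..T. N q * (1 / real q)) - b * (\<Sum>q=1..T. ?m q)\<bar> \<le> (\<Sum>q=1..T. hyperbola_error q * (1 / real q)) + 2 * (1 + ln (real T))" .
  have "b * (\<Sum>q=1..T. ?m q) - b * (6 / pi ^ 2) * clipped_log (real T) ?L = b * ((\<Sum>q=1..T. ?m q) - 6 / pi ^ 2 * clipped_log (real T) ?L)"
    by (simp only: right_diff_distrib mult.assoc)
  then have "\<bar>b * (\<Sum>q=1..T. ?m q) - b * (6 / pi ^ 2) * clipped_log (real T) ?L\<bar> = b * \<bar>(\<Sum>q=1..T. ?m q) - 6 / pi ^ 2 * clipped_log (real T) ?L\<bar>"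
    using assms(2) by (simp only: abs_mult abs_of_nonneg)
  also have "\<dots> \<le> 1 * (4 * (1 + ln (real T)))"
    using sum_totient_min[OF assms(1), of ?L] assms(1,2,3) by (intro mult_mono) auto
  finally have 2: "\<bar>b * (\<Sum>q=1..T. ?m q) - b * (6 / pi ^ 2) * clipped_log (real T) ?L\<bar> \<le> 4 * (1 + ln (real T))" by simp
  show ?thesis using 1 2 by argo
qed

text \<open>The weights \<open>1/q\<close> of the left ends and \<open>1/q'\<close> of the right ends each give half of the main term. For
  the right ends the condition \<open>left_end p < b\<close> is first replaced by \<open>right_end p \<le> b\<close>, which removes
  at most the one cell around \<open>b\<close>.\<close>

lemma farey_weight_sum:
  fixes b s :: real
  assumes "T > 0" "0 \<le> b" "b \<le> 1"
  shows "\<bar>(\<Sum>p\<in>{p \<in> farey T. left_end p < b \<and> denom_sum p \<le> s}. cell_weight p) - b * (12 / pi ^ 2 * clipped_log (real T) (s - real T))\<bar> \<le>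
     2 * (\<Sum>q=1..T. hyperbola_error q * (1 / real q)) + 13 * (1 + ln (real T))"
proof -
  let ?F = "{p \<in> farey T. left_end p < b \<and> denom_sum p \<le> s}"
  let ?G = "{p \<in> farey T. right_end p \<le> b \<and> denom_sum p \<le> s}"
  let ?l = "\<lambda>p. 1 / real (fst (snd p))" and ?r = "\<lambda>p. 1 / real (snd (snd (snd p)))"
  let ?M = "b * (6 / pi ^ 2) * clipped_log (real T) (s - real T)"
  have w: "cell_weight p = ?l p + ?r p" for p by (cases p) (simp add: cell_weight_def)
  have sub: "?G \<subseteq> ?F" using left_less_right by force
  have "(\<Sum>p\<in>?F. ?r p) = (\<Sum>p\<in>?G. ?r p) + (\<Sum>p\<in>?F - ?G. ?r p)"
    using sub by (intro sum.subset_diff[THEN trans[OF _ add.commute]]) auto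
  moreover have "(\<Sum>p\<in>?F - ?G. ?r p) \<le> 1"
  proof -
    have "(\<Sum>p\<in>?F - ?G. ?r p) \<le> real (card (?F - ?G)) * 1"
    proof (rule sum_bounded_above)
      fix p assume "p \<in> ?F - ?G"
      moreover obtain a q a' q' where pe: "p = (a, q, a', q')" by (metis prod_cases4)
      ultimately have "(a, q, a', q') \<in> farey T" by auto
      from fareyD(3)[OF this] show "?r p \<le> 1" unfolding pe by simp
    qed
    also have "card (?F - ?G) \<le> card {p \<in> farey T. left_end p < b \<and> b < right_end p}"
      by (intro card_mono) auto
    then have "real (card (?F - ?G)) * 1 \<le> 1" using card_straddling_le[of T b] by simp
    finally show ?thesis .
  qed
  moreover have "(\<Sum>p\<in>?F - ?G. ?r p) \<ge> 0" by (intro sum_nonneg) auto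
  ultimately have r: "\<bar>(\<Sum>p\<in>?F. ?r p) - (\<Sum>p\<in>?G. ?r p)\<bar> \<le> 1" by simp
  have L: "\<bar>(\<Sum>p\<in>?F. ?l p) - ?M\<bar> \<le> (\<Sum>q=1..T. hyperbola_error q * (1 / real q)) + 6 * (1 + ln (real T))"
    unfolding farey_left_sum[OF assms(3)]
    by (intro weighted_count_sum left_neighbour_count assms)
  have R: "\<bar>(\<Sum>p\<in>?G. ?r p) - ?M\<bar> \<le> (\<Sum>q=1..T. hyperbola_error q * (1 / real q)) + 6 * (1 + ln (real T))"
    unfolding farey_right_sum[OF assms(3)]
    by (intro weighted_count_sum right_neighbour_count assms)
  have "(\<Sum>p\<in>?F. cell_weight p) = (\<Sum>p\<in>?F. ?l p) + (\<Sum>p\<in>?F. ?r p)"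
    unfolding w by (rule sum.distrib)
  moreover have "b * (12 / pi ^ 2 * clipped_log (real T) (s - real T)) = ?M + ?M" by simp
  moreover have "ln (real T) \<ge> 0" using assms(1) by simp
  ultimately show ?thesis using r L R by argo
qed

text \<open>One half of \<open>\<delta>\<close> pays for the box counts, the other half for the harmonic sum.\<close>

lemma farey_error_bound:
  fixes \<delta> :: real
  assumes "\<delta> > 0"
  obtains C where "C > 0" "\<And>T. T > 0 \<Longrightarrow>
    2 * (\<Sum>q=1..T. hyperbola_error q * (1 / real q)) + 13 * (1 + ln (real T)) \<le> C * real T powr (3 / 4 + \<delta>)"
proof -
  define a where "a = \<delta> / 2"
  have a: "a > 0" using assms by (simp add: a_def)
  obtain C where C: "C \<ge> 0" "\<And>q. q > 0 \<Longrightarrow> hyperbola_error q \<le> C * real q powr (3 / 4 + a)"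
    using hyperbola_error_bound[OF a] by blast
  have "2 * (\<Sum>q=1..T. hyperbola_error q * (1 / real q)) + 13 * (1 + ln (real T)) \<le>
      (2 * C + 13) * (1 + 1 / a) * real T powr (3 / 4 + \<delta>)" if T: "T > 0" for T
  proof -
    let ?E = "real T powr (3 / 4 + a)"
    have l: "1 + ln (real T) \<le> (1 + 1 / a) * real T powr a" using T a by (intro one_plus_ln_le) auto
    have l0: "1 + ln (real T) \<ge> 0" using T by simp
    have E1: "?E \<ge> 1" using T a by (intro ge_one_powr_ge_zero) auto
    have "(\<Sum>q=1..T. hyperbola_error q * (1 / real q)) \<le> (\<Sum>q=1..T. (C * ?E) * (1 / real q))"
    proof (intro sum_mono mult_right_mono)
      fix q assume q: "q \<in> {1..T}"
      have "hyperbola_error q \<le> C * real q powr (3 / 4 + a)" using C(2) q by simp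
      also have "\<dots> \<le> C * ?E" using C(1) q a by (intro mult_left_mono powr_mono2) auto
      finally show "hyperbola_error q \<le> C * ?E" .
    qed simp
    also have "\<dots> \<le> (C * ?E) * (1 + ln (real T))"
      unfolding sum_distrib_left[symmetric] using C(1) by (intro mult_left_mono harm_le_ln T) auto
    finally have "2 * (\<Sum>q=1..T. hyperbola_error q * (1 / real q)) + 13 * (1 + ln (real T)) \<le>
       (2 * C * ?E) * (1 + ln (real T)) + (13 * ?E) * (1 + ln (real T))"
      using mult_right_mono[OF E1 l0] by simp
    also have "\<dots> = (2 * C + 13) * ?E * (1 + ln (real T))" by (simp add: algebra_simps)
    also have "\<dots> \<le> (2 * C + 13) * ?E * ((1 + 1 / a) * real T powr a)"
      using C(1) by (intro mult_left_mono l) auto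
    also have "\<dots> = (2 * C + 13) * (1 + 1 / a) * (?E * real T powr a)" by simp
    also have "?E * real T powr a = real T powr (3 / 4 + \<delta>)"
      by (simp add: a_def add.commute flip: powr_add)
    finally show ?thesis .
  qed
  moreover have "(2 * C + 13) * (1 + 1 / a) > 0" using C(1) a by (intro mult_pos_pos add_nonneg_pos add_pos_pos) auto
  ultimately show thesis using that by blast
qed

section \<open>The limiting distribution\<close>

text \<open>As \<open>ln 0 = 0\<close>, the value at \<open>0\<close> is \<open>0\<close>, which makes the function continuous on \<open>{0..}\<close>.\<close>

definition entropy_fun :: "real \<Rightarrow> real" where
  "entropy_fun u = u * (1 - ln u)"

text \<open>Constant \<open>12/\<pi>\<^sup>2\<close> up to \<open>1/2\<close>, then \<open>12/\<pi>\<^sup>2 \<sqdot> u (1 - ln u)\<close> with \<open>u = 1/y - 1\<close> up to \<open>1\<close>, and \<open>0\<close> from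
  there on. Writing it with \<open>max\<close> instead of a case distinction makes its continuity evident.\<close>

definition hit_density :: "real \<Rightarrow> real" where
  "hit_density y = 12 / pi ^ 2 * entropy_fun (max 0 (1 / max y (1 / 2) - 1))"

text \<open>The limiting distribution function of \<open>\<eta>\<close> times the least \<open>m \<ge> 1\<close> such that \<open>m t\<close> is within \<open>\<eta>\<close> of
  an integer, for uniformly distributed \<open>t\<close>.\<close>

definition hit_cdf :: "real \<Rightarrow> real" where
  "hit_cdf x = integral {0..x} hit_density"

lemma entropy_fun_bounds:
  assumes "0 \<le> u" "u \<le> 1" shows "0 \<le> entropy_fun u" "entropy_fun u \<le> 1"
proof -
  show "0 \<le> entropy_fun u"
  proof (cases "u = 0")
    case False
    then have "ln u \<le> u - 1" using assms by (intro ln_le_minus_one) auto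
    then show ?thesis unfolding entropy_fun_def using assms by (intro mult_nonneg_nonneg) auto
  qed (simp add: entropy_fun_def)
  show "entropy_fun u \<le> 1"
  proof (cases "u = 0")
    case False
    then have u: "u > 0" using assms by simp
    have "ln (1 / u) \<le> 1 / u - 1" using u by (intro ln_le_minus_one) auto
    then have "1 - ln u \<le> 1 / u" using u by (simp add: ln_div)
    then have "u * (1 - ln u) \<le> u * (1 / u)" using u by (intro mult_left_mono) auto
    then show ?thesis using u by (simp add: entropy_fun_def)
  qed (simp add: entropy_fun_def)
qed

lemma continuous_on_entropy_fun: "continuous_on {0..} entropy_fun"
  unfolding continuous_on_def
proof
  fix u :: real assume u: "u \<in> {0..}"
  show "(entropy_fun \<longlongrightarrow> entropy_fun u) (at u within {0..})"
  proof (cases "u = 0")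
    case True
    have "((\<lambda>u::real. u * (1 - ln u)) \<longlongrightarrow> 0) (at_right 0)" by real_asymp
    then have "(entropy_fun \<longlongrightarrow> entropy_fun 0) (at_right 0)" by (simp add: entropy_fun_def[abs_def])
    then show ?thesis using True by (simp add: at_within_Ici_at_right)
  next
    case False
    then have "isCont entropy_fun u"
      unfolding entropy_fun_def[abs_def] by (intro continuous_intros) auto
    then show ?thesis
      using continuous_at_imp_continuous_within[of u entropy_fun "{0..}"] unfolding continuous_within by blast
  qed
qed

lemma continuous_on_hit_density: "continuous_on A hit_density"
proof -
  have "continuous_on UNIV hit_density"
    unfolding hit_density_def[abs_def]
    by (intro continuous_intros continuous_on_compose2[OF continuous_on_entropy_fun]) auto
  then show ?thesis by (rule continuous_on_subset) auto
qed

lemma hit_density_arg: "0 \<le> max 0 (1 / max y (1 / 2) - 1)" "max 0 (1 / max y (1 / 2) - 1) \<le> (1::real)"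
  by (auto simp: max_def field_simps)

lemma twelve_over_pi2: "12 / pi ^ 2 \<le> 2"
proof -
  have "3 * 3 \<le> pi * pi" using pi_gt3 by (intro mult_mono) auto
  then show ?thesis by (simp add: power2_eq_square field_simps)
qed

lemma hit_density_bounds: "0 \<le> hit_density y" "hit_density y \<le> 2"
proof -
  let ?u = "max 0 (1 / max y (1 / 2) - 1)"
  note b = entropy_fun_bounds[OF hit_density_arg[of y]]
  show "0 \<le> hit_density y" unfolding hit_density_def using b by (intro mult_nonneg_nonneg) auto
  have "hit_density y \<le> 2 * 1"
    unfolding hit_density_def using b twelve_over_pi2 by (intro mult_mono) auto
  then show "hit_density y \<le> 2" by simp
qed

lemma hit_density_ge_1: "y \<ge> 1 \<Longrightarrow> hit_density y = 0"
  by (simp add: hit_density_def entropy_fun_def max_def)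

lemma hit_density_le_half: "y \<le> 1 / 2 \<Longrightarrow> hit_density y = 12 / pi ^ 2"
  by (simp add: hit_density_def entropy_fun_def max_def)

text \<open>The left-hand side is the main term of \<open>farey_weight_sum\<close> for \<open>s = 1 / x\<close>.\<close>

lemma hit_density_scaled:
  assumes "x > 0" "T > 0"
  shows "12 / pi ^ 2 * clipped_log T (1 / x - T) = T * hit_density (x * T)"
proof -
  have xT: "x * T > 0" using assms by simp
  consider "x * T \<le> 1 / 2" | "1 / 2 < x * T" "x * T < 1" | "x * T \<ge> 1" by linarith
  then show ?thesis
  proof cases
    case 1
    then have "T \<le> 1 / x - T" using assms by (simp add: field_simps)
    then show ?thesis using 1 by (simp add: hit_density_le_half clipped_log_def)
  next
    case 2
    then have c: "\<not> T \<le> 1 / x - T" "\<not> 1 / x - T \<le> 0" using assms by (simp_all add: field_simps)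
    define u where "u = 1 / (x * T) - 1"
    have u: "u > 0" using 2 xT by (simp add: u_def field_simps)
    have L: "1 / x - T = T * u" using assms by (simp add: u_def field_simps)
    have m: "max 0 (1 / max (x * T) (1 / 2) - 1) = u" using 2 u by (simp add: u_def max_def)
    have "ln (T / (T * u)) = - ln u" using assms u by (simp add: ln_div)
    then show ?thesis using c unfolding clipped_log_def hit_density_def m entropy_fun_def L
      by (simp add: algebra_simps)
  next
    case 3
    then have "\<not> T \<le> 1 / x - T" "1 / x - T \<le> 0" using assms by (simp_all add: field_simps)
    then show ?thesis using 3 by (simp add: hit_density_ge_1 clipped_log_def)
  qed
qed

lemma hit_cdf_0 [simp]: "hit_cdf 0 = 0"
  by (simp add: hit_cdf_def)

lemma hit_cdf_deriv:
  assumes "0 \<le> x" "x \<le> M"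
  shows "(hit_cdf has_real_derivative hit_density x) (at x within {0..M})"
  unfolding hit_cdf_def[abs_def]
  by (rule integral_has_real_derivative[OF continuous_on_hit_density]) (use assms in auto)

lemma hit_cdf_diff:
  assumes "0 \<le> x" "x \<le> y"
  shows "0 \<le> hit_cdf y - hit_cdf x" "hit_cdf y - hit_cdf x \<le> 2 * (y - x)"
proof -
  have i: "hit_density integrable_on {c..d}" for c d
    by (rule integrable_continuous_real[OF continuous_on_hit_density])
  have "integral {0..x} hit_density + integral {x..y} hit_density = integral {0..y} hit_density"
    by (rule Henstock_Kurzweil_Integration.integral_combine) (use assms i in auto)
  then have e: "hit_cdf y - hit_cdf x = integral {x..y} hit_density" by (simp add: hit_cdf_def)
  show "0 \<le> hit_cdf y - hit_cdf x" unfolding e by (rule integral_nonneg[OF i]) (simp add: hit_density_bounds)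
  have "integral {x..y} hit_density \<le> integral {x..y} (\<lambda>_. 2)"
    by (rule integral_le[OF i]) (auto simp: hit_density_bounds)
  then show "hit_cdf y - hit_cdf x \<le> 2 * (y - x)" unfolding e using assms by simp
qed

lemma hit_cdf_scaled:
  assumes "\<eta> \<ge> 0" "T > 0"
  shows "((\<lambda>x. T * hit_density (x * T)) has_integral hit_cdf (\<eta> * T)) {0..\<eta>}"
proof -
  have "((\<lambda>x. T * hit_density (x * T)) has_integral (hit_cdf (\<eta> * T) - hit_cdf (0 * T))) {0..\<eta>}"
  proof (rule fundamental_theorem_of_calculus[OF assms(1)])
    fix x assume x: "x \<in> {0..\<eta>}"
    have "(hit_cdf has_real_derivative hit_density (x * T)) (at (x * T) within {0..\<eta> * T})"
      using x assms by (intro hit_cdf_deriv) (auto intro: mult_right_mono)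
    then have "(hit_cdf has_real_derivative hit_density (x * T)) (at (x * T) within (\<lambda>x. x * T) ` {0..\<eta>})"
      by (rule has_field_derivative_subset) (use assms in \<open>auto intro: mult_right_mono\<close>)
    moreover have "((\<lambda>x. x * T) has_real_derivative T) (at x within {0..\<eta>})"
      by (auto intro!: derivative_eq_intros)
    ultimately have "(hit_cdf \<circ> (\<lambda>x. x * T) has_real_derivative hit_density (x * T) * T) (at x within {0..\<eta>})"
      by (rule DERIV_image_chain)
    then show "((\<lambda>x. hit_cdf (x * T)) has_vector_derivative T * hit_density (x * T)) (at x within {0..\<eta>})"
      by (simp add: has_real_derivative_iff_has_vector_derivative o_def mult.commute)
  qed
  then show ?thesis by simp
qed

lemma indicator_ramp_integral:
  fixes d w \<eta> :: real
  assumes "d > 0" "\<eta> \<ge> 0"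
  shows "((\<lambda>x. if x * d \<le> 1 then w else 0) has_integral w * min \<eta> (1 / d)) {0..\<eta>}"
proof -
  let ?m = "min \<eta> (1 / d)"
  have m: "0 \<le> ?m" using assms by simp
  have "((\<lambda>x. w) has_integral (measure lborel {0..?m} *\<^sub>R w)) {0..?m}" by (rule has_integral_const_real)
  moreover have "measure lborel {0..?m} *\<^sub>R w = w * ?m" using m by simp
  ultimately have "((\<lambda>x. w) has_integral w * ?m) {0..?m}" by (simp only:)
  moreover have "{0..?m} \<subseteq> {0..\<eta>}" by auto
  ultimately have "((\<lambda>x. if x \<in> {0..?m} then w else 0) has_integral w * ?m) {0..\<eta>}"
    by (simp only: has_integral_restrict)
  moreover have "(if x \<in> {0..?m} then w else 0) = (if x * d \<le> 1 then w else 0)" if "x \<in> {0..\<eta>}" for x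
    using that assms by (auto simp: field_simps)
  ultimately show ?thesis by (rule has_integral_eq[rotated]) auto
qed

text \<open>Since \<open>min \<eta> (1 / d)\<close> is the integral over \<open>0 \<le> x \<le> \<eta>\<close> of the indicator of \<open>x d \<le> 1\<close>, the
  covered length is the integral over \<open>x\<close> of the weighted cell counts with \<open>q + q' \<le> 1 / x\<close>. The error
  of these counts is uniform in \<open>x\<close>, so it only picks up the factor \<open>\<eta>\<close>.\<close>

theorem near_equidistributed:
  fixes \<delta> :: real
  assumes "\<delta> > 0"
  obtains C where "C > 0"
    "\<And>T \<eta> b. 0 \<le> \<eta> \<Longrightarrow> 0 \<le> b \<Longrightarrow> b \<le> 1 \<Longrightarrow>
      \<bar>measure lborel (near T \<eta> \<inter> {0..<b}) - b * hit_cdf (\<eta> * real T)\<bar> \<le> C * \<eta> * real T powr (3 / 4 + \<delta>)"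
proof -
  obtain C where C: "C > 0" "\<And>T. T > 0 \<Longrightarrow>
    2 * (\<Sum>q=1..T. hyperbola_error q * (1 / real q)) + 13 * (1 + ln (real T)) \<le> C * real T powr (3 / 4 + \<delta>)"
    using farey_error_bound[OF assms] by blast
  have "\<bar>measure lborel (near T \<eta> \<inter> {0..<b}) - b * hit_cdf (\<eta> * real T)\<bar> \<le> (C + 2) * \<eta> * real T powr (3 / 4 + \<delta>)"
    if \<eta>: "0 \<le> \<eta>" and b: "0 \<le> b" "b \<le> 1" for T \<eta> b
  proof (cases "T = 0")
    case True
    then have "near T \<eta> = {}" by (auto simp: near_def)
    then show ?thesis using True by simp
  next
    case False
    then have T: "T > 0" by simp
    let ?F = "{p \<in> farey T. left_end p < b}"
    let ?E = "C * real T powr (3 / 4 + \<delta>)"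
    let ?S = "\<Sum>p\<in>?F. cell_weight p * min \<eta> (1 / denom_sum p)"
    let ?f = "\<lambda>x. (\<Sum>p\<in>?F. if x * denom_sum p \<le> 1 then cell_weight p else 0) - b * (real T * hit_density (x * real T))"
    have "(?f has_integral (?S - b * hit_cdf (\<eta> * real T))) {0..\<eta>}"
    proof (intro has_integral_diff has_integral_sum has_integral_mult_right hit_cdf_scaled indicator_ramp_integral \<eta>)
      fix p assume "p \<in> ?F"
      then show "0 < denom_sum p" using cell_weight_bounds(3)[of p T] by simp
    qed (use T in auto)
    moreover have "norm (?f x) \<le> ?E" if x: "x \<in> {0..\<eta>}" for x
    proof -
      \<comment> \<open>at \<open>x = 0\<close>, where \<open>1 / x = 0\<close>, any bound that admits all cells will do\<close>
      define s where "s = (if x = 0 then 2 * real T else 1 / x)"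
      have "denom_sum p \<le> s \<longleftrightarrow> x * denom_sum p \<le> 1" if "p \<in> farey T" for p
      proof -
        obtain a q a' q' where pe: "p = (a, q, a', q')" by (metis prod_cases4)
        note D = fareyD[OF \<open>p \<in> farey T\<close>[unfolded pe]]
        have "denom_sum p \<le> 2 * real T" using D by (simp add: pe denom_sum_def)
        then show ?thesis using x by (auto simp: s_def field_simps)
      qed
      then have "{p \<in> farey T. left_end p < b \<and> denom_sum p \<le> s} = {p \<in> ?F. x * denom_sum p \<le> 1}" by auto
      then have A: "(\<Sum>p\<in>?F. if x * denom_sum p \<le> 1 then cell_weight p else 0) =
          (\<Sum>p\<in>{p \<in> farey T. left_end p < b \<and> denom_sum p \<le> s}. cell_weight p)"
        using sum.inter_filter[of ?F cell_weight "\<lambda>p. x * denom_sum p \<le> 1"] by simp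
      have B: "12 / pi ^ 2 * clipped_log (real T) (s - real T) = real T * hit_density (x * real T)"
      proof (cases "x = 0")
        case True
        then show ?thesis using T by (simp add: s_def clipped_log_def hit_density_le_half)
      next
        case False
        then show ?thesis using x T hit_density_scaled[of x "real T"] by (simp add: s_def)
      qed
      show ?thesis unfolding A B[symmetric] real_norm_def
        by (rule order_trans[OF farey_weight_sum[OF T b] C(2)[OF T]])
    qed
    ultimately have "norm (?S - b * hit_cdf (\<eta> * real T)) \<le> ?E * measure lborel {0..\<eta>}"
      using C(1) by (intro has_integral_bound_real) auto
    then have 1: "\<bar>?S - b * hit_cdf (\<eta> * real T)\<bar> \<le> ?E * \<eta>" using \<eta> by simp
    have "1 \<le> real T powr (3 / 4 + \<delta>)" using T assms by (intro ge_one_powr_ge_zero) auto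
    then have "2 * \<eta> \<le> 2 * \<eta> * real T powr (3 / 4 + \<delta>)" using \<eta> mult_left_mono[of 1 "real T powr (3 / 4 + \<delta>)" "2 * \<eta>"] by simp
    then show ?thesis using 1 measure_near_sum_cells[OF T \<eta> b] by (simp add: algebra_simps)
  qed
  then show thesis using that[of "C + 2"] C(1) by simp
qed

text \<open>Dirichlet's approximation theorem: in a cell, \<open>q (a' - q' t) + q' (q t - a) = 1\<close>, so the two
  deviations cannot both exceed \<open>1 / (q + q')\<close>.\<close>

lemma near_full:
  assumes "T > 0" "1 \<le> \<eta> * real T" "0 \<le> t" "t < 1"
  shows "t \<in> near T \<eta>"
proof -
  obtain p where p: "p \<in> farey T" "t \<in> cell p" using farey_cover[OF assms(1,3,4)] by blast
  obtain a q a' q' where pe: "p = (a, q, a', q')" by (metis prod_cases4)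
  note P = p[unfolded pe] note D = fareyD[OF P(1)]
  have \<eta>: "\<eta> > 0" using assms(1,2) by (metis less_numeral_extra(1) order_less_le_trans of_nat_0_less_iff zero_less_mult_pos2)
  have "real q * t - real a \<le> \<eta> \<or> real a' - real q' * t \<le> \<eta>"
  proof (rule ccontr)
    assume "\<not> (real q * t - real a \<le> \<eta> \<or> real a' - real q' * t \<le> \<eta>)"
    then have x: "real q * t - real a > \<eta>" "real a' - real q' * t > \<eta>" by auto
    have "real q * \<eta> < real q * (real a' - real q' * t)" "real q' * \<eta> < real q' * (real q * t - real a)"
      using x D by (auto intro!: mult_strict_left_mono)
    then have "\<eta> * (real q + real q') < real a' * real q - real a * real q'" by (simp add: algebra_simps)
    then have "\<eta> * (real q + real q') < 1" using farey_det[OF P(1)] by simp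
    moreover have "\<eta> * real T \<le> \<eta> * (real q + real q')" using D(5) \<eta> by (intro mult_left_mono) auto
    ultimately show False using assms(2) by simp
  qed
  then show ?thesis unfolding near_in_cell_iff[OF P order_less_imp_le[OF \<eta>]] .
qed

text \<open>Evaluating the integral of \<open>hit_density\<close> amounts to a special value of the dilogarithm. It can be
  had without computation: for \<open>\<eta> = 1/T\<close> every slope is covered, so \<open>near_equidistributed\<close> forces
  \<open>hit_cdf 1 = 1\<close> as \<open>T\<close> tends to infinity.\<close>

lemma hit_cdf_1: "hit_cdf 1 = 1"
proof -
  obtain C where C: "C > 0" "\<And>T \<eta> b. 0 \<le> \<eta> \<Longrightarrow> 0 \<le> b \<Longrightarrow> b \<le> 1 \<Longrightarrow>
      \<bar>measure lborel (near T \<eta> \<inter> {0..<b}) - b * hit_cdf (\<eta> * real T)\<bar> \<le> C * \<eta> * real T powr (3 / 4 + 1 / 8)"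
    using near_equidistributed[of "1 / 8"] by auto
  have "\<bar>1 - hit_cdf 1\<bar> \<le> C * real (Suc n) powr (- 1 / 8)" for n
  proof -
    have "near (Suc n) (1 / real (Suc n)) \<inter> {0..<1} = {0..<1}"
      using near_full[of "Suc n" "1 / real (Suc n)"] by auto
    then have m: "measure lborel (near (Suc n) (1 / real (Suc n)) \<inter> {0..<1}) = 1" by simp
    have e: "C * (1 / x) * x powr (3 / 4 + 1 / 8) = C * x powr (- 1 / 8)" if "x > 0" for x :: real
    proof -
      have "1 / x = x powr (- 1)" using that by (simp add: powr_minus_divide)
      then have "C * (1 / x) * x powr (3 / 4 + 1 / 8) = C * (x powr (- 1) * x powr (3 / 4 + 1 / 8))"
        by (simp only: mult.assoc)
      also have "\<dots> = C * x powr (- 1 + (3 / 4 + 1 / 8))" by (simp only: powr_add)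
      finally show ?thesis by simp
    qed
    have "0 \<le> 1 / real (Suc n)" "real (Suc n) > 0" "1 / real (Suc n) * real (Suc n) = 1" by simp_all
    then show ?thesis using C(2)[of "1 / real (Suc n)" 1 "Suc n"] m e[of "real (Suc n)"] by (simp only: mult_1)
  qed
  moreover have "(\<lambda>n. C * real (Suc n) powr (- 1 / 8)) \<longlonglongrightarrow> 0" by real_asymp
  ultimately have "\<bar>1 - hit_cdf 1\<bar> \<le> 0" by (intro LIMSEQ_le_const[OF _ exI[of _ 0]]) auto
  then show ?thesis by simp
qed

lemma hit_cdf_ge_1: "x \<ge> 1 \<Longrightarrow> hit_cdf x = 1"
proof -
  assume x: "x \<ge> 1"
  have i: "hit_density integrable_on {c..d}" for c d
    by (rule integrable_continuous_real[OF continuous_on_hit_density])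
  have "integral {0..1} hit_density + integral {1..x} hit_density = integral {0..x} hit_density"
    by (rule Henstock_Kurzweil_Integration.integral_combine) (use x i in auto)
  moreover have "integral {1..x} hit_density = integral {1..x} (\<lambda>_. 0)"
    by (rule integral_cong) (simp add: hit_density_ge_1)
  ultimately show ?thesis using hit_cdf_1 by (simp add: hit_cdf_def)
qed

section \<open>The billiard trajectory\<close>

lemma card_grid_crossings:
  fixes c E :: real
  assumes "c > 0"
  shows "card {\<tau> \<in> {0<..<E}. \<tau> * c \<in> \<int>} = nat (\<lceil>E * c\<rceil> - 1)"
proof -
  have "bij_betw (\<lambda>k. real_of_int k / c) {1..\<lceil>E * c\<rceil> - 1} {\<tau> \<in> {0<..<E}. \<tau> * c \<in> \<int>}"
  proof (rule bij_betwI[where g = "\<lambda>\<tau>. \<lfloor>\<tau> * c\<rfloor>"])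
    show "(\<lambda>k. real_of_int k / c) \<in> {1..\<lceil>E * c\<rceil> - 1} \<rightarrow> {\<tau> \<in> {0<..<E}. \<tau> * c \<in> \<int>}"
    proof
      fix k assume "k \<in> {1..\<lceil>E * c\<rceil> - 1}"
      then have "0 < k" "k < \<lceil>E * c\<rceil>" by auto
      then have "real_of_int k < E * c" by (simp add: less_ceiling_iff)
      then show "real_of_int k / c \<in> {\<tau> \<in> {0<..<E}. \<tau> * c \<in> \<int>}"
        using assms \<open>0 < k\<close> by (simp add: field_simps)
    qed
    show "(\<lambda>\<tau>. \<lfloor>\<tau> * c\<rfloor>) \<in> {\<tau> \<in> {0<..<E}. \<tau> * c \<in> \<int>} \<rightarrow> {1..\<lceil>E * c\<rceil> - 1}"
    proof
      fix \<tau> assume t: "\<tau> \<in> {\<tau> \<in> {0<..<E}. \<tau> * c \<in> \<int>}"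
      then obtain k where k: "\<tau> * c = real_of_int k" by (auto elim: Ints_cases)
      have "0 < \<tau> * c" "\<tau> * c < E * c" using t assms by auto
      then have "0 < k" "k < \<lceil>E * c\<rceil>" unfolding k by (auto simp: less_ceiling_iff)
      then show "\<lfloor>\<tau> * c\<rfloor> \<in> {1..\<lceil>E * c\<rceil> - 1}" unfolding k by simp
    qed
    show "\<lfloor>real_of_int k / c * c\<rfloor> = k" for k using assms by simp
    show "real_of_int \<lfloor>\<tau> * c\<rfloor> / c = \<tau>" if "\<tau> \<in> {\<tau> \<in> {0<..<E}. \<tau> * c \<in> \<int>}" for \<tau>
      using that assms by (auto elim!: Ints_cases simp: field_simps)
  qed
  then have "card {\<tau> \<in> {0<..<E}. \<tau> * c \<in> \<int>} = card {1..\<lceil>E * c\<rceil> - 1}"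
    by (rule bij_betw_same_card[symmetric])
  then show ?thesis by simp
qed

lemma reflections_eq:
  assumes "cos \<omega> > 0" "sin \<omega> > 0"
  shows "reflections \<epsilon> \<omega> = nat (\<lceil>exit_time \<epsilon> \<omega> * cos \<omega>\<rceil> - 1) + nat (\<lceil>exit_time \<epsilon> \<omega> * sin \<omega>\<rceil> - 1)"
  unfolding reflections_def by (simp only: card_grid_crossings assms)

text \<open>The set of hitting times in the definition of \<open>exit_time\<close>, with the Minkowski sum resolved.\<close>

definition exit_set :: "real \<Rightarrow> real \<Rightarrow> real set" where
  "exit_set \<epsilon> \<omega> = {\<tau>. \<tau> > 0 \<and> (\<exists>m n :: int. (m, n) \<noteq> (0, 0) \<and>
     (\<tau> * cos \<omega> - real_of_int m)\<^sup>2 + (\<tau> * sin \<omega> - real_of_int n)\<^sup>2 = \<epsilon>\<^sup>2)}"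

lemma exit_time_eq: "exit_time \<epsilon> \<omega> = Inf (exit_set \<epsilon> \<omega>)"
proof -
  have "(x, y) \<in> pocket_circle \<epsilon> + (\<int> \<times> \<int> - {(0, 0)}) \<longleftrightarrow>
      (\<exists>m n :: int. (m, n) \<noteq> (0, 0) \<and> (x - real_of_int m)\<^sup>2 + (y - real_of_int n)\<^sup>2 = \<epsilon>\<^sup>2)" for x y
  proof
    assume "(x, y) \<in> pocket_circle \<epsilon> + (\<int> \<times> \<int> - {(0, 0)})"
    then obtain p r where pr: "(x, y) = p + r" "p \<in> pocket_circle \<epsilon>" "r \<in> \<int> \<times> \<int> - {(0, 0)}"
      by (rule set_plus_elim)
    obtain u v where p: "p = (u, v)" by fastforce
    obtain k l where r: "r = (k, l)" by fastforce
    have *: "(u, v) \<in> pocket_circle \<epsilon>" "k \<in> \<int>" "l \<in> \<int>" "(k, l) \<noteq> (0, 0)" "x = u + k" "y = v + l"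
      using pr unfolding p r by auto
    then obtain m n where "k = real_of_int m" "l = real_of_int n" by (auto elim!: Ints_cases)
    then show "\<exists>m n :: int. (m, n) \<noteq> (0, 0) \<and> (x - real_of_int m)\<^sup>2 + (y - real_of_int n)\<^sup>2 = \<epsilon>\<^sup>2"
      using * by (intro exI[of _ m] exI[of _ n]) (auto simp: pocket_circle_def)
  next
    assume "\<exists>m n :: int. (m, n) \<noteq> (0, 0) \<and> (x - real_of_int m)\<^sup>2 + (y - real_of_int n)\<^sup>2 = \<epsilon>\<^sup>2"
    then obtain m n :: int where *: "(m, n) \<noteq> (0, 0)" "(x - real_of_int m)\<^sup>2 + (y - real_of_int n)\<^sup>2 = \<epsilon>\<^sup>2"
      by blast
    have "(x, y) = (x - real_of_int m, y - real_of_int n) + (real_of_int m, real_of_int n)" by simp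
    moreover have "(x - real_of_int m, y - real_of_int n) \<in> pocket_circle \<epsilon>" using * by (simp add: pocket_circle_def)
    moreover have "(real_of_int m, real_of_int n) \<in> \<int> \<times> \<int> - {(0, 0)}" using * by auto
    ultimately show "(x, y) \<in> pocket_circle \<epsilon> + (\<int> \<times> \<int> - {(0, 0)})"
      by (metis set_plus_intro)
  qed
  then show ?thesis unfolding exit_time_def exit_set_def by simp
qed

lemma exit_set_bdd_below: "bdd_below (exit_set \<epsilon> \<omega>)"
  by (rule bdd_belowI[of _ 0]) (auto simp: exit_set_def)

lemma exit_time_nonneg: "exit_set \<epsilon> \<omega> \<noteq> {} \<Longrightarrow> exit_time \<epsilon> \<omega> \<ge> 0"
  unfolding exit_time_eq by (rule cInf_greatest) (auto simp: exit_set_def)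

lemma octant_closed_facts:
  assumes "0 \<le> \<omega>" "\<omega> \<le> pi / 4"
  shows "7 / 10 \<le> cos \<omega>" "cos \<omega> \<le> 1" "0 \<le> tan \<omega>" "tan \<omega> \<le> 1" "sin \<omega> + cos \<omega> = cos \<omega> * (1 + tan \<omega>)"
    "1 \<le> sin \<omega> + cos \<omega>" "sin \<omega> + cos \<omega> \<le> 2"
proof -
  have "cos (pi / 4) \<le> cos \<omega>" using assms by (intro cos_monotone_0_pi_le) auto
  moreover have "sqrt 2 / 2 \<ge> (7 / 10 :: real)"
    using real_le_rsqrt[of "14/10" 2] by (simp add: power2_eq_square)
  ultimately show c: "7 / 10 \<le> cos \<omega>" by (simp add: cos_45)
  show c1: "cos \<omega> \<le> 1" by simp
  have s0: "0 \<le> sin \<omega>" using assms by (intro sin_ge_zero) auto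
  then show "0 \<le> tan \<omega>" using c by (simp add: tan_def)
  show "tan \<omega> \<le> 1"
  proof (cases "\<omega> = pi / 4")
    case True
    then show ?thesis using tan_45 by (simp only:)
  next
    case False
    then show ?thesis using tan_monotone[of \<omega> "pi / 4"] assms by (simp add: tan_45)
  qed
  show "sin \<omega> + cos \<omega> = cos \<omega> * (1 + tan \<omega>)" using c by (simp add: tan_def distrib_left)
  have "(sin \<omega> + cos \<omega>)\<^sup>2 = 1 + 2 * (sin \<omega> * cos \<omega>)" by (simp add: power2_sum)
  moreover have "0 \<le> sin \<omega> * cos \<omega>" using s0 c by simp
  ultimately have "1\<^sup>2 \<le> (sin \<omega> + cos \<omega>)\<^sup>2" by simp
  then show "1 \<le> sin \<omega> + cos \<omega>" using s0 c by (intro power2_le_imp_le[of 1]) auto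
  show "sin \<omega> + cos \<omega> \<le> 2" using sin_le_one[of \<omega>] cos_le_one[of \<omega>] by linarith
qed

lemma octant_facts:
  assumes "0 < \<omega>" "\<omega> < pi / 4"
  shows "7 / 10 \<le> cos \<omega>" "0 < sin \<omega>" "sin \<omega> \<le> 1" "cos \<omega> \<le> 1" "(cos \<omega>)\<^sup>2 + (sin \<omega>)\<^sup>2 = 1" "0 < tan \<omega>" "tan \<omega> < 1"
    "sin \<omega> = tan \<omega> * cos \<omega>"
proof -
  show c: "7 / 10 \<le> cos \<omega>" using octant_closed_facts(1)[of \<omega>] assms by simp
  show "0 < sin \<omega>" using assms by (intro sin_gt_zero) auto
  show "sin \<omega> \<le> 1" "cos \<omega> \<le> 1" "(cos \<omega>)\<^sup>2 + (sin \<omega>)\<^sup>2 = 1" by simp_all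
  show "0 < tan \<omega>" using assms by (intro tan_gt_zero) auto
  show "tan \<omega> < 1" using tan_monotone[of \<omega> "pi / 4"] assms by (simp add: tan_45)
  show "sin \<omega> = tan \<omega> * cos \<omega>" using c by (simp add: tan_def)
qed

text \<open>With \<open>D\<close> the projection of \<open>(q, a)\<close> onto the ray and \<open>X\<close> its signed distance from the ray, the ray
  enters the circle about \<open>(q, a)\<close> at time \<open>D - e\<close>, where \<open>e = sqrt (\<epsilon>\<^sup>2 - X\<^sup>2)\<close>. Hence it has exited by
  the time it comes near \<open>(q, a)\<close>, after crossing at most \<open>q + a\<close> grid lines up to \<open>O(\<epsilon>)\<close>.\<close>

lemma hit_gives_exit:
  assumes \<omega>: "0 < \<omega>" "\<omega> < pi / 4" and \<epsilon>: "0 < \<epsilon>" "\<epsilon> \<le> 1 / 8"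
    and q: "1 \<le> q" and hit: "\<bar>real q * sin \<omega> - real_of_int a * cos \<omega>\<bar> \<le> \<epsilon>"
  shows "exit_set \<epsilon> \<omega> \<noteq> {}" "real (reflections \<epsilon> \<omega>) \<le> real q * (1 + tan \<omega>) + 1"
proof -
  note F = octant_facts[OF \<omega>]
  define c s where "c = cos \<omega>" and "s = sin \<omega>"
  define X D e where "X = real q * s - real_of_int a * c" and "D = real q * c + real_of_int a * s" and "e = sqrt (\<epsilon>\<^sup>2 - X\<^sup>2)"
  have cs: "7 / 10 \<le> c" "0 < s" "s \<le> 1" "c \<le> 1" "c\<^sup>2 + s\<^sup>2 = 1" using F by (simp_all add: c_def s_def)
  have X: "\<bar>X\<bar> \<le> \<epsilon>" using hit by (simp add: X_def c_def s_def)
  have X2: "X\<^sup>2 \<le> \<epsilon>\<^sup>2" using X \<epsilon> by (simp add: abs_le_square_iff[symmetric])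
  have e2: "e\<^sup>2 = \<epsilon>\<^sup>2 - X\<^sup>2" using X2 by (simp add: e_def)
  have e: "0 \<le> e" "e \<le> \<epsilon>"
  proof -
    show "0 \<le> e" using X2 by (simp add: e_def)
    have "e \<le> sqrt (\<epsilon>\<^sup>2)" unfolding e_def by (intro real_sqrt_le_mono) simp
    then show "e \<le> \<epsilon>" using \<epsilon> by simp
  qed
  have a: "a \<ge> 0"
  proof (rule ccontr)
    assume "\<not> a \<ge> 0"
    then have "real_of_int a \<le> - 1" by linarith
    then have "real_of_int a * c \<le> - 1 * c" using cs by (intro mult_right_mono) auto
    moreover have "0 \<le> real q * s" using cs by simp
    ultimately show False using X[unfolded X_def] \<epsilon> cs by linarith
  qed
  have Dc: "D * c = real q - s * X"
  proof -
    have "real q - s * X = real q * (c\<^sup>2 + s\<^sup>2) - s * X" using cs by simp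
    also have "\<dots> = D * c" by (simp add: D_def X_def algebra_simps power2_eq_square)
    finally show ?thesis ..
  qed
  have Ds: "D * s = real_of_int a + c * X"
  proof -
    have "real_of_int a + c * X = real_of_int a * (c\<^sup>2 + s\<^sup>2) + c * X" using cs by simp
    also have "\<dots> = D * s" by (simp add: D_def X_def algebra_simps power2_eq_square)
    finally show ?thesis ..
  qed
  have "1 * c \<le> real q * c" using q cs by (intro mult_right_mono) auto
  moreover have "0 \<le> real_of_int a * s" using a cs by simp
  ultimately have pos: "D - e > 0" unfolding D_def using e \<epsilon> cs by linarith
  have "((D - e) * c - real q)\<^sup>2 + ((D - e) * s - real_of_int a)\<^sup>2 = (s * X + e * c)\<^sup>2 + (c * X - e * s)\<^sup>2"
  proof -
    have "(D - e) * c - real q = - (s * X + e * c)" "(D - e) * s - real_of_int a = c * X - e * s"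
      using Dc Ds by (simp_all add: left_diff_distrib)
    then show ?thesis by (simp only: power2_minus)
  qed
  also have "\<dots> = (c\<^sup>2 + s\<^sup>2) * (X\<^sup>2 + e\<^sup>2)" by (simp add: power2_eq_square algebra_simps)
  also have "\<dots> = \<epsilon>\<^sup>2" using cs e2 by simp
  finally have sq: "((D - e) * c - real q)\<^sup>2 + ((D - e) * s - real_of_int a)\<^sup>2 = \<epsilon>\<^sup>2" .
  have "\<exists>m n :: int. (m, n) \<noteq> (0, 0) \<and>
      ((D - e) * cos \<omega> - real_of_int m)\<^sup>2 + ((D - e) * sin \<omega> - real_of_int n)\<^sup>2 = \<epsilon>\<^sup>2"
    by (rule exI[of _ "int q"], rule exI[of _ a]) (use q sq in \<open>simp add: c_def s_def\<close>)
  then have mem: "D - e \<in> exit_set \<epsilon> \<omega>" unfolding exit_set_def using pos by simp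
  then show ne: "exit_set \<epsilon> \<omega> \<noteq> {}" by blast
  define E where "E = exit_time \<epsilon> \<omega>"
  have E0: "E \<ge> 0" using exit_time_nonneg[OF ne] by (simp add: E_def)
  have "E \<le> D - e" unfolding E_def exit_time_eq by (rule cInf_lower[OF mem exit_set_bdd_below])
  then have ED: "E \<le> D" using e by simp
  have "E * c \<le> D * c" "E * s \<le> D * s" using ED cs by (auto intro: mult_right_mono)
  moreover have "\<bar>s * X\<bar> \<le> 1 * \<epsilon>" "\<bar>c * X\<bar> \<le> 1 * \<epsilon>" 
    using cs X \<epsilon> mult_mono[of s 1 "\<bar>X\<bar>" \<epsilon>] mult_mono[of c 1 "\<bar>X\<bar>" \<epsilon>] by (simp_all add: abs_mult)
  ultimately have b: "E * c \<le> real q + \<epsilon>" "E * s \<le> real_of_int a + \<epsilon>" using Dc Ds by linarith+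
  have r: "real (nat (\<lceil>x\<rceil> - 1)) \<le> x" if "x \<ge> 0" for x :: real using that by linarith
  have "real (reflections \<epsilon> \<omega>) \<le> E * c + E * s"
    using reflections_eq[of \<omega> \<epsilon>] F r[of "E * c"] r[of "E * s"] E0 cs by (simp add: E_def c_def s_def)
  also have "\<dots> \<le> real q + real_of_int a + 2 * \<epsilon>" using b by simp
  also have "real_of_int a \<le> real q * tan \<omega> + 2 * \<epsilon>"
  proof -
    have "real_of_int a * c \<le> real q * s + \<epsilon>" using X by (simp add: X_def)
    also have "\<dots> \<le> real q * (tan \<omega> * c) + 2 * \<epsilon> * c" using F(8) cs \<epsilon> mult_left_mono[of "7/10" c \<epsilon>] by (simp add: c_def s_def)
    also have "\<dots> = (real q * tan \<omega> + 2 * \<epsilon>) * c" by (simp add: algebra_simps)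
    finally show ?thesis using cs by simp
  qed
  finally show "real (reflections \<epsilon> \<omega>) \<le> real q * (1 + tan \<omega>) + 1" using \<epsilon> by (simp add: distrib_left)
qed

text \<open>The exit time is approximated by a hitting time to within \<open>1/8\<close>; the summand \<open>3\<close> absorbs this, the
  rounding in the two counts of grid lines, and the \<open>O(\<epsilon>)\<close> between the hitting point and the centre
  \<open>(m, n)\<close> of its circle.\<close>

lemma exit_gives_hit:
  assumes \<omega>: "0 < \<omega>" "\<omega> < pi / 4" and \<epsilon>: "0 < \<epsilon>" "\<epsilon> \<le> 1 / 8" and ne: "exit_set \<epsilon> \<omega> \<noteq> {}"
  obtains m :: nat and n :: int where "1 \<le> m" "\<bar>real m * sin \<omega> - real_of_int n * cos \<omega>\<bar> \<le> \<epsilon>"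
    "real m * (1 + tan \<omega>) \<le> real (reflections \<epsilon> \<omega>) + 3"
proof -
  note F = octant_facts[OF \<omega>]
  define c s where "c = cos \<omega>" and "s = sin \<omega>"
  have cs: "7 / 10 \<le> c" "0 < s" "s \<le> 1" "c \<le> 1" "c\<^sup>2 + s\<^sup>2 = 1" using F by (simp_all add: c_def s_def)
  define E where "E = exit_time \<epsilon> \<omega>"
  have E0: "E \<ge> 0" using exit_time_nonneg[OF ne] by (simp add: E_def)
  obtain \<tau> where \<tau>: "\<tau> \<in> exit_set \<epsilon> \<omega>" "\<tau> < E + 1 / 8"
    using cInf_lessD[OF ne, of "E + 1 / 8"] by (auto simp: E_def exit_time_eq)
  then obtain m n :: int where mn: "(m, n) \<noteq> (0, 0)" "(\<tau> * c - real_of_int m)\<^sup>2 + (\<tau> * s - real_of_int n)\<^sup>2 = \<epsilon>\<^sup>2" and \<tau>0: "\<tau> > 0"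
    by (auto simp: exit_set_def c_def s_def)
  define U V where "U = \<tau> * c - real_of_int m" and "V = \<tau> * s - real_of_int n"
  have UV: "U\<^sup>2 + V\<^sup>2 = \<epsilon>\<^sup>2" using mn by (simp add: U_def V_def)
  have "U\<^sup>2 \<le> \<epsilon>\<^sup>2" "V\<^sup>2 \<le> \<epsilon>\<^sup>2" using UV zero_le_power2[of U] zero_le_power2[of V] by linarith+
  then have U: "\<bar>U\<bar> \<le> \<epsilon>" and V: "\<bar>V\<bar> \<le> \<epsilon>" using \<epsilon> by (simp_all add: abs_le_square_iff[symmetric])
  have X: "real_of_int m * s - real_of_int n * c = V * c - U * s" by (simp add: U_def V_def algebra_simps)
  have "(V * c - U * s)\<^sup>2 + (V * s + U * c)\<^sup>2 = (c\<^sup>2 + s\<^sup>2) * (U\<^sup>2 + V\<^sup>2)" by (simp add: power2_eq_square algebra_simps)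
  then have "(V * c - U * s)\<^sup>2 + (V * s + U * c)\<^sup>2 = \<epsilon>\<^sup>2" using cs UV by simp
  then have "(V * c - U * s)\<^sup>2 \<le> \<epsilon>\<^sup>2" using zero_le_power2[of "V * s + U * c"] by linarith
  then have Xle: "\<bar>real_of_int m * s - real_of_int n * c\<bar> \<le> \<epsilon>" unfolding X using \<epsilon> by (simp add: abs_le_square_iff[symmetric])
  have tc: "\<tau> * c > 0" "\<tau> * s > 0" using \<tau>0 cs by auto
  have m0: "m \<ge> 0" "n \<ge> 0" using tc U V \<epsilon> by (simp_all add: U_def V_def)
  have "m \<noteq> 0"
  proof
    assume "m = 0"
    then have "n \<ge> 1" using mn m0 by auto
    then have "1 * c \<le> real_of_int n * c" using cs by (intro mult_right_mono) auto
    moreover have "real_of_int n * c \<le> \<epsilon>" using Xle \<open>m = 0\<close> by simp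
    ultimately show False using cs \<epsilon> by linarith
  qed
  then have m1: "m \<ge> 1" using m0 by simp
  have r: "x - 1 \<le> real (nat (\<lceil>x\<rceil> - 1))" for x :: real by linarith
  have R: "E * c + E * s - 2 \<le> real (reflections \<epsilon> \<omega>)"
    using reflections_eq[of \<omega> \<epsilon>] F r[of "E * c"] r[of "E * s"] by (simp add: E_def c_def s_def)
  have "(\<tau> - 1 / 8) * c \<le> E * c" "(\<tau> - 1 / 8) * s \<le> E * s" using \<tau>(2) cs by (auto intro: mult_right_mono)
  then have "\<tau> * c - 1 / 8 \<le> E * c" "\<tau> * s - 1 / 8 \<le> E * s" using cs by (simp_all add: left_diff_distrib)
  then have mn': "real_of_int m + real_of_int n \<le> real (reflections \<epsilon> \<omega>) + 2 + 1 / 4 + 2 * \<epsilon>"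
    using R U V by (simp add: U_def V_def)
  have "real_of_int m * (tan \<omega> * c) \<le> real_of_int n * c + \<epsilon>" using Xle F(8) by (simp add: c_def s_def)
  also have "\<dots> \<le> real_of_int n * c + 2 * \<epsilon> * c" using cs \<epsilon> mult_left_mono[of "7/10" c \<epsilon>] by simp
  finally have "(real_of_int m * tan \<omega>) * c \<le> (real_of_int n + 2 * \<epsilon>) * c" by (simp add: algebra_simps)
  then have "real_of_int m * tan \<omega> \<le> real_of_int n + 2 * \<epsilon>" using cs by simp
  then have fin: "real_of_int m * (1 + tan \<omega>) \<le> real (reflections \<epsilon> \<omega>) + 3" using mn' \<epsilon> by (simp add: distrib_left)
  show thesis
    by (rule that[of "nat m" n]) (use m1 Xle fin in \<open>simp_all add: c_def s_def of_nat_nat\<close>)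
qed

lemma tan_near_iff:
  assumes "cos \<omega> > 0"
  shows "\<bar>real m * sin \<omega> - real_of_int n * cos \<omega>\<bar> \<le> \<epsilon> \<longleftrightarrow> \<bar>real m * tan \<omega> - real_of_int n\<bar> \<le> \<epsilon> / cos \<omega>"
proof -
  have "real m * sin \<omega> - real_of_int n * cos \<omega> = (real m * tan \<omega> - real_of_int n) * cos \<omega>"
    using assms by (simp add: tan_def field_simps)
  then have "\<bar>real m * sin \<omega> - real_of_int n * cos \<omega>\<bar> = \<bar>real m * tan \<omega> - real_of_int n\<bar> * cos \<omega>"
    using assms by (simp add: abs_mult)
  then show ?thesis using assms by (simp add: field_simps)
qed

text \<open>Dirichlet's theorem provides a lattice point of abscissa at most \<open>1/\<epsilon> + 1\<close> close to the ray.\<close>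

lemma trajectory_exits:
  assumes \<omega>: "0 < \<omega>" "\<omega> < pi / 4" and \<epsilon>: "0 < \<epsilon>" "\<epsilon> \<le> 1 / 8"
  shows "exit_set \<epsilon> \<omega> \<noteq> {}" "real (reflections \<epsilon> \<omega>) * \<epsilon> \<le> 3"
proof -
  note F = octant_facts[OF \<omega>]
  define T where "T = nat \<lceil>1 / \<epsilon>\<rceil>"
  have T: "1 / \<epsilon> \<le> real T" "real T \<le> 1 / \<epsilon> + 1" using \<epsilon> by (simp_all add: T_def of_nat_ceiling)
  have T0: "T > 0" using T(1) \<epsilon> by (intro Nat.gr0I) (simp add: field_simps)
  have "\<epsilon> * 1 \<le> \<epsilon> / cos \<omega>" using F \<epsilon> by (simp add: field_simps)
  then have "1 \<le> \<epsilon> / cos \<omega> * real T" using T(1) \<epsilon> mult_mono[of \<epsilon> "\<epsilon> / cos \<omega>" "1 / \<epsilon>" "real T"] F by simp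
  then have "tan \<omega> \<in> near T (\<epsilon> / cos \<omega>)" using F T0 by (intro near_full) auto
  then obtain q a where q: "1 \<le> q" "q \<le> T" "\<bar>real q * tan \<omega> - real_of_int a\<bar> \<le> \<epsilon> / cos \<omega>" by (auto simp: near_def)
  then have hit: "\<bar>real q * sin \<omega> - real_of_int a * cos \<omega>\<bar> \<le> \<epsilon>" using tan_near_iff[of \<omega>] F by simp
  note h = hit_gives_exit[OF \<omega> \<epsilon> q(1) hit]
  show "exit_set \<epsilon> \<omega> \<noteq> {}" by (rule h(1))
  have "real q * (1 + tan \<omega>) \<le> (1 / \<epsilon> + 1) * 2" using q(2) T F by (intro mult_mono) auto
  then have "real (reflections \<epsilon> \<omega>) \<le> 2 / \<epsilon> + 3" using h(2) by simp
  then have "real (reflections \<epsilon> \<omega>) * \<epsilon> \<le> (2 / \<epsilon> + 3) * \<epsilon>" using \<epsilon> by (intro mult_right_mono) auto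
  also have "\<dots> \<le> 3" using \<epsilon> by (simp add: distrib_right)
  finally show "real (reflections \<epsilon> \<omega>) * \<epsilon> \<le> 3" .
qed

text \<open>The squared distance from \<open>(m, n)\<close> to the point at time \<open>t\<close> on the ray of direction \<open>(C, S)\<close>, split
  into its components along and across the ray.\<close>

lemma distance_to_point_on_line:
  fixes C S t m n :: real
  assumes "C\<^sup>2 + S\<^sup>2 = 1"
  shows "(t * C - m)\<^sup>2 + (t * S - n)\<^sup>2 = (t - (m * C + n * S))\<^sup>2 + (m * S - n * C)\<^sup>2"
proof -
  have "(t * C - m)\<^sup>2 + (t * S - n)\<^sup>2 = t\<^sup>2 * (C\<^sup>2 + S\<^sup>2) - 2 * t * (m * C + n * S) + (m\<^sup>2 + n\<^sup>2)"
    by (simp add: power2_eq_square algebra_simps)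
  moreover have "(m * C + n * S)\<^sup>2 + (m * S - n * C)\<^sup>2 = (m\<^sup>2 + n\<^sup>2) * (C\<^sup>2 + S\<^sup>2)"
    by (simp add: power2_eq_square algebra_simps)
  ultimately show ?thesis using assms by (simp add: power2_diff)
qed

text \<open>The exit time is an infimum over countably many circles, and the times at which the ray meets the
  circle about \<open>(m, n)\<close> are \<open>D \<plusminus> r\<close> with \<open>D\<close> and \<open>r\<close> continuous in \<open>\<omega>\<close>.\<close>

lemma borel_measurable_reflections:
  assumes \<epsilon>: "0 < \<epsilon>" "\<epsilon> \<le> 1 / 8"
  shows "(\<lambda>\<omega>. if 0 < \<omega> \<and> \<omega> < pi / 4 then real (reflections \<epsilon> \<omega>) else 0) \<in> borel_measurable borel"
proof -
  define E where "E = (\<lambda>\<omega>. if 0 < \<omega> \<and> \<omega> < pi / 4 then exit_time \<epsilon> \<omega> else 0)"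
  have "E \<in> borel_measurable borel"
  proof (rule borel_measurableI_less)
    fix x :: real
    define D X where "D = (\<lambda>(m::int) (n::int) \<omega>. real_of_int m * cos \<omega> + real_of_int n * sin \<omega>)"
      and "X = (\<lambda>(m::int) (n::int) \<omega>. real_of_int m * sin \<omega> - real_of_int n * cos \<omega>)"
    define r where "r = (\<lambda>m n \<omega>. sqrt (\<epsilon>\<^sup>2 - (X m n \<omega>)\<^sup>2))"
    have [measurable]: "D m n \<in> borel_measurable borel" "X m n \<in> borel_measurable borel" "r m n \<in> borel_measurable borel" for m n
      unfolding D_def X_def r_def by (intro borel_measurable_continuous_onI continuous_intros)+
    let ?B = "\<lambda>m n. {\<omega>. (m, n) \<noteq> (0, 0) \<and> (X m n \<omega>)\<^sup>2 \<le> \<epsilon>\<^sup>2 \<and> (0 < D m n \<omega> - r m n \<omega> \<and> D m n \<omega> - r m n \<omega> < x \<or> 0 < D m n \<omega> + r m n \<omega> \<and> D m n \<omega> + r m n \<omega> < x)}"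
    have sol: "(\<tau> * cos \<omega> - real_of_int m)\<^sup>2 + (\<tau> * sin \<omega> - real_of_int n)\<^sup>2 = \<epsilon>\<^sup>2 \<longleftrightarrow>
        (X m n \<omega>)\<^sup>2 \<le> \<epsilon>\<^sup>2 \<and> (\<tau> = D m n \<omega> - r m n \<omega> \<or> \<tau> = D m n \<omega> + r m n \<omega>)" for \<tau> \<omega> m n
    proof -
      have e: "(\<tau> * cos \<omega> - real_of_int m)\<^sup>2 + (\<tau> * sin \<omega> - real_of_int n)\<^sup>2 = (\<tau> - D m n \<omega>)\<^sup>2 + (X m n \<omega>)\<^sup>2"
        unfolding D_def X_def by (rule distance_to_point_on_line) simp
      show ?thesis
      proof (cases "(X m n \<omega>)\<^sup>2 \<le> \<epsilon>\<^sup>2")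
        case True
        then have "(r m n \<omega>)\<^sup>2 = \<epsilon>\<^sup>2 - (X m n \<omega>)\<^sup>2" by (simp add: r_def)
        then have "(\<tau> - D m n \<omega>)\<^sup>2 + (X m n \<omega>)\<^sup>2 = \<epsilon>\<^sup>2 \<longleftrightarrow> (\<tau> - D m n \<omega>)\<^sup>2 = (r m n \<omega>)\<^sup>2" by linarith
        also have "\<dots> \<longleftrightarrow> \<tau> - D m n \<omega> = r m n \<omega> \<or> \<tau> - D m n \<omega> = - r m n \<omega>" by (rule power2_eq_iff)
        finally show ?thesis unfolding e using True by auto
      next
        case False
        then have "(\<tau> - D m n \<omega>)\<^sup>2 + (X m n \<omega>)\<^sup>2 \<noteq> \<epsilon>\<^sup>2"
          using zero_le_power2[of "\<tau> - D m n \<omega>"] by linarith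
        then show ?thesis unfolding e using False by simp
      qed
    qed
    have lt: "exit_time \<epsilon> \<omega> < x \<longleftrightarrow> \<omega> \<in> (\<Union>m. \<Union>n. ?B m n)" if "0 < \<omega>" "\<omega> < pi / 4" for \<omega>
    proof -
      have "exit_time \<epsilon> \<omega> < x \<longleftrightarrow> (\<exists>\<tau>\<in>exit_set \<epsilon> \<omega>. \<tau> < x)"
        unfolding exit_time_eq by (rule cInf_less_iff[OF trajectory_exits(1)[OF that \<epsilon>] exit_set_bdd_below])
      also have "\<dots> \<longleftrightarrow> \<omega> \<in> (\<Union>m. \<Union>n. ?B m n)"
        unfolding exit_set_def sol UN_iff mem_Collect_eq Bex_def by blast
      finally show ?thesis .
    qed
    have "{\<omega> \<in> space borel. E \<omega> < x} = ({0<..<pi / 4} \<inter> (\<Union>m. \<Union>n. ?B m n)) \<union> (if 0 < x then - {0<..<pi / 4} else {})"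
      by (auto simp: E_def lt split: if_splits)
    also have "\<dots> \<in> sets borel"
      by (intro sets.Un sets.Int sets.countable_UN' countableI_type sets.empty_sets)
         (auto intro!: sets.countable_UN' countableI_type)
    finally show "{\<omega> \<in> space borel. E \<omega> < x} \<in> sets borel" .
  qed
  note [measurable] = this
  have [measurable]: "(\<lambda>\<omega>::real. cos \<omega>) \<in> borel_measurable borel" "(\<lambda>\<omega>::real. sin \<omega>) \<in> borel_measurable borel"
    by (intro borel_measurable_continuous_onI continuous_intros)+
  have "(\<lambda>\<omega>. if 0 < \<omega> \<and> \<omega> < pi / 4 then real (nat (\<lceil>E \<omega> * cos \<omega>\<rceil> - 1) + nat (\<lceil>E \<omega> * sin \<omega>\<rceil> - 1)) else 0) \<in> borel_measurable borel"
    by measurable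
  moreover have "(if 0 < \<omega> \<and> \<omega> < pi / 4 then real (nat (\<lceil>E \<omega> * cos \<omega>\<rceil> - 1) + nat (\<lceil>E \<omega> * sin \<omega>\<rceil> - 1)) else 0) =
     (if 0 < \<omega> \<and> \<omega> < pi / 4 then real (reflections \<epsilon> \<omega>) else 0)" for \<omega>
  proof (cases "0 < \<omega> \<and> \<omega> < pi / 4")
    case True
    then have "cos \<omega> > 0" "sin \<omega> > 0" using octant_facts(1,2)[of \<omega>] by auto
    then show ?thesis using True by (simp add: E_def reflections_eq)
  next
    case False
    then show ?thesis by (simp only: if_False)
  qed
  ultimately show ?thesis by (simp only:)
qed

section \<open>Distribution of the reflection count\<close>

text \<open>The substitution \<open>t = tan \<omega>\<close> has the density \<open>1 / cos\<^sup>2 \<omega>\<close>, which is monotone in \<open>\<omega>\<close>.\<close>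

lemma measure_tan_preimage:
  fixes S :: "real set"
  assumes \<omega>: "0 \<le> \<omega>1" "\<omega>1 \<le> \<omega>2" "\<omega>2 < pi / 2" and S: "S \<in> sets borel"
  defines "A \<equiv> {\<omega> \<in> {\<omega>1..\<omega>2}. tan \<omega> \<in> S}" and "m \<equiv> measure lborel (S \<inter> {tan \<omega>1..tan \<omega>2})"
  shows "A \<in> sets borel" "(cos \<omega>2)\<^sup>2 * m \<le> measure lborel A" "measure lborel A \<le> (cos \<omega>1)\<^sup>2 * m"
proof -
  have c2: "cos \<omega>2 > 0" using \<omega> by (intro cos_gt_zero_pi) auto
  have cpos: "cos \<omega> > 0" if "\<omega> \<in> {\<omega>1..\<omega>2}" for \<omega> using that \<omega> by (intro cos_gt_zero_pi) auto
  have cne: "cos \<omega> \<noteq> 0" if "\<omega> \<in> {\<omega>1..\<omega>2}" for \<omega> using cpos[OF that] by simp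
  have mono: "cos \<omega>2 \<le> cos \<omega>" "cos \<omega> \<le> cos \<omega>1" if "\<omega> \<in> {\<omega>1..\<omega>2}" for \<omega>
    using that \<omega> by (auto intro!: cos_monotone_0_pi_le)
  have "continuous_on {\<omega>1..\<omega>2} tan"
    by (intro continuous_intros) (use cne in auto)
  then have "tan \<in> borel_measurable (restrict_space borel {\<omega>1..\<omega>2})"
    by (rule borel_measurable_continuous_on_restrict)
  from measurable_sets[OF this S] show A: "A \<in> sets borel"
    by (auto simp: A_def vimage_def Int_def sets_restrict_space_iff space_restrict_space conj_commute)
  have fin: "emeasure lborel A \<noteq> \<infinity>" "emeasure lborel (S \<inter> {tan \<omega>1..tan \<omega>2}) \<noteq> \<infinity>"
  proof -
    have "bounded A" by (rule bounded_subset[OF bounded_closed_interval[of \<omega>1 \<omega>2]]) (auto simp: A_def)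
    then show "emeasure lborel A \<noteq> \<infinity>" using emeasure_bounded_finite[of A] by simp
    have "bounded (S \<inter> {tan \<omega>1..tan \<omega>2})"
      by (rule bounded_subset[OF bounded_closed_interval[of "tan \<omega>1" "tan \<omega>2"]]) auto
    then show "emeasure lborel (S \<inter> {tan \<omega>1..tan \<omega>2}) \<noteq> \<infinity>"
      using emeasure_bounded_finite[of "S \<inter> {tan \<omega>1..tan \<omega>2}"] by simp
  qed
  have mA: "emeasure lborel A = ennreal (measure lborel A)"
    and mS: "emeasure lborel (S \<inter> {tan \<omega>1..tan \<omega>2}) = ennreal m"
    unfolding m_def using fin by (simp_all add: emeasure_eq_ennreal_measure)
  have inv_nonneg: "0 \<le> inverse ((cos x)\<^sup>2)" for x :: real by simp
  have "(\<integral>\<^sup>+x. ennreal (indicator S x * indicator {tan \<omega>1..tan \<omega>2} x) \<partial>lborel) =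
      (\<integral>\<^sup>+x. ennreal (indicator S (tan x) * inverse ((cos x)\<^sup>2) * indicator {\<omega>1..\<omega>2} x) \<partial>lborel)"
  proof (rule nn_integral_substitution)
    show "set_borel_measurable borel {tan \<omega>1..tan \<omega>2} (indicat_real S)"
      unfolding set_borel_measurable_def using S by measurable
    show "(tan has_real_derivative inverse ((cos x)\<^sup>2)) (at x)" if "x \<in> {\<omega>1..\<omega>2}" for x
      using cpos[OF that] by (intro DERIV_tan) simp
    show "continuous_on {\<omega>1..\<omega>2} (\<lambda>x. inverse ((cos x)\<^sup>2))"
      by (intro continuous_intros) (use cne in auto)
  qed (use \<omega> in auto)
  also have "(\<integral>\<^sup>+x. ennreal (indicator S x * indicator {tan \<omega>1..tan \<omega>2} x) \<partial>lborel) = emeasure lborel (S \<inter> {tan \<omega>1..tan \<omega>2})"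
  proof -
    have "(\<integral>\<^sup>+x. ennreal (indicator S x * indicator {tan \<omega>1..tan \<omega>2} x) \<partial>lborel) =
        (\<integral>\<^sup>+x. indicator (S \<inter> {tan \<omega>1..tan \<omega>2}) x \<partial>lborel)"
      by (intro nn_integral_cong) (auto simp: indicator_def)
    then show ?thesis using S by simp
  qed
  finally have e: "emeasure lborel (S \<inter> {tan \<omega>1..tan \<omega>2}) = (\<integral>\<^sup>+x. ennreal (inverse ((cos x)\<^sup>2)) * indicator A x \<partial>lborel)"
    by (simp, intro nn_integral_cong) (auto simp: A_def indicator_def)
  have "(\<integral>\<^sup>+x. ennreal (inverse ((cos x)\<^sup>2)) * indicator A x \<partial>lborel) \<le> (\<integral>\<^sup>+x. ennreal (inverse ((cos \<omega>2)\<^sup>2)) * indicator A x \<partial>lborel)"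
  proof (intro nn_integral_mono)
    fix x
    have "inverse ((cos x)\<^sup>2) \<le> inverse ((cos \<omega>2)\<^sup>2)" if "x \<in> A"
      using that mono[of x] cpos[of x] c2 by (intro le_imp_inverse_le power_mono) (auto simp: A_def)
    then show "ennreal (inverse ((cos x)\<^sup>2)) * indicator A x \<le> ennreal (inverse ((cos \<omega>2)\<^sup>2)) * indicator A x"
      by (auto simp: indicator_def intro: ennreal_leI)
  qed
  also have "\<dots> = ennreal (inverse ((cos \<omega>2)\<^sup>2)) * emeasure lborel A" using A by (simp add: nn_integral_cmult_indicator)
  finally have "ennreal m \<le> ennreal (inverse ((cos \<omega>2)\<^sup>2) * measure lborel A)"
    by (simp only: e[symmetric] mS mA ennreal_mult[OF inv_nonneg measure_nonneg])
  then have "m \<le> inverse ((cos \<omega>2)\<^sup>2) * measure lborel A" by (simp add: ennreal_le_iff)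
  then show "(cos \<omega>2)\<^sup>2 * m \<le> measure lborel A" using c2 by (simp add: field_simps)
  have c1: "cos \<omega>1 > 0" using cpos \<omega> by auto
  have "ennreal (inverse ((cos \<omega>1)\<^sup>2)) * emeasure lborel A = (\<integral>\<^sup>+x. ennreal (inverse ((cos \<omega>1)\<^sup>2)) * indicator A x \<partial>lborel)"
    using A by (simp add: nn_integral_cmult_indicator)
  also have "\<dots> \<le> (\<integral>\<^sup>+x. ennreal (inverse ((cos x)\<^sup>2)) * indicator A x \<partial>lborel)"
  proof (intro nn_integral_mono)
    fix x
    have "inverse ((cos \<omega>1)\<^sup>2) \<le> inverse ((cos x)\<^sup>2)" if "x \<in> A"
      using that mono[of x] cpos[of x] c1 by (intro le_imp_inverse_le power_mono) (auto simp: A_def)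
    then show "ennreal (inverse ((cos \<omega>1)\<^sup>2)) * indicator A x \<le> ennreal (inverse ((cos x)\<^sup>2)) * indicator A x"
      by (auto simp: indicator_def intro: ennreal_leI)
  qed
  finally have "ennreal (inverse ((cos \<omega>1)\<^sup>2) * measure lborel A) \<le> ennreal m"
    by (simp only: e[symmetric] mS mA ennreal_mult[OF inv_nonneg measure_nonneg])
  then have "inverse ((cos \<omega>1)\<^sup>2) * measure lborel A \<le> m" by (simp add: ennreal_le_iff m_def)
  then show "measure lborel A \<le> (cos \<omega>1)\<^sup>2 * m" using c1 by (simp add: field_simps)
qed

lemma measure_Icc_eq_Ico:
  fixes B :: "real set"
  assumes "B \<in> sets borel"
  shows "measure lborel (B \<inter> {a..b}) = measure lborel (B \<inter> {a..<b})"
proof (rule measure_eq_AE)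
  show "AE x in lborel. (x \<in> B \<inter> {a..b}) = (x \<in> B \<inter> {a..<b})"
    using AE_lborel_singleton[of b] by eventually_elim auto
qed (use assms in auto)

definition few_reflections :: "real \<Rightarrow> real \<Rightarrow> real set" where
  "few_reflections \<epsilon> y = {\<omega>. 0 < \<omega> \<and> \<omega> < pi / 4 \<and> \<epsilon> * real (reflections \<epsilon> \<omega>) \<le> y}"

lemma few_reflections_measurable [measurable]:
  assumes \<epsilon>: "0 < \<epsilon>" "\<epsilon> \<le> 1 / 8"
  shows "few_reflections \<epsilon> y \<in> sets borel"
proof -
  note [measurable] = borel_measurable_reflections[OF assms]
  have "few_reflections \<epsilon> y = {0<..<pi / 4} \<inter> {\<omega> \<in> space borel. \<epsilon> * (if 0 < \<omega> \<and> \<omega> < pi / 4 then real (reflections \<epsilon> \<omega>) else 0) \<le> y}"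
    by (auto simp: few_reflections_def)
  also have "\<dots> \<in> sets borel" by measurable
  finally show ?thesis .
qed

lemma trig_differences:
  assumes "0 \<le> x" "x < y" "y \<le> pi / 4"
  shows "0 \<le> cos x - cos y" "cos x - cos y \<le> y - x"
    "(y - x) / (cos x)\<^sup>2 \<le> tan y - tan x" "tan y - tan x \<le> (y - x) / (cos y)\<^sup>2"
proof -
  show "0 \<le> cos x - cos y" using assms cos_monotone_0_pi_le[of x y] by simp
  have "\<exists>z>x. z < y \<and> cos y - cos x = (y - x) * (- sin z)"
    by (rule MVT2[OF assms(2)]) (auto intro!: derivative_eq_intros)
  then obtain z where z: "cos y - cos x = (y - x) * (- sin z)" by blast
  have "(y - x) * sin z \<le> (y - x) * 1" using assms by (intro mult_left_mono) auto
  then show "cos x - cos y \<le> y - x" using z by simp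
  have cpos: "cos w > 0" if "x \<le> w" "w \<le> y" for w using assms that by (intro cos_gt_zero_pi) auto
  have "\<exists>z>x. z < y \<and> tan y - tan x = (y - x) * inverse ((cos z)\<^sup>2)"
    by (rule MVT2[OF assms(2)]) (use cpos in \<open>fastforce intro!: DERIV_tan\<close>)
  then obtain z where z: "x < z" "z < y" "tan y - tan x = (y - x) * inverse ((cos z)\<^sup>2)" by blast
  have "cos y \<le> cos z" "cos z \<le> cos x" using assms z by (auto intro!: cos_monotone_0_pi_le)
  then have "inverse ((cos x)\<^sup>2) \<le> inverse ((cos z)\<^sup>2)" "inverse ((cos z)\<^sup>2) \<le> inverse ((cos y)\<^sup>2)"
    using cpos[of x] cpos[of y] cpos[of z] assms z by (auto intro!: le_imp_inverse_le power_mono)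
  then show "(y - x) / (cos x)\<^sup>2 \<le> tan y - tan x" "tan y - tan x \<le> (y - x) / (cos y)\<^sup>2"
    unfolding z(3) divide_inverse using assms by (auto intro!: mult_left_mono)
qed

lemma tan_mono_octant:
  assumes "0 \<le> x" "x \<le> y" "y \<le> pi / 4"
  shows "tan x \<le> tan y"
proof (cases "x = y")
  case False
  then have "0 \<le> (y - x) / (cos x)\<^sup>2" using assms by simp
  then show ?thesis using trig_differences(3)[of x y] assms False by linarith
qed simp

lemma hit_cdf_le_1: "0 \<le> x \<Longrightarrow> hit_cdf x \<le> 1"
  using hit_cdf_diff(1)[of x "max x 1"] hit_cdf_ge_1[of "max x 1"] by simp

lemma hit_cdf_nonneg: "0 \<le> x \<Longrightarrow> 0 \<le> hit_cdf x"
  using hit_cdf_diff(1)[of 0 x] by simp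

text \<open>The density is at most \<open>2\<close>.\<close>

lemma hit_cdf_shift:
  assumes "0 \<le> u" "0 \<le> v" "u \<le> v + \<rho>" "0 \<le> \<rho>"
  shows "hit_cdf u \<le> hit_cdf v + 2 * \<rho>"
proof (cases "u \<le> v")
  case True
  then show ?thesis using hit_cdf_diff(1)[of u v] assms by simp
next
  case False
  then show ?thesis using hit_cdf_diff(2)[of v u] assms by simp
qed

lemma measure_near_interval:
  assumes equi: "\<And>T \<eta> b. 0 \<le> \<eta> \<Longrightarrow> 0 \<le> b \<Longrightarrow> b \<le> 1 \<Longrightarrow>
      \<bar>measure lborel (near T \<eta> \<inter> {0..<b}) - b * hit_cdf (\<eta> * real T)\<bar> \<le> C * \<eta> * real T powr e"
    and "0 \<le> \<eta>" "0 \<le> a" "a \<le> b" "b \<le> 1"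
  shows "\<bar>measure lborel (near T \<eta> \<inter> {a..b}) - (b - a) * hit_cdf (\<eta> * real T)\<bar> \<le> 2 * (C * \<eta> * real T powr e)"
proof -
  have fin: "emeasure lborel (near T \<eta> \<inter> {x..<y}) \<noteq> \<infinity>" for x y
  proof -
    have "bounded (near T \<eta> \<inter> {x..<y})" by (rule bounded_subset[OF bounded_closed_interval[of x y]]) auto
    then show ?thesis using emeasure_bounded_finite[of "near T \<eta> \<inter> {x..<y}"] by simp
  qed
  have "near T \<eta> \<inter> {0..<b} = (near T \<eta> \<inter> {0..<a}) \<union> (near T \<eta> \<inter> {a..<b})" using assms by auto
  moreover have "measure lborel ((near T \<eta> \<inter> {0..<a}) \<union> (near T \<eta> \<inter> {a..<b})) =
      measure lborel (near T \<eta> \<inter> {0..<a}) + measure lborel (near T \<eta> \<inter> {a..<b})"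
    by (rule measure_Union) (use fin in auto)
  ultimately have "measure lborel (near T \<eta> \<inter> {0..<b}) = measure lborel (near T \<eta> \<inter> {0..<a}) + measure lborel (near T \<eta> \<inter> {a..b})"
    using measure_Icc_eq_Ico[of "near T \<eta>" a b] by simp
  moreover have "\<bar>measure lborel (near T \<eta> \<inter> {0..<b}) - b * hit_cdf (\<eta> * real T)\<bar> \<le> C * \<eta> * real T powr e"
    "\<bar>measure lborel (near T \<eta> \<inter> {0..<a}) - a * hit_cdf (\<eta> * real T)\<bar> \<le> C * \<eta> * real T powr e"
    using equi[of \<eta> b T] equi[of \<eta> a T] assms by auto
  ultimately show ?thesis by (simp add: left_diff_distrib)
qed

text \<open>On the interval from \<open>\<omega>1\<close> to \<open>\<omega>2\<close> the tolerance \<open>\<epsilon> / cos \<omega>\<close> lies between its values at the ends.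
  So directions with few reflections have slopes in \<open>near T \<eta>\<close> for the larger tolerance and a slightly
  enlarged \<open>T\<close>, and slopes in \<open>near T \<eta>\<close> for the smaller tolerance and a slightly diminished \<open>T\<close>
  belong to directions with few reflections. In both cases \<open>\<eta> T\<close> differs from \<open>y / (sin \<omega> + cos \<omega>)\<close>
  by \<open>O(d + \<epsilon>)\<close>, for every \<open>\<omega>\<close> in the interval.\<close>

lemma few_reflections_piece:
  assumes equi: "\<And>T \<eta> b. 0 \<le> \<eta> \<Longrightarrow> 0 \<le> b \<Longrightarrow> b \<le> 1 \<Longrightarrow>
      \<bar>measure lborel (near T \<eta> \<inter> {0..<b}) - b * hit_cdf (\<eta> * real T)\<bar> \<le> C * \<eta> * real T powr e"
    and C: "C > 0" "e > 0" and \<epsilon>: "0 < \<epsilon>" "\<epsilon> \<le> 1 / 8" and y: "0 \<le> y" "y \<le> 3"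
    and I: "0 \<le> \<omega>1" "\<omega>1 < \<omega>2" "\<omega>2 \<le> pi / 4" and \<omega>: "\<omega>1 \<le> \<omega>" "\<omega> \<le> \<omega>2"
  defines "d \<equiv> \<omega>2 - \<omega>1" and "E \<equiv> C * (2 * \<epsilon>) * (6 / \<epsilon>) powr e"
  shows "\<bar>measure lborel (few_reflections \<epsilon> y \<inter> {\<omega>1..<\<omega>2}) - d * hit_cdf (y / (sin \<omega> + cos \<omega>))\<bar> \<le> 45 * d\<^sup>2 + 10 * d * \<epsilon> + 2 * E"
proof -
  define c1 c2 c t1 t2 t where "c1 = cos \<omega>1" and "c2 = cos \<omega>2" and "c = cos \<omega>"
    and "t1 = tan \<omega>1" and "t2 = tan \<omega>2" and "t = tan \<omega>"
  define g where "g = sin \<omega> + cos \<omega>"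
  define v where "v = y / g"
  define \<rho> where "\<rho> = 20 * d + 5 * \<epsilon>"
  note F1 = octant_closed_facts[of \<omega>1] and F2 = octant_closed_facts[of \<omega>2] and F = octant_closed_facts[of \<omega>]
  have d: "0 < d" "d \<le> 1" using I pi_less_4 by (auto simp: d_def)
  have cb: "7 / 10 \<le> c1" "c1 \<le> 1" "7 / 10 \<le> c2" "c2 \<le> 1" "7 / 10 \<le> c" "c \<le> 1"
    and tb: "0 \<le> t1" "t1 \<le> 1" "0 \<le> t2" "t2 \<le> 1" "0 \<le> t" "t \<le> 1"
    and g: "g = c * (1 + t)" "1 \<le> g" "g \<le> 2"
    using F1 F2 F I \<omega> by (simp_all add: c1_def c2_def c_def t1_def t2_def t_def g_def)
  have tan_lip: "tan y' - tan x' \<le> 5 / 2 * (y' - x')" if "0 \<le> x'" "x' < y'" "y' \<le> pi / 4" for x' y'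
  proof -
    have "(7 / 10)\<^sup>2 \<le> (cos y')\<^sup>2" using octant_closed_facts(1)[of y'] that by (intro power_mono) auto
    then have "(y' - x') / (cos y')\<^sup>2 \<le> (y' - x') / (2 / 5)"
      using that by (intro divide_left_mono) (auto simp: power2_eq_square)
    also have "(y' - x') / (2 / 5) = 5 / 2 * (y' - x')" by simp
    finally show ?thesis using trig_differences(4)[OF that] by linarith
  qed
  have diffs: "0 \<le> c - c2" "c - c2 \<le> d" "0 \<le> c1 - c" "c1 - c \<le> d" "0 \<le> t - t1" "t - t1 \<le> 5 / 2 * d" "0 \<le> t2 - t" "t2 - t \<le> 5 / 2 * d"
  proof -
    have "0 \<le> cos x' - cos y' \<and> cos x' - cos y' \<le> y' - x' \<and> 0 \<le> tan y' - tan x' \<and> tan y' - tan x' \<le> 5 / 2 * (y' - x')"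
      if "0 \<le> x'" "x' \<le> y'" "y' \<le> pi / 4" for x' y'
    proof (cases "x' = y'")
      case False
      then have lt: "x' < y'" using that by simp
      have "0 \<le> (y' - x') / (cos x')\<^sup>2" using that by simp
      then show ?thesis using trig_differences[OF that(1) lt that(3)] tan_lip[OF that(1) lt that(3)] by linarith
    qed simp
    from this[of \<omega> \<omega>2] this[of \<omega>1 \<omega>]
    show "0 \<le> c - c2" "c - c2 \<le> d" "0 \<le> c1 - c" "c1 - c \<le> d" "0 \<le> t - t1" "t - t1 \<le> 5 / 2 * d" "0 \<le> t2 - t" "t2 - t \<le> 5 / 2 * d"
      using I \<omega> by (simp_all add: c_def c1_def c2_def t_def t1_def t2_def d_def)
  qed
  have t12: "t1 \<le> t2" using diffs by linarith
  have v0: "0 \<le> v" "v \<le> 3"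
    using y g by (simp_all add: v_def divide_le_eq)
  have \<rho>0: "0 \<le> \<rho>" using d \<epsilon> by (simp add: \<rho>_def)
  have E0: "0 \<le> E" using C \<epsilon> by (simp add: E_def)
  have errE: "C * \<eta> * real T powr e \<le> E" if "0 \<le> \<eta>" "\<eta> \<le> 2 * \<epsilon>" "real T \<le> 6 / \<epsilon>" for \<eta> T
    unfolding E_def using that C by (intro mult_mono powr_mono2) auto
  have c2sq: "2 / 5 \<le> c2\<^sup>2" "2 / 5 \<le> c1\<^sup>2"
  proof -
    have "(7 / 10)\<^sup>2 \<le> c2\<^sup>2" "(7 / 10)\<^sup>2 \<le> c1\<^sup>2" using cb by (auto intro!: power_mono)
    then show "2 / 5 \<le> c2\<^sup>2" "2 / 5 \<le> c1\<^sup>2" by (simp_all add: power2_eq_square)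
  qed
  have csq: "c1\<^sup>2 - c2\<^sup>2 \<le> 2 * d"
  proof -
    have "c1 - c2 \<le> d" using trig_differences(2)[of \<omega>1 \<omega>2] I by (simp add: c1_def c2_def d_def)
    then have "(c1 - c2) * (c1 + c2) \<le> d * 2" using diffs cb d by (intro mult_mono) auto
    then show ?thesis by (simp add: power2_eq_square algebra_simps)
  qed
  have c21: "c2\<^sup>2 \<le> c1\<^sup>2" using diffs cb by (intro power_mono) auto
  have cnz: "c1 \<noteq> 0" "c2 \<noteq> 0" using cb by auto
  have up_len: "c1\<^sup>2 * (t2 - t1) \<le> d + 5 * d\<^sup>2"
  proof -
    have "c1\<^sup>2 * (t2 - t1) \<le> c1\<^sup>2 * (d / c2\<^sup>2)"
      using trig_differences(4)[of \<omega>1 \<omega>2] I by (intro mult_left_mono) (auto simp: c2_def t1_def t2_def d_def)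
    also have "\<dots> = d + d * ((c1\<^sup>2 - c2\<^sup>2) / c2\<^sup>2)" using cnz by (simp add: field_simps)
    also have "\<dots> \<le> d + d * (2 * d / (2 / 5))"
      using d csq c2sq c21 by (intro add_left_mono mult_left_mono frac_le) auto
    finally show ?thesis by (simp add: power2_eq_square)
  qed
  have low_len: "d - 5 * d\<^sup>2 \<le> c2\<^sup>2 * (t2 - t1)"
  proof -
    have "d - 5 * d\<^sup>2 = d - d * (2 * d / (2 / 5))" by (simp add: power2_eq_square)
    also have "\<dots> \<le> d - d * ((c1\<^sup>2 - c2\<^sup>2) / c1\<^sup>2)"
      using d csq c2sq c21 by (intro diff_left_mono mult_left_mono frac_le) auto
    also have "\<dots> = c2\<^sup>2 * (d / c1\<^sup>2)" using cnz by (simp add: field_simps)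
    also have "\<dots> \<le> c2\<^sup>2 * (t2 - t1)"
      using trig_differences(3)[of \<omega>1 \<omega>2] I by (intro mult_left_mono) (auto simp: c1_def t1_def t2_def d_def)
    finally show ?thesis .
  qed
  have I': "0 \<le> \<omega>1" "\<omega>1 \<le> \<omega>2" "\<omega>2 < pi / 2" using I by auto
  let ?M = "measure lborel (few_reflections \<epsilon> y \<inter> {\<omega>1..<\<omega>2})"
  have few_meas: "few_reflections \<epsilon> y \<in> sets borel" by (rule few_reflections_measurable[OF \<epsilon>])
  have upper: "?M \<le> d * hit_cdf v + 45 * d\<^sup>2 + 10 * d * \<epsilon> + 2 * E"
  proof -
    \<comment> \<open>\<open>exit_gives_hit\<close> yields \<open>m (1 + tan x) \<le> y / \<epsilon> + 3\<close>, and \<open>tan x \<ge> t1\<close>\<close>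
    define T where "T = nat \<lfloor>(y / \<epsilon> + 3) / (1 + t1)\<rfloor>"
    define \<eta> where "\<eta> = \<epsilon> / c2"
    let ?A = "{x \<in> {\<omega>1..\<omega>2}. tan x \<in> near T \<eta>}"
    have \<eta>: "0 \<le> \<eta>" "\<eta> \<le> 2 * \<epsilon>" using cb \<epsilon> by (simp_all add: \<eta>_def field_simps)
    have a0: "0 \<le> (y / \<epsilon> + 3) / (1 + t1)" using y \<epsilon> tb by simp
    have Tle: "real T \<le> (y / \<epsilon> + 3) / (1 + t1)" using a0 by (simp add: T_def)
    also have "\<dots> \<le> (y / \<epsilon> + 3) / 1" using y \<epsilon> tb by (intro divide_left_mono) auto
    also have "\<dots> \<le> 6 / \<epsilon>"
    proof -
      have "y / \<epsilon> \<le> 3 / \<epsilon>" "3 \<le> 3 / \<epsilon>" "6 / \<epsilon> = 3 / \<epsilon> + 3 / \<epsilon>"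
        using y \<epsilon> by (simp_all add: divide_right_mono field_simps)
      then show ?thesis by simp
    qed
    finally have T6: "real T \<le> 6 / \<epsilon>" .
    have sub: "few_reflections \<epsilon> y \<inter> {\<omega>1..<\<omega>2} \<subseteq> ?A"
    proof
      fix x assume "x \<in> few_reflections \<epsilon> y \<inter> {\<omega>1..<\<omega>2}"
      then have x: "0 < x" "x < pi / 4" "\<epsilon> * real (reflections \<epsilon> x) \<le> y" "\<omega>1 \<le> x" "x < \<omega>2" by (auto simp: few_reflections_def)
      obtain m n where mn: "1 \<le> m" "\<bar>real m * sin x - real_of_int n * cos x\<bar> \<le> \<epsilon>" "real m * (1 + tan x) \<le> real (reflections \<epsilon> x) + 3"
        using exit_gives_hit[OF x(1,2) \<epsilon> trajectory_exits(1)[OF x(1,2) \<epsilon>]] by blast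
      have cx: "cos x > 0" "c2 \<le> cos x" using x I octant_facts(1)[OF x(1,2)] by (auto simp: c2_def intro!: cos_monotone_0_pi_le)
      have tx: "t1 \<le> tan x" unfolding t1_def using x I by (intro tan_mono_octant) auto
      have "real (reflections \<epsilon> x) \<le> y / \<epsilon>" using x(3) \<epsilon> by (simp add: field_simps)
      moreover have "real m * (1 + t1) \<le> real m * (1 + tan x)" using tx by (intro mult_left_mono) auto
      ultimately have "real m * (1 + t1) \<le> y / \<epsilon> + 3" using mn(3) by linarith
      then have "real m \<le> (y / \<epsilon> + 3) / (1 + t1)" using tb by (simp add: field_simps)
      then have "m \<le> T" unfolding T_def by (rule le_nat_floor)
      have "\<bar>real m * tan x - real_of_int n\<bar> \<le> \<epsilon> / cos x" using mn(2) tan_near_iff[OF cx(1)] by simp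
      also have "\<dots> \<le> \<eta>" unfolding \<eta>_def using cx cb \<epsilon> by (intro divide_left_mono) auto
      finally have "tan x \<in> near T \<eta>" using \<open>m \<le> T\<close> mn(1) by (auto simp: near_def)
      then show "x \<in> ?A" using x by simp
    qed
    note tp = measure_tan_preimage[OF I' near_measurable[of T \<eta>]]
    have "bounded ?A" by (rule bounded_subset[OF bounded_closed_interval[of \<omega>1 \<omega>2]]) auto
    then have "?A \<in> fmeasurable lborel" using tp(1) emeasure_bounded_finite[of ?A] by (intro fmeasurableI) auto
    then have "?M \<le> measure lborel ?A" using sub few_meas by (intro measure_mono_fmeasurable) auto
    also have "\<dots> \<le> c1\<^sup>2 * measure lborel (near T \<eta> \<inter> {t1..t2})" using tp(3) by (simp add: c1_def t1_def t2_def)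
    also have "\<dots> \<le> c1\<^sup>2 * ((t2 - t1) * hit_cdf (\<eta> * real T) + 2 * E)"
    proof (intro mult_left_mono)
      have "\<bar>measure lborel (near T \<eta> \<inter> {t1..t2}) - (t2 - t1) * hit_cdf (\<eta> * real T)\<bar> \<le> 2 * (C * \<eta> * real T powr e)"
        by (rule measure_near_interval[OF equi \<eta>(1) tb(1) t12 tb(4)])
      also have "\<dots> \<le> 2 * E" using errE[OF \<eta> T6] by simp
      finally show "measure lborel (near T \<eta> \<inter> {t1..t2}) \<le> (t2 - t1) * hit_cdf (\<eta> * real T) + 2 * E" by linarith
    qed simp
    also have "\<dots> = (c1\<^sup>2 * (t2 - t1)) * hit_cdf (\<eta> * real T) + c1\<^sup>2 * (2 * E)" by (simp only: distrib_left mult.assoc)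
    also have "\<dots> \<le> (d + 5 * d\<^sup>2) * hit_cdf (\<eta> * real T) + 1 * (2 * E)"
    proof (intro add_mono mult_right_mono up_len)
      show "0 \<le> hit_cdf (\<eta> * real T)" using \<eta> by (intro hit_cdf_nonneg) simp
      have "c1\<^sup>2 \<le> 1\<^sup>2" using cb by (intro power_mono) auto
      then show "c1\<^sup>2 \<le> 1" by simp
    qed (use E0 in simp)
    also have "\<dots> \<le> d * (hit_cdf v + 2 * \<rho>) + 5 * d\<^sup>2 * 1 + 2 * E"
    proof -
      have "\<eta> * real T \<le> v + \<rho>"
      proof -
        define g2 where "g2 = c2 * (1 + t1)"
        have "7 / 10 * 1 \<le> c2 * (1 + t1)" using cb tb by (intro mult_mono) auto
        then have g2: "7 / 10 \<le> g2" by (simp add: g2_def)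
        have "g - g2 = (c - c2) * (1 + t) + c2 * (t - t1)" by (simp add: g g2_def algebra_simps)
        also have "\<dots> \<le> d * 2 + 1 * (5 / 2 * d)" using diffs cb tb d by (intro add_mono mult_mono) auto
        finally have gg: "g - g2 \<le> 9 / 2 * d" by simp
        have "\<eta> * real T \<le> \<epsilon> / c2 * ((y / \<epsilon> + 3) / (1 + t1))" unfolding \<eta>_def using Tle cb \<epsilon> by (intro mult_left_mono) auto
        also have "\<dots> = (\<epsilon> * (y / \<epsilon> + 3)) / g2" by (simp add: g2_def)
        also have "\<epsilon> * (y / \<epsilon> + 3) = y + 3 * \<epsilon>" using \<epsilon> by (simp add: distrib_left)
        also have "(y + 3 * \<epsilon>) / g2 = v + (y * (g - g2)) / (g * g2) + 3 * \<epsilon> / g2"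
        proof -
          have "g \<noteq> 0" "g2 \<noteq> 0" using g g2 by auto
          then show ?thesis by (simp add: v_def field_simps)
        qed
        also have "\<dots> \<le> v + (3 * (9 / 2 * d)) / (1 * (7 / 10)) + 3 * \<epsilon> / (7 / 10)"
        proof (intro add_mono order_refl)
          have "y * (g - g2) \<le> 3 * (9 / 2 * d)"
          proof (cases "0 \<le> g - g2")
            case True then show ?thesis using y gg d by (intro mult_mono) auto
          next
            case False
            then have "y * (g - g2) \<le> 0" using y by (intro mult_nonneg_nonpos) auto
            then show ?thesis using d by simp
          qed
          then have "y * (g - g2) / (g * g2) \<le> 3 * (9 / 2 * d) / (g * g2)" using g g2 by (intro divide_right_mono) auto
          also have "\<dots> \<le> 3 * (9 / 2 * d) / (1 * (7 / 10))" using g g2 d by (intro divide_left_mono mult_mono) auto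
          finally show "y * (g - g2) / (g * g2) \<le> 3 * (9 / 2 * d) / (1 * (7 / 10))" .
          show "3 * \<epsilon> / g2 \<le> 3 * \<epsilon> / (7 / 10)" using g2 \<epsilon> by (intro divide_left_mono) auto
        qed
        also have "\<dots> \<le> v + \<rho>" using d \<epsilon> by (simp add: \<rho>_def)
        finally show ?thesis .
      qed
      then have h: "hit_cdf (\<eta> * real T) \<le> hit_cdf v + 2 * \<rho>" using \<eta> v0 \<rho>0 by (intro hit_cdf_shift) auto
      have h1: "hit_cdf (\<eta> * real T) \<le> 1" using \<eta> by (intro hit_cdf_le_1) simp
      have "d * hit_cdf (\<eta> * real T) \<le> d * (hit_cdf v + 2 * \<rho>)" using h d by (intro mult_left_mono) auto
      moreover have "5 * d\<^sup>2 * hit_cdf (\<eta> * real T) \<le> 5 * d\<^sup>2 * 1" using h1 by (intro mult_left_mono) auto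
      ultimately show ?thesis by (simp add: distrib_right)
    qed
    also have "\<dots> = d * hit_cdf v + 45 * d\<^sup>2 + 10 * d * \<epsilon> + 2 * E" by (simp add: \<rho>_def power2_eq_square algebra_simps)
    finally show ?thesis .
  qed
  have lower: "d * hit_cdf v - 45 * d\<^sup>2 - 10 * d * \<epsilon> - 2 * E \<le> ?M"
  proof -
    \<comment> \<open>\<open>hit_gives_exit\<close> needs \<open>m (1 + tan x) + 1 \<le> y / \<epsilon>\<close>, and \<open>tan x \<le> t2\<close>; if \<open>a < 1\<close>, then \<open>T = 0\<close> and nothing is claimed\<close>
    define a where "a = (y / \<epsilon> - 1) / (1 + t2)"
    define T where "T = nat \<lfloor>a\<rfloor>"
    define \<eta> where "\<eta> = \<epsilon> / c1"
    let ?A = "{x \<in> {\<omega>1..\<omega>2}. tan x \<in> near T \<eta>}"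
    have \<eta>: "0 \<le> \<eta>" "\<eta> \<le> 2 * \<epsilon>" using cb \<epsilon> by (simp_all add: \<eta>_def field_simps)
    have Tge: "a - 1 \<le> real T" unfolding T_def by linarith
    have ale: "a \<le> y / \<epsilon>"
    proof (cases "y / \<epsilon> - 1 \<ge> 0")
      case True
      then have "a \<le> (y / \<epsilon> - 1) / 1" unfolding a_def using tb by (intro divide_left_mono) auto
      then show ?thesis by simp
    next
      case False
      then have "a \<le> 0" unfolding a_def using tb by (intro divide_nonpos_nonneg) auto
      moreover have "0 \<le> y / \<epsilon>" using y \<epsilon> by simp
      ultimately show ?thesis by linarith
    qed
    have "y / \<epsilon> \<le> 6 / \<epsilon>" "0 \<le> 6 / \<epsilon>" using y \<epsilon> by (auto intro: divide_right_mono)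
    then have T6: "real T \<le> 6 / \<epsilon>" unfolding T_def using ale by linarith
    have sub: "?A \<inter> {\<omega>1<..<\<omega>2} \<subseteq> few_reflections \<epsilon> y \<inter> {\<omega>1..<\<omega>2}"
    proof
      fix x assume "x \<in> ?A \<inter> {\<omega>1<..<\<omega>2}"
      then have x: "\<omega>1 < x" "x < \<omega>2" and nr: "tan x \<in> near T \<eta>" by auto
      have x': "0 < x" "x < pi / 4" using x I by auto
      obtain m n where mn: "1 \<le> m" "m \<le> T" "\<bar>real m * tan x - real_of_int n\<bar> \<le> \<eta>" using nr by (auto simp: near_def)
      have cx: "cos x > 0" "cos x \<le> c1" using x I octant_facts(1)[OF x'] by (auto simp: c1_def intro!: cos_monotone_0_pi_le)
      have "\<eta> \<le> \<epsilon> / cos x" unfolding \<eta>_def using cx cb \<epsilon> by (intro divide_left_mono) auto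
      then have "\<bar>real m * sin x - real_of_int n * cos x\<bar> \<le> \<epsilon>" using mn(3) tan_near_iff[OF cx(1)] by simp
      from hit_gives_exit(2)[OF x' \<epsilon> mn(1) this]
      have R: "real (reflections \<epsilon> x) \<le> real m * (1 + tan x) + 1" .
      have tx: "tan x \<le> t2" unfolding t2_def using x x' I by (intro tan_mono_octant) auto
      have "1 \<le> T" using mn by simp
      then have "real T \<le> a" unfolding T_def by linarith
      then have "real m \<le> a" using mn(2) by simp
      then have "real m * (1 + tan x) \<le> a * (1 + t2)" using tx octant_facts(6)[OF x'] by (intro mult_mono) auto
      also have "\<dots> = y / \<epsilon> - 1" using tb by (simp add: a_def)
      finally have "real (reflections \<epsilon> x) \<le> y / \<epsilon>" using R by simp
      then have "\<epsilon> * real (reflections \<epsilon> x) \<le> y" using \<epsilon> by (simp add: field_simps)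
      then show "x \<in> few_reflections \<epsilon> y \<inter> {\<omega>1..<\<omega>2}" using x x' by (simp add: few_reflections_def)
    qed
    note tp = measure_tan_preimage[OF I' near_measurable[of T \<eta>]]
    have Aeq: "measure lborel ?A = measure lborel (?A \<inter> {\<omega>1<..<\<omega>2})"
    proof (rule measure_eq_AE)
      show "AE x in lborel. (x \<in> ?A) = (x \<in> ?A \<inter> {\<omega>1<..<\<omega>2})"
        using AE_lborel_singleton[of \<omega>1] AE_lborel_singleton[of \<omega>2] by eventually_elim auto
    qed (use tp(1) in auto)
    have "bounded (few_reflections \<epsilon> y \<inter> {\<omega>1..<\<omega>2})" by (rule bounded_subset[OF bounded_closed_interval[of \<omega>1 \<omega>2]]) auto
    then have "few_reflections \<epsilon> y \<inter> {\<omega>1..<\<omega>2} \<in> fmeasurable lborel"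
      using few_meas emeasure_bounded_finite[of "few_reflections \<epsilon> y \<inter> {\<omega>1..<\<omega>2}"] by (intro fmeasurableI) auto
    then have AM: "measure lborel ?A \<le> ?M" unfolding Aeq using sub tp(1) by (intro measure_mono_fmeasurable) auto
    have uv: "v \<le> \<eta> * real T + \<rho>"
    proof -
      define g1 where "g1 = c1 * (1 + t2)"
      have "g1 - g = (c1 - c) * (1 + t2) + c * (t2 - t)" by (simp add: g g1_def algebra_simps)
      also have "\<dots> \<le> d * 2 + 1 * (5 / 2 * d)" using diffs cb tb d by (intro add_mono mult_mono) auto
      finally have gg: "g1 - g \<le> 9 / 2 * d" by simp
      have "g \<le> g1" unfolding g g1_def using diffs cb tb by (intro mult_mono) auto
      then have g1: "1 \<le> g1" using g by simp
      have "\<epsilon> * (y / \<epsilon> - 1) = y - \<epsilon>" using \<epsilon> by (simp add: right_diff_distrib)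
      then have "(y - \<epsilon>) / g1 = \<epsilon> / c1 * a" by (simp add: g1_def a_def)
      then have "(y - \<epsilon>) / g1 - \<epsilon> / c1 = \<epsilon> / c1 * (a - 1)" by (simp only: right_diff_distrib mult_1_right)
      also have "\<dots> \<le> \<eta> * real T" unfolding \<eta>_def using Tge cb \<epsilon> by (intro mult_left_mono) auto
      finally have 1: "(y - \<epsilon>) / g1 - \<epsilon> / c1 \<le> \<eta> * real T" .
      have 2: "v = (y - \<epsilon>) / g1 + \<epsilon> / g1 + y * (g1 - g) / (g * g1)"
      proof -
        have "g \<noteq> 0" "g1 \<noteq> 0" using g g1 by auto
        then show ?thesis by (simp add: v_def field_simps)
      qed
      have "y * (g1 - g) / (g * g1) \<le> 3 * (9 / 2 * d) / (1 * 1)"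
        using y gg g g1 \<open>g \<le> g1\<close> d by (intro frac_le mult_mono) auto
      moreover have "\<epsilon> / g1 \<le> \<epsilon> / 1" using g1 \<epsilon> by (intro divide_left_mono) auto
      moreover have "\<epsilon> / c1 \<le> 2 * \<epsilon>" using \<eta>(2) by (simp add: \<eta>_def)
      ultimately show ?thesis using 1 2 d \<epsilon> unfolding \<rho>_def by argo
    qed
    then have h: "hit_cdf v \<le> hit_cdf (\<eta> * real T) + 2 * \<rho>" using \<eta> v0 \<rho>0 by (intro hit_cdf_shift) auto
    have h0: "0 \<le> hit_cdf (\<eta> * real T)" and h1: "hit_cdf (\<eta> * real T) \<le> 1"
      using \<eta> by (auto intro!: hit_cdf_le_1 hit_cdf_nonneg)
    have "d * hit_cdf v \<le> d * (hit_cdf (\<eta> * real T) + 2 * \<rho>)" using h d by (intro mult_left_mono) auto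
    moreover have "5 * d\<^sup>2 * hit_cdf (\<eta> * real T) \<le> 5 * d\<^sup>2 * 1" using h1 by (intro mult_left_mono) auto
    ultimately have "d * hit_cdf v - 45 * d\<^sup>2 - 10 * d * \<epsilon> - 2 * E \<le> (d - 5 * d\<^sup>2) * hit_cdf (\<eta> * real T) - 1 * (2 * E)"
      by (simp add: \<rho>_def power2_eq_square algebra_simps)
    also have "\<dots> \<le> (c2\<^sup>2 * (t2 - t1)) * hit_cdf (\<eta> * real T) - c2\<^sup>2 * (2 * E)"
    proof (intro diff_mono mult_right_mono low_len h0)
      have "c2\<^sup>2 \<le> 1\<^sup>2" using cb by (intro power_mono) auto
      then show "c2\<^sup>2 \<le> 1" by simp
    qed (use E0 in simp)
    also have "\<dots> = c2\<^sup>2 * ((t2 - t1) * hit_cdf (\<eta> * real T) - 2 * E)" by (simp add: algebra_simps)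
    also have "\<dots> \<le> c2\<^sup>2 * measure lborel (near T \<eta> \<inter> {t1..t2})"
    proof (intro mult_left_mono)
      have "\<bar>measure lborel (near T \<eta> \<inter> {t1..t2}) - (t2 - t1) * hit_cdf (\<eta> * real T)\<bar> \<le> 2 * (C * \<eta> * real T powr e)"
        by (rule measure_near_interval[OF equi \<eta>(1) tb(1) t12 tb(4)])
      also have "\<dots> \<le> 2 * E" using errE[OF \<eta> T6] by simp
      finally show "(t2 - t1) * hit_cdf (\<eta> * real T) - 2 * E \<le> measure lborel (near T \<eta> \<inter> {t1..t2})" by linarith
    qed simp
    also have "\<dots> \<le> measure lborel ?A" using tp(2) by (simp add: c2_def t1_def t2_def)
    finally show ?thesis using AM by linarith
  qed
  show ?thesis using upper lower unfolding v_def g_def by linarith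
qed

lemma continuous_on_hit_cdf: "continuous_on {0..M} hit_cdf"
  using hit_cdf_deriv by (intro DERIV_continuous_on) auto

lemma continuous_on_limit_law:
  assumes "0 \<le> y" "y \<le> 3"
  shows "continuous_on {0..pi / 4} (\<lambda>\<omega>. hit_cdf (y / (sin \<omega> + cos \<omega>)))"
proof (rule continuous_on_compose2[OF continuous_on_hit_cdf[of 3]])
  have g: "1 \<le> sin \<omega> + cos \<omega>" if "\<omega> \<in> {0..pi / 4}" for \<omega>
    using octant_closed_facts(6)[of \<omega>] that by simp
  show "continuous_on {0..pi / 4} (\<lambda>\<omega>. y / (sin \<omega> + cos \<omega>))"
    by (intro continuous_intros) (use g in force)
  show "(\<lambda>\<omega>. y / (sin \<omega> + cos \<omega>)) ` {0..pi / 4} \<subseteq> {0..3}"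
  proof
    fix u assume "u \<in> (\<lambda>\<omega>. y / (sin \<omega> + cos \<omega>)) ` {0..pi / 4}"
    then obtain \<omega> where \<omega>: "\<omega> \<in> {0..pi / 4}" "u = y / (sin \<omega> + cos \<omega>)" by blast
    have "y / (sin \<omega> + cos \<omega>) \<le> 3 / 1" using assms g[OF \<omega>(1)] by (intro frac_le) auto
    then show "u \<in> {0..3}" using \<omega> assms g[OF \<omega>(1)] by simp
  qed
qed

text \<open>With \<open>M\<close> pieces of length \<open>d \<le> 1 / M\<close>, the terms \<open>d\<^sup>2\<close> of \<open>few_reflections_piece\<close> add up to
  \<open>O(1 / M)\<close> and the terms \<open>E = O(\<epsilon> powr (1/4 - \<delta>))\<close> to \<open>M E\<close>. The choice \<open>M = \<epsilon> powr (-1/8)\<close> balances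
  the two.\<close>

theorem distribution_of_reflections:
  fixes \<delta> :: real
  assumes "0 < \<delta>"
  obtains C where "C > 0" "\<And>\<epsilon> y \<alpha> \<beta>. 0 < \<epsilon> \<Longrightarrow> \<epsilon> \<le> 1 / 8 \<Longrightarrow> 0 \<le> y \<Longrightarrow> y \<le> 3 \<Longrightarrow> 0 \<le> \<alpha> \<Longrightarrow> \<alpha> < \<beta> \<Longrightarrow> \<beta> \<le> pi / 4 \<Longrightarrow>
    \<bar>measure lborel (few_reflections \<epsilon> y \<inter> {\<alpha>..<\<beta>}) - integral {\<alpha>..\<beta>} (\<lambda>\<omega>. hit_cdf (y / (sin \<omega> + cos \<omega>)))\<bar> \<le> C * \<epsilon> powr (1 / 8 - \<delta>)"
proof -
  define e where "e = 3 / 4 + \<delta>"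
  have e: "e > 0" using assms by (simp add: e_def)
  obtain C where C: "C > 0" and equi: "\<And>T \<eta> b. 0 \<le> \<eta> \<Longrightarrow> 0 \<le> b \<Longrightarrow> b \<le> 1 \<Longrightarrow>
      \<bar>measure lborel (near T \<eta> \<inter> {0..<b}) - b * hit_cdf (\<eta> * real T)\<bar> \<le> C * \<eta> * real T powr e"
    using near_equidistributed[OF assms] unfolding e_def by blast
  have "\<bar>measure lborel (few_reflections \<epsilon> y \<inter> {\<alpha>..<\<beta>}) - integral {\<alpha>..\<beta>} (\<lambda>\<omega>. hit_cdf (y / (sin \<omega> + cos \<omega>)))\<bar> \<le> (55 + 8 * C * 6 powr e) * \<epsilon> powr (1 / 8 - \<delta>)"
    if \<epsilon>: "0 < \<epsilon>" "\<epsilon> \<le> 1 / 8" and y: "0 \<le> y" "y \<le> 3" and I: "0 \<le> \<alpha>" "\<alpha> < \<beta>" "\<beta> \<le> pi / 4" for \<epsilon> y \<alpha> \<beta>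
  proof -
    let ?V = "\<lambda>\<omega>. hit_cdf (y / (sin \<omega> + cos \<omega>))" and ?P = "few_reflections \<epsilon> y"
    define E where "E = C * (2 * \<epsilon>) * (6 / \<epsilon>) powr e"
    define M where "M = nat \<lceil>\<epsilon> powr (- 1 / 8)\<rceil>"
    define d where "d = (\<beta> - \<alpha>) / real M"
    define err where "err = 45 * d\<^sup>2 + 10 * d * \<epsilon> + 2 * E"
    have em: "1 \<le> \<epsilon> powr (- 1 / 8)" using \<epsilon> powr_mono'[of "- 1 / 8" 0 \<epsilon>] by simp
    have Mge: "\<epsilon> powr (- 1 / 8) \<le> real M" by (simp add: M_def real_nat_ceiling_ge)
    then have M1: "1 \<le> real M" using em by linarith
    have Mle: "real M \<le> 2 * \<epsilon> powr (- 1 / 8)" using em unfolding M_def by linarith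
    have d: "0 < d" "real M * d = \<beta> - \<alpha>" "real M * d \<le> 1" using I M1 pi_less_4 by (simp_all add: d_def)
    have int: "?V integrable_on {a..b}" if "0 \<le> a" "b \<le> pi / 4" for a b
      by (rule integrable_continuous_real, rule continuous_on_subset[OF continuous_on_limit_law[OF y]]) (use that in auto)
    have piece: "\<bar>measure lborel (?P \<inter> {a..<a + d}) - integral {a..a + d} ?V\<bar> \<le> err" if a: "0 \<le> a" "a + d \<le> pi / 4" for a
    proof -
      let ?m = "measure lborel (?P \<inter> {a..<a + d})"
      have "((\<lambda>\<omega>. ?m - d * ?V \<omega>) has_integral (measure lborel {a..a + d} *\<^sub>R ?m - d * integral {a..a + d} ?V)) {a..a + d}"
        by (intro has_integral_diff has_integral_const_real has_integral_mult_right integrable_integral int a)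
      moreover have "norm (?m - d * ?V \<omega>) \<le> err" if "\<omega> \<in> {a..a + d}" for \<omega>
        using few_reflections_piece[OF equi C e \<epsilon> y a(1) _ a(2), of \<omega>] that d by (simp add: err_def E_def)
      moreover have "0 \<le> err" using d \<epsilon> C by (simp add: err_def E_def)
      ultimately have "norm (measure lborel {a..a + d} *\<^sub>R ?m - d * integral {a..a + d} ?V) \<le> err * measure lborel {a..a + d}"
        by (intro has_integral_bound_real) auto
      then have "\<bar>d * (?m - integral {a..a + d} ?V)\<bar> \<le> err * d" using d by (simp add: right_diff_distrib)
      then show ?thesis using d by (simp add: abs_mult)
    qed
    have fin: "emeasure lborel (?P \<inter> {a..<b}) \<noteq> \<infinity>" for a b
    proof -
      have "bounded (?P \<inter> {a..<b})" by (rule bounded_subset[OF bounded_closed_interval[of a b]]) auto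
      then show ?thesis using emeasure_bounded_finite[of "?P \<inter> {a..<b}"] by simp
    qed
    have few_meas: "?P \<in> sets borel" by (rule few_reflections_measurable[OF \<epsilon>])
    have ind: "\<bar>measure lborel (?P \<inter> {\<alpha>..<\<alpha> + real k * d}) - integral {\<alpha>..\<alpha> + real k * d} ?V\<bar> \<le> real k * err" if "k \<le> M" for k
      using that
    proof (induction k)
      case (Suc k)
      let ?a = "\<alpha> + real k * d"
      have ab: "\<alpha> + real (Suc k) * d = ?a + d" by (simp add: algebra_simps)
      have "real (Suc k) * d \<le> real M * d" using Suc.prems d by (intro mult_right_mono) auto
      then have le: "?a + d \<le> pi / 4" using d I ab by linarith
      have a: "\<alpha> \<le> ?a" using d by simp
      have un: "?P \<inter> {\<alpha>..<?a + d} = (?P \<inter> {\<alpha>..<?a}) \<union> (?P \<inter> {?a..<?a + d})"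
        unfolding Int_Un_distrib[symmetric] using ivl_disj_un_two(3)[OF a, of "?a + d"] d by simp
      have "measure lborel (?P \<inter> {\<alpha>..<?a + d}) = measure lborel (?P \<inter> {\<alpha>..<?a}) + measure lborel (?P \<inter> {?a..<?a + d})"
        unfolding un by (rule measure_Union) (use fin few_meas in auto)
      moreover have "integral {\<alpha>..?a} ?V + integral {?a..?a + d} ?V = integral {\<alpha>..?a + d} ?V"
        by (rule Henstock_Kurzweil_Integration.integral_combine) (use a d int I le in auto)
      moreover have "\<bar>measure lborel (?P \<inter> {?a..<?a + d}) - integral {?a..?a + d} ?V\<bar> \<le> err"
        by (rule piece) (use a I le in auto)
      moreover have "\<bar>measure lborel (?P \<inter> {\<alpha>..<?a}) - integral {\<alpha>..?a} ?V\<bar> \<le> real k * err" using Suc by simp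
      moreover have "real (Suc k) * err = real k * err + err" by (simp add: algebra_simps)
      ultimately show ?case unfolding ab by linarith
    qed simp
    have "\<bar>measure lborel (?P \<inter> {\<alpha>..<\<beta>}) - integral {\<alpha>..\<beta>} ?V\<bar> \<le> real M * err"
      using ind[OF order_refl] d by simp
    also have "real M * err = 45 * (real M * d) * d + 10 * (real M * d) * \<epsilon> + 2 * E * real M"
      by (simp add: err_def power2_eq_square algebra_simps)
    also have "\<dots> \<le> 45 * 1 * \<epsilon> powr (1 / 8) + 10 * 1 * \<epsilon> powr (1 / 8) + 2 * E * (2 * \<epsilon> powr (- 1 / 8))"
    proof (intro add_mono mult_mono mult_left_mono)
      have "d \<le> 1 / real M" using d M1 by (simp add: field_simps)
      also have "\<dots> \<le> 1 / \<epsilon> powr (- 1 / 8)" using Mge M1 \<epsilon> by (intro divide_left_mono) auto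
      also have "\<dots> = \<epsilon> powr (1 / 8)" using \<epsilon> by (simp add: powr_minus_divide)
      finally show "d \<le> \<epsilon> powr (1 / 8)" .
      have "\<epsilon> powr 1 \<le> \<epsilon> powr (1 / 8)" using \<epsilon> by (intro powr_mono') auto
      then show "\<epsilon> \<le> \<epsilon> powr (1 / 8)" using \<epsilon> by simp
    qed (use d \<epsilon> Mle C I in \<open>auto simp: E_def\<close>)
    also have "\<dots> = 55 * \<epsilon> powr (1 / 8) + 4 * E * \<epsilon> powr (- 1 / 8)" by simp
    also have "\<dots> \<le> 55 * \<epsilon> powr (1 / 8 - \<delta>) + 8 * C * 6 powr e * \<epsilon> powr (1 / 8 - \<delta>)"
    proof (intro add_mono)
      have "\<epsilon> powr (1 / 8) \<le> \<epsilon> powr (1 / 8 - \<delta>)" using \<epsilon> assms by (intro powr_mono') auto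
      then show "55 * \<epsilon> powr (1 / 8) \<le> 55 * \<epsilon> powr (1 / 8 - \<delta>)" by simp
      have "4 * E * \<epsilon> powr (- 1 / 8) = 8 * C * 6 powr e * (\<epsilon> powr 1 * \<epsilon> powr (- e) * \<epsilon> powr (- 1 / 8))"
        using \<epsilon> by (simp add: E_def powr_divide powr_minus_divide)
      also have "\<epsilon> powr 1 * \<epsilon> powr (- e) * \<epsilon> powr (- 1 / 8) = \<epsilon> powr (1 + - e + - 1 / 8)"
        by (simp only: powr_add)
      also have "1 + - e + - 1 / 8 = 1 / 8 - \<delta>" by (simp add: e_def)
      finally show "4 * E * \<epsilon> powr (- 1 / 8) \<le> 8 * C * 6 powr e * \<epsilon> powr (1 / 8 - \<delta>)" by simp
    qed
    also have "\<dots> = (55 + 8 * C * 6 powr e) * \<epsilon> powr (1 / 8 - \<delta>)" by (simp add: distrib_right)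
    finally show ?thesis .
  qed
  moreover have "55 + 8 * C * 6 powr e > 0" using C by (intro add_pos_nonneg) auto
  ultimately show thesis using that by blast
qed

section \<open>The moment constant\<close>

definition hit_moment :: "real \<Rightarrow> real \<Rightarrow> real" where
  "hit_moment r x = integral {0..x} (\<lambda>u. u powr r * hit_density u)"

lemma continuous_on_moment_integrand:
  assumes "r > 0" shows "continuous_on {0..M} (\<lambda>u. u powr r * hit_density u)"
  by (intro continuous_on_mult continuous_on_hit_density continuous_on_powr') (use assms in \<open>auto intro!: continuous_intros\<close>)

lemma hit_moment_deriv:
  assumes "r > 0" "0 < x"
  shows "(hit_moment r has_real_derivative x powr r * hit_density x) (at x)"
proof -
  have "(hit_moment r has_real_derivative x powr r * hit_density x) (at x within {0..x + 1})"
    unfolding hit_moment_def[abs_def]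
    by (rule integral_has_real_derivative[OF continuous_on_moment_integrand[OF assms(1)]]) (use assms in auto)
  then show ?thesis using assms(2) by (simp add: at_within_Icc_at)
qed

lemma continuous_on_hit_moment: "r > 0 \<Longrightarrow> continuous_on {0..M} (hit_moment r)"
  unfolding hit_moment_def[abs_def]
  by (intro indefinite_integral_continuous_1 integrable_continuous_real continuous_on_moment_integrand)

lemma hit_moment_ge_1:
  assumes "r > 0" "x \<ge> 1" shows "hit_moment r x = hit_moment r 1"
proof -
  let ?f = "\<lambda>u. u powr r * hit_density u"
  have i: "?f integrable_on {c..d}" if "0 \<le> c" for c d
    by (rule integrable_continuous_real, rule continuous_on_subset[OF continuous_on_moment_integrand[OF assms(1), of d]]) (use that in auto)
  have "integral {0..1} ?f + integral {1..x} ?f = integral {0..x} ?f"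
    by (rule Henstock_Kurzweil_Integration.integral_combine) (use assms i in auto)
  moreover have "integral {1..x} ?f = integral {1..x} (\<lambda>_. 0)"
    by (rule integral_cong) (simp add: hit_density_ge_1)
  ultimately show ?thesis by (simp add: hit_moment_def)
qed

lemma hit_cdf_deriv_at:
  assumes "0 < x" shows "(hit_cdf has_real_derivative hit_density x) (at x)"
  using hit_cdf_deriv[of x "x + 1"] assms by (simp add: at_within_Icc_at)

text \<open>The upper half of the unit interval in the reflected variable, as it enters \<open>moment_const\<close>.\<close>

lemma hit_density_upper:
  assumes "0 < x" "x \<le> 1 / 2"
  shows "hit_density (1 - x) = 12 / pi ^ 2 * (x / (1 - x) * (1 - ln (x / (1 - x))))"
proof -
  have "max (1 - x) (1 / 2) = 1 - x" using assms by simp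
  moreover have "1 / (1 - x) - 1 = x / (1 - x)" using assms by (simp add: field_simps)
  moreover have "max 0 (x / (1 - x)) = x / (1 - x)" using assms by simp
  ultimately show ?thesis by (simp only: hit_density_def entropy_fun_def)
qed

text \<open>In \<open>\<integral>\<^sub>0\<^sup>1 u\<^sup>r hit_density u du\<close> the halves \<open>u = x\<close> and \<open>u = 1 - x\<close> are folded together onto
  \<open>0 \<le> x \<le> 1/2\<close>. The logarithm in the second half is removed by an integration by parts, since
  \<open>K(x) = (1 - (1-x)\<^sup>r) / r - (1 - (1-x)\<^bsup>r+1\<^esup>) / (r+1)\<close> has the derivative \<open>x (1-x)\<^bsup>r-1\<^esup>\<close> and
  \<open>ln (x / (1-x))\<close> the derivative \<open>1 / (x (1-x))\<close>. Altogether the integrand of \<open>moment_const\<close>, without the factor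
  \<open>12/\<pi>\<^sup>2\<close>, has the antiderivative \<open>G\<close> below; the boundary terms of \<open>K(x) ln (x / (1-x))\<close> vanish.\<close>

lemma moment_const_eq:
  assumes r: "r > 0" shows "moment_const r = hit_moment r 1"
proof -
  let ?K = "\<lambda>x. (1 - (1 - x) powr r) / r - (1 - (1 - x) powr (r + 1)) / (r + 1)"
  let ?l = "\<lambda>x::real. ln (x / (1 - x))"
  let ?f = "\<lambda>x. x * (x powr (r - 1) + (1 - x) powr (r - 1))
      + (1 - (1 - x) powr r) / (r * x * (1 - x))
      - (1 - (1 - x) powr (r + 1)) / ((r + 1) * x * (1 - x))"
  let ?G = "\<lambda>x. pi ^ 2 / 12 * (hit_moment r x - hit_moment r (1 - x)) + ?K x * ?l x"
  have G_cont: "continuous_on {0..1 / 2} ?G"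
  proof (rule continuous_on_add)
    have "continuous_on {0..1 / 2} (\<lambda>x. hit_moment r (1 - x))"
      by (rule continuous_on_compose2[OF continuous_on_hit_moment[OF r, of 1]]) (auto intro!: continuous_intros)
    then show "continuous_on {0..1 / 2} (\<lambda>x. pi ^ 2 / 12 * (hit_moment r x - hit_moment r (1 - x)))"
      by (intro continuous_on_mult continuous_on_const continuous_on_diff continuous_on_hit_moment[OF r])
    show "continuous_on {0..1 / 2} (\<lambda>x. ?K x * ?l x)"
      unfolding continuous_on_def
    proof
      fix x :: real assume x: "x \<in> {0..1 / 2}"
      show "((\<lambda>x. ?K x * ?l x) \<longlongrightarrow> ?K x * ?l x) (at x within {0..1 / 2})"
      proof (cases "x = 0")
        case True
        have "((\<lambda>x. ?K x * ?l x) \<longlongrightarrow> 0) (at_right 0)" using r by real_asymp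
        then have "((\<lambda>x. ?K x * ?l x) \<longlongrightarrow> 0) (at 0 within {0..1 / 2})"
          by (simp add: at_within_Icc_at_right)
        then show ?thesis using True by simp
      next
        case False
        then have "isCont (\<lambda>x. ?K x * ?l x) x" using x r by (intro continuous_intros) auto
        then show ?thesis
          using continuous_at_imp_continuous_within unfolding continuous_within by blast
      qed
    qed
  qed
  have G_deriv: "(?G has_real_derivative ?f x) (at x)" if x: "0 < x" "x < 1 / 2" for x
  proof -
    have 1: "(hit_moment r has_real_derivative x powr r * (12 / pi ^ 2)) (at x)"
      using hit_moment_deriv[OF r, of x] x by (simp add: hit_density_le_half)
    have "(hit_moment r has_real_derivative (1 - x) powr r * hit_density (1 - x)) (at (1 - x))"
      using hit_moment_deriv[OF r, of "1 - x"] x by simp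
    then have 2: "((\<lambda>x. hit_moment r (1 - x)) has_real_derivative (1 - x) powr r * hit_density (1 - x) * (- 1)) (at x)"
      by (rule DERIV_chain2) (auto intro!: derivative_eq_intros)
    have 3: "(?K has_real_derivative x * (1 - x) powr (r - 1)) (at x)"
    proof -
      have pw: "((\<lambda>x. (1 - (1 - x) powr s) / s) has_real_derivative (1 - x) powr (s - 1)) (at x)" if "s > 0" for s
        using x that by (auto intro!: derivative_eq_intros)
      have "(?K has_real_derivative (1 - x) powr (r - 1) - (1 - x) powr r) (at x)"
        using DERIV_diff[OF pw[of r] pw[of "r + 1"]] r by simp
      moreover have "(1 - x) powr r = (1 - x) * (1 - x) powr (r - 1)"
        using x by (simp add: powr_mult_base)
      ultimately show ?thesis by (simp add: algebra_simps)
    qed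
    have 4: "(?l has_real_derivative 1 / (x * (1 - x))) (at x)"
    proof -
      have "((\<lambda>x::real. x / (1 - x)) has_real_derivative (1 * (1 - x) - x * (- 1)) / ((1 - x) * (1 - x))) (at x)"
        using x by (intro DERIV_divide) (auto intro!: derivative_eq_intros)
      then have "(?l has_real_derivative 1 / (x / (1 - x)) * ((1 * (1 - x) - x * (- 1)) / ((1 - x) * (1 - x)))) (at x)"
        using x by (intro DERIV_chain2[OF DERIV_ln_divide]) auto
      moreover have "1 / (x / (1 - x)) * ((1 * (1 - x) - x * (- 1)) / ((1 - x) * (1 - x))) = 1 / (x * (1 - x))"
        using x by simp
      ultimately show ?thesis by (simp only:)
    qed
    have "(?G has_real_derivative pi ^ 2 / 12 * (x powr r * (12 / pi ^ 2) - (1 - x) powr r * hit_density (1 - x) * (- 1)) +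
        (x * (1 - x) powr (r - 1) * ?l x + 1 / (x * (1 - x)) * ?K x)) (at x)"
      by (intro DERIV_add DERIV_cmult DERIV_diff DERIV_mult 1 2 3 4)
    moreover have "pi ^ 2 / 12 * (x powr r * (12 / pi ^ 2) - (1 - x) powr r * hit_density (1 - x) * (- 1)) +
        (x * (1 - x) powr (r - 1) * ?l x + 1 / (x * (1 - x)) * ?K x) = ?f x"
    proof -
      have a: "(1 - x) powr r = (1 - x) * (1 - x) powr (r - 1)" "x powr r = x * x powr (r - 1)"
        using x by (simp_all add: powr_mult_base)
      have hd: "hit_density (1 - x) = 12 / pi ^ 2 * (x / (1 - x) * (1 - ?l x))" using x by (intro hit_density_upper) auto
      have alg: "pi ^ 2 / 12 * (u * (12 / pi ^ 2) - v * (12 / pi ^ 2 * w) * (- 1)) = u + v * w" for u v w :: real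
        by (simp add: field_simps)
      have "pi ^ 2 / 12 * (x powr r * (12 / pi ^ 2) - (1 - x) powr r * hit_density (1 - x) * (- 1)) =
          x powr r + (1 - x) powr r * (x / (1 - x) * (1 - ?l x))"
        unfolding hd by (rule alg)
      also have "(1 - x) powr r * (x / (1 - x) * (1 - ?l x)) = x * (1 - x) powr (r - 1) * (1 - ?l x)"
        unfolding a(1) using x by simp
      finally have b: "pi ^ 2 / 12 * (x powr r * (12 / pi ^ 2) - (1 - x) powr r * hit_density (1 - x) * (- 1)) =
          x * x powr (r - 1) + x * (1 - x) powr (r - 1) * (1 - ?l x)" unfolding a(2) .
      have c: "1 / (x * (1 - x)) * ?K x = (1 - (1 - x) powr r) / (r * x * (1 - x)) - (1 - (1 - x) powr (r + 1)) / ((r + 1) * x * (1 - x))"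
      proof -
        have "1 / (x * w) * (u / r - v / s) = u / (r * x * w) - v / (s * x * w)" for u v w s :: real
          by (simp add: diff_divide_distrib mult_ac)
        then show ?thesis .
      qed
      show ?thesis unfolding b c by (simp add: algebra_simps)
    qed
    ultimately show ?thesis by simp
  qed
  have "(?f has_integral (?G (1 / 2) - ?G 0)) {0..1 / 2}"
  proof (rule fundamental_theorem_of_calculus_interior[OF _ G_cont])
    fix x :: real assume "x \<in> {0<..<1 / 2}"
    then show "(?G has_vector_derivative ?f x) (at x)"
      using G_deriv[of x] by (simp only: has_real_derivative_iff_has_vector_derivative greaterThanLessThan_iff)
  qed simp
  moreover have "?G (1 / 2) - ?G 0 = pi ^ 2 / 12 * hit_moment r 1" by (simp add: hit_moment_def)
  ultimately have HK: "(?f has_integral (pi ^ 2 / 12 * hit_moment r 1)) {0..1 / 2}" by (simp only:)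
  have f_cont: "continuous_on {0..1 / 2} ?f"
    unfolding continuous_on_def
  proof
    fix x :: real assume x: "x \<in> {0..1 / 2}"
    show "(?f \<longlongrightarrow> ?f x) (at x within {0..1 / 2})"
    proof (cases "x = 0")
      case True
      have lim: "((\<lambda>x::real. (1 - (1 - x) powr s) / (s * x * (1 - x))) \<longlongrightarrow> 1) (at_right 0)" if "s > 0" for s
        using that by real_asymp
      have "((\<lambda>x::real. x powr r) \<longlongrightarrow> 0) (at_right 0)" "((\<lambda>x::real. x * (1 - x) powr (r - 1)) \<longlongrightarrow> 0) (at_right 0)"
        using r by real_asymp+
      then have "((\<lambda>x. x powr r + x * (1 - x) powr (r - 1) + (1 - (1 - x) powr r) / (r * x * (1 - x))
          - (1 - (1 - x) powr (r + 1)) / ((r + 1) * x * (1 - x))) \<longlongrightarrow> 0 + 0 + 1 - 1) (at_right 0)"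
        using r by (intro tendsto_add tendsto_diff lim) auto
      moreover have "\<forall>\<^sub>F x in at_right 0. x powr r + x * (1 - x) powr (r - 1) + (1 - (1 - x) powr r) / (r * x * (1 - x))
          - (1 - (1 - x) powr (r + 1)) / ((r + 1) * x * (1 - x)) = ?f x"
        using eventually_at_right_less[of "0 :: real"]
        by eventually_elim (simp add: distrib_left powr_mult_base)
      ultimately have "(?f \<longlongrightarrow> 0) (at_right 0)" by (simp add: tendsto_cong)
      then have "(?f \<longlongrightarrow> 0) (at 0 within {0..1 / 2})"
        by (simp add: at_within_Icc_at_right)
      then show ?thesis using True by simp
    next
      case False
      then have "isCont ?f x" using x r by (intro continuous_intros) auto
      then show ?thesis
        using continuous_at_imp_continuous_within unfolding continuous_within by blast
    qed
  qed
  have "set_integrable lborel {0..1 / 2} ?f"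
    by (rule borel_integrable_atLeastAtMost'[OF f_cont])
  then have "(LINT x:{0..1 / 2}|lborel. ?f x) = integral {0..1 / 2} ?f"
    by (rule set_borel_integral_eq_integral(2))
  also have "\<dots> = pi ^ 2 / 12 * hit_moment r 1" using HK by (rule integral_unique)
  finally have e: "(LINT x:{0..1 / 2}|lborel. ?f x) = pi ^ 2 / 12 * hit_moment r 1" .
  show ?thesis unfolding moment_const_def e by simp
qed

text \<open>An antiderivative in \<open>z\<close> is \<open>z F(x) - g\<^sup>r \<integral>\<^sub>0\<^sup>x u\<^sup>r dF(u)\<close> with \<open>F = hit_cdf\<close> and \<open>x = z powr (1/r) / g\<close>,
  because \<open>g\<^sup>r x\<^sup>r = z\<close>. At the upper end \<open>x \<ge> 1\<close>, where \<open>F\<close> and the moment have reached their final values.\<close>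

lemma layer_cake_limit:
  assumes r: "r > 0" and g: "1 \<le> g" "g \<le> 3"
  shows "((\<lambda>z. hit_cdf (z powr (1 / r) / g)) has_integral (3 powr r - g powr r * hit_moment r 1)) {0..3 powr r}"
proof -
  let ?x = "\<lambda>z. z powr (1 / r) / g"
  let ?A = "\<lambda>z. z * hit_cdf (?x z) - g powr r * hit_moment r (?x z)"
  have xle: "?x z \<in> {0..3}" if "z \<in> {0..3 powr r}" for z
  proof -
    have "z powr (1 / r) \<le> (3 powr r) powr (1 / r)" using that r by (intro powr_mono2) auto
    then have "z powr (1 / r) \<le> 3" using r by (simp add: powr_powr)
    then have "z powr (1 / r) / g \<le> 3 / 1" using g by (intro frac_le) auto
    then show ?thesis using g by simp
  qed
  have x_cont: "continuous_on {0..3 powr r} ?x"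
    by (intro continuous_on_divide continuous_on_powr' continuous_on_id continuous_on_const) (use r g in auto)
  have "((\<lambda>z. hit_cdf (?x z)) has_integral (?A (3 powr r) - ?A 0)) {0..3 powr r}"
  proof (rule fundamental_theorem_of_calculus_interior)
    show "continuous_on {0..3 powr r} ?A"
      by (intro continuous_on_diff continuous_on_mult continuous_on_id continuous_on_const
           continuous_on_compose2[OF continuous_on_hit_cdf[of 3] x_cont]
           continuous_on_compose2[OF continuous_on_hit_moment[OF r, of 3] x_cont]) (use xle in auto)
    fix z assume "z \<in> {0<..<3 powr r}"
    then have z: "z > 0" by simp
    have x0: "?x z > 0" using z g by simp
    define D where "D = (1 / r) * z powr (1 / r - 1) / g"
    have dx: "(?x has_real_derivative D) (at z)"
      using z g unfolding D_def by (auto intro!: derivative_eq_intros)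
    have "(?A has_real_derivative (1 * hit_cdf (?x z) + hit_density (?x z) * D * z) - g powr r * (?x z powr r * hit_density (?x z) * D)) (at z)"
      by (intro DERIV_diff DERIV_mult DERIV_cmult DERIV_ident DERIV_chain2[OF hit_cdf_deriv_at[OF x0] dx]
            DERIV_chain2[OF hit_moment_deriv[OF r x0] dx])
    moreover have gx: "g powr r * ?x z powr r = z"
    proof -
      have "?x z powr r = z powr (1 / r * r) / g powr r" using z g by (simp only: powr_divide powr_powr)
      then show ?thesis using r z g by simp
    qed
    have "(1 * hit_cdf (?x z) + hit_density (?x z) * D * z) - g powr r * (?x z powr r * hit_density (?x z) * D) = hit_cdf (?x z)"
    proof -
      have e: "g powr r * (?x z powr r * hit_density (?x z) * D) = z * (hit_density (?x z) * D)"
        by (simp only: mult.assoc[symmetric] gx)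
      show ?thesis unfolding e by (simp add: mult_ac)
    qed
    ultimately have "(?A has_real_derivative hit_cdf (?x z)) (at z)" by (simp only:)
    then show "(?A has_vector_derivative hit_cdf (?x z)) (at z)"
      by (simp only: has_real_derivative_iff_has_vector_derivative)
  qed simp
  moreover have "?A (3 powr r) - ?A 0 = 3 powr r - g powr r * hit_moment r 1"
  proof -
    have x3: "(3 powr r) powr (1 / r) = (3 :: real)" using r by (simp add: powr_powr)
    have "3 / g \<ge> 1" using g by simp
    then have "?A (3 powr r) = 3 powr r - g powr r * hit_moment r 1"
      unfolding x3 using hit_cdf_ge_1[of "3 / g"] hit_moment_ge_1[OF r, of "3 / g"] by simp
    moreover have "?A 0 = 0" by (simp add: hit_moment_def)
    ultimately show ?thesis by simp
  qed
  ultimately show ?thesis by (simp only:)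
qed

lemma layer_cake_point:
  fixes X r :: real
  assumes r: "r > 0" and X: "0 \<le> X" "X \<le> 3"
  shows "((\<lambda>z. if X \<le> z powr (1 / r) then 1 else 0 :: real) has_integral (3 powr r - X powr r)) {0..3 powr r}"
proof -
  have Xr: "0 \<le> X powr r" "X powr r \<le> 3 powr r" using X r by (auto intro: powr_mono2)
  have "((\<lambda>z. 1 :: real) has_integral (measure lborel {X powr r..3 powr r} *\<^sub>R 1)) {X powr r..3 powr r}"
    by (rule has_integral_const_real)
  then have "((\<lambda>z. 1 :: real) has_integral (3 powr r - X powr r)) {X powr r..3 powr r}" using Xr by simp
  moreover have "{X powr r..3 powr r} \<subseteq> {0..3 powr r}" using Xr by auto
  ultimately have "((\<lambda>z. if z \<in> {X powr r..3 powr r} then 1 else 0 :: real) has_integral (3 powr r - X powr r)) {0..3 powr r}"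
    by (simp only: has_integral_restrict)
  moreover have "(if z \<in> {X powr r..3 powr r} then 1 else 0) = (if X \<le> z powr (1 / r) then 1 else 0 :: real)" if "z \<in> {0..3 powr r}" for z
  proof -
    have "X \<le> z powr (1 / r) \<longleftrightarrow> X powr r \<le> z"
    proof
      assume "X \<le> z powr (1 / r)"
      then have "X powr r \<le> (z powr (1 / r)) powr r" using X r by (intro powr_mono2) auto
      then show "X powr r \<le> z" using r that by (simp add: powr_powr)
    next
      assume "X powr r \<le> z"
      then have "(X powr r) powr (1 / r) \<le> z powr (1 / r)" using X r by (intro powr_mono2) auto
      then show "X \<le> z powr (1 / r)" using r X by (simp add: powr_powr)
    qed
    then show ?thesis using that by simp
  qed
  ultimately show ?thesis by (rule has_integral_eq[rotated]) simp
qed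

lemma hit_cdf_borel_measurable [measurable]: "hit_cdf \<in> borel_measurable borel"
proof (rule borel_measurable_mono)
  show "mono hit_cdf"
  proof (rule monoI)
    fix x y :: real assume xy: "x \<le> y"
    have neg: "hit_cdf u = 0" if "u < 0" for u using that by (simp add: hit_cdf_def)
    show "hit_cdf x \<le> hit_cdf y"
    proof (cases "x < 0")
      case True
      then show ?thesis using neg[of x] neg[of y] hit_cdf_nonneg[of y] by (cases "y < 0") auto
    next
      case False
      then show ?thesis using hit_cdf_diff(1)[of x y] xy by simp
    qed
  qed
qed

section \<open>Moments of the reflection count\<close>

text \<open>Both moments are written as integrals over \<open>z = y\<^sup>r\<close>, \<open>0 \<le> z \<le> 3\<^sup>r\<close>, of the corresponding distribution
  functions at the threshold \<open>y\<close>. In the variable \<open>z\<close> the integrand is bounded also for \<open>r < 1\<close>, so the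
  uniform bound \<open>B\<close> is just multiplied by the length of the range.\<close>

lemma moment_difference_bound:
  fixes r :: real
  assumes r: "r > 0" and \<epsilon>: "0 < \<epsilon>" "\<epsilon> \<le> 1 / 8" and I: "0 \<le> \<alpha>" "\<alpha> < \<beta>" "\<beta> \<le> pi / 4"
    and dist: "\<And>y. 0 \<le> y \<Longrightarrow> y \<le> 3 \<Longrightarrow>
      \<bar>measure lborel (few_reflections \<epsilon> y \<inter> {\<alpha>..<\<beta>}) - integral {\<alpha>..\<beta>} (\<lambda>\<omega>. hit_cdf (y / (sin \<omega> + cos \<omega>)))\<bar> \<le> B"
  shows "\<bar>\<epsilon> powr r * (LINT \<omega>:{\<alpha><..<\<beta>}|lborel. real (reflections \<epsilon> \<omega>) powr r)
      - moment_const r * (LINT x:{\<alpha><..<\<beta>}|lborel. (sin x + cos x) powr r)\<bar> \<le> 3 powr r * B"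
proof -
  define X where "X = (\<lambda>\<omega>. \<epsilon> * (if 0 < \<omega> \<and> \<omega> < pi / 4 then real (reflections \<epsilon> \<omega>) else 0))"
  have [measurable]: "X \<in> borel_measurable borel"
    unfolding X_def using borel_measurable_reflections[OF \<epsilon>] by (rule borel_measurable_times[OF borel_measurable_const])
  have [measurable]: "(\<lambda>\<omega>::real. cos \<omega>) \<in> borel_measurable borel" "(\<lambda>\<omega>::real. sin \<omega>) \<in> borel_measurable borel"
    by (intro borel_measurable_continuous_onI continuous_intros)+
  let ?g = "\<lambda>\<omega>::real. sin \<omega> + cos \<omega>" and ?J = "{\<alpha><..<\<beta>}" and ?Z = "{0..3 powr r}"
  have J: "0 < \<omega> \<and> \<omega> < pi / 4" if "\<omega> \<in> ?J" for \<omega> using that I by auto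
  have X: "X \<omega> = \<epsilon> * real (reflections \<epsilon> \<omega>)" "0 \<le> X \<omega>" "X \<omega> \<le> 3" if "\<omega> \<in> ?J" for \<omega>
    using J[OF that] trajectory_exits(2)[of \<omega> \<epsilon>] \<epsilon> by (auto simp: X_def mult.commute)
  have g: "1 \<le> ?g \<omega>" "?g \<omega> \<le> 2" if "\<omega> \<in> ?J" for \<omega>
    using octant_closed_facts(6,7)[of \<omega>] J[OF that] by auto
  \<comment> \<open>indicator of \<open>\<epsilon> R(\<omega>) \<le> y\<close> minus its limit law, for \<open>y = z powr (1 / r)\<close>\<close>
  define f where "f = (\<lambda>\<omega> z. indicator ?J \<omega> * (indicator ?Z z * ((if X \<omega> \<le> z powr (1 / r) then 1 else 0) - hit_cdf (z powr (1 / r) / ?g \<omega>))) :: real)"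
  have f_meas: "(\<lambda>(\<omega>, z). f \<omega> z) \<in> borel_measurable (lborel \<Otimes>\<^sub>M lborel)"
    unfolding f_def by measurable
  have cdf01: "0 \<le> hit_cdf (z powr (1 / r) / ?g \<omega>)" "hit_cdf (z powr (1 / r) / ?g \<omega>) \<le> 1" if "\<omega> \<in> ?J" for \<omega> z
    using g[OF that] by (auto intro!: hit_cdf_nonneg hit_cdf_le_1)
  have f_int: "integrable (lborel \<Otimes>\<^sub>M lborel) (\<lambda>(\<omega>, z). f \<omega> z)"
  proof (rule integrableI_bounded_set[where A = "?J \<times> ?Z" and B = 1])
    show "(\<lambda>(\<omega>, z). f \<omega> z) \<in> borel_measurable (lborel \<Otimes>\<^sub>M lborel)" by (rule f_meas)
    show "?J \<times> ?Z \<in> sets (lborel \<Otimes>\<^sub>M lborel)" by simp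
    show "emeasure (lborel \<Otimes>\<^sub>M lborel) (?J \<times> ?Z) < \<infinity>"
      using I by (subst lborel.emeasure_pair_measure_Times) (auto simp: ennreal_mult_less_top)
    show "AE p in lborel \<Otimes>\<^sub>M lborel. p \<in> ?J \<times> ?Z \<longrightarrow> norm (case p of (\<omega>, z) \<Rightarrow> f \<omega> z) \<le> 1"
    proof (intro AE_I2 impI)
      fix p :: "real \<times> real" assume p: "p \<in> ?J \<times> ?Z"
      obtain \<omega> z where pe: "p = (\<omega>, z)" by fastforce
      have "\<omega> \<in> ?J" using p pe by simp
      from cdf01[OF this, of z] show "norm (case p of (\<omega>, z) \<Rightarrow> f \<omega> z) \<le> 1"
        unfolding pe f_def prod.case by (auto simp: indicator_def)
    qed
    show "AE p in lborel \<Otimes>\<^sub>M lborel. p \<notin> ?J \<times> ?Z \<longrightarrow> (case p of (\<omega>, z) \<Rightarrow> f \<omega> z) = 0"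
      by (intro AE_I2) (auto simp: f_def indicator_def)
  qed
  have inner_z: "(LINT z|lborel. f \<omega> z) = indicator ?J \<omega> * (?g \<omega> powr r * moment_const r - X \<omega> powr r)" for \<omega>
  proof (cases "\<omega> \<in> ?J")
    case True
    let ?h = "\<lambda>z. (if X \<omega> \<le> z powr (1 / r) then 1 else 0) - hit_cdf (z powr (1 / r) / ?g \<omega>)"
    have hi: "(?h has_integral ((3 powr r - X \<omega> powr r) - (3 powr r - ?g \<omega> powr r * hit_moment r 1))) ?Z"
      using X[OF True] g[OF True] by (intro has_integral_diff layer_cake_point layer_cake_limit r) auto
    have "set_integrable lborel ?Z ?h"
      unfolding set_integrable_def
    proof (rule integrableI_bounded_set[where A = ?Z and B = 1])
      show "(\<lambda>z. indicator ?Z z *\<^sub>R ?h z) \<in> borel_measurable lborel" by measurable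
      show "AE z in lborel. z \<in> ?Z \<longrightarrow> norm (indicator ?Z z *\<^sub>R ?h z) \<le> 1"
      proof (intro AE_I2 impI)
        fix z show "norm (indicator ?Z z *\<^sub>R ?h z) \<le> 1"
          using cdf01[OF True, of z] by (auto simp: indicator_def)
      qed
    qed auto
    then have "(LINT z:?Z|lborel. ?h z) = integral ?Z ?h" by (rule set_borel_integral_eq_integral(2))
    also have "\<dots> = ?g \<omega> powr r * moment_const r - X \<omega> powr r"
      using integral_unique[OF hi] by (simp add: moment_const_eq[OF r])
    finally show ?thesis using True by (simp add: f_def set_lebesgue_integral_def)
  next
    case False
    then show ?thesis by (simp add: f_def)
  qed
  have inner_\<omega>: "\<bar>LINT \<omega>|lborel. f \<omega> z\<bar> \<le> indicator ?Z z * B" for z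
  proof (cases "z \<in> ?Z")
    case True
    define y where "y = z powr (1 / r)"
    have "z powr (1 / r) \<le> (3 powr r) powr (1 / r)" using True r by (intro powr_mono2) auto
    then have y: "0 \<le> y" "y \<le> 3" using r by (simp_all add: y_def powr_powr)
    let ?P = "few_reflections \<epsilon> y"
    let ?V = "\<lambda>\<omega>. hit_cdf (y / ?g \<omega>)"
    have P_meas: "?P \<in> sets borel" by (rule few_reflections_measurable[OF \<epsilon>])
    have PJ: "measure lborel (?P \<inter> ?J) = measure lborel (?P \<inter> {\<alpha>..<\<beta>})"
    proof (rule measure_eq_AE)
      show "AE x in lborel. (x \<in> ?P \<inter> ?J) = (x \<in> ?P \<inter> {\<alpha>..<\<beta>})"
        using AE_lborel_singleton[of \<alpha>] by eventually_elim auto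
    qed (use P_meas in auto)
    have finP: "emeasure lborel (?P \<inter> ?J) < \<infinity>"
      by (rule emeasure_bounded_finite, rule bounded_subset[OF bounded_closed_interval[of \<alpha> \<beta>]]) auto
    have V_cont: "continuous_on {\<alpha>..\<beta>} ?V"
      by (rule continuous_on_subset[OF continuous_on_limit_law[OF y]]) (use I in auto)
    have Vi: "set_integrable lborel {\<alpha>..\<beta>} ?V" by (rule borel_integrable_atLeastAtMost'[OF V_cont])
    then have ViJ: "set_integrable lborel ?J ?V" by (rule set_integrable_subset) auto
    have "(LINT \<omega>:?J|lborel. ?V \<omega>) = (LINT \<omega>:{\<alpha>..\<beta>}|lborel. ?V \<omega>)"
    proof (rule set_integral_cong_set)
      show "set_borel_measurable lborel {\<alpha>..\<beta>} ?V" "set_borel_measurable lborel ?J ?V"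
        using Vi ViJ unfolding set_integrable_def set_borel_measurable_def by auto
      show "AE x in lborel. (x \<in> {\<alpha>..\<beta>}) = (x \<in> ?J)"
        using AE_lborel_singleton[of \<alpha>] AE_lborel_singleton[of \<beta>] by eventually_elim auto
    qed
    also have "\<dots> = integral {\<alpha>..\<beta>} ?V" by (rule set_borel_integral_eq_integral(2)[OF Vi])
    finally have V: "(LINT \<omega>:?J|lborel. ?V \<omega>) = integral {\<alpha>..\<beta>} ?V" .
    have "f \<omega> z = indicator (?P \<inter> ?J) \<omega> - indicator ?J \<omega> *\<^sub>R ?V \<omega>" for \<omega>
    proof (cases "\<omega> \<in> ?J")
      case True
      then have "\<omega> \<in> ?P \<longleftrightarrow> X \<omega> \<le> y" using J[OF True] X(1)[OF True] by (simp add: few_reflections_def)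
      then show ?thesis using True \<open>z \<in> ?Z\<close> by (simp add: f_def y_def indicator_def)
    qed (simp add: f_def)
    then have "(LINT \<omega>|lborel. f \<omega> z) = (LINT \<omega>|lborel. indicator (?P \<inter> ?J) \<omega> - indicator ?J \<omega> *\<^sub>R ?V \<omega>)" by simp
    also have "\<dots> = (LINT \<omega>|lborel. indicator (?P \<inter> ?J) \<omega>) - (LINT \<omega>|lborel. indicator ?J \<omega> *\<^sub>R ?V \<omega>)"
    proof (rule Bochner_Integration.integral_diff)
      show "integrable lborel (\<lambda>\<omega>. indicator (?P \<inter> ?J) \<omega> :: real)"
        using P_meas finP by (intro integrable_real_indicator) auto
      show "integrable lborel (\<lambda>\<omega>. indicator ?J \<omega> *\<^sub>R ?V \<omega>)" using ViJ by (simp add: set_integrable_def)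
    qed
    also have "\<dots> = measure lborel (?P \<inter> {\<alpha>..<\<beta>}) - integral {\<alpha>..\<beta>} ?V"
      using V PJ by (simp add: set_lebesgue_integral_def)
    finally show ?thesis using dist[OF y] True by simp
  next
    case False
    then show ?thesis by (simp add: f_def)
  qed
  have B0: "0 \<le> B" using dist[of 0] by linarith
  have "(LINT z|lborel. LINT \<omega>|lborel. f \<omega> z) = (LINT \<omega>|lborel. LINT z|lborel. f \<omega> z)"
    by (rule lborel_pair.Fubini_integral[OF f_int])
  also have "\<dots> = (LINT \<omega>:?J|lborel. ?g \<omega> powr r * moment_const r - X \<omega> powr r)"
    by (simp add: inner_z set_lebesgue_integral_def)
  also have "\<dots> = (LINT \<omega>:?J|lborel. ?g \<omega> powr r * moment_const r) - (LINT \<omega>:?J|lborel. X \<omega> powr r)"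
  proof (rule set_integral_diff(2))
    have gi: "set_integrable lborel ?J (\<lambda>\<omega>. ?g \<omega> powr r)"
      unfolding set_integrable_def
    proof (rule integrableI_bounded_set[where A = ?J and B = "2 powr r"])
      show "(\<lambda>\<omega>. indicator ?J \<omega> *\<^sub>R ?g \<omega> powr r) \<in> borel_measurable lborel" by measurable
      show "AE \<omega> in lborel. \<omega> \<in> ?J \<longrightarrow> norm (indicator ?J \<omega> *\<^sub>R ?g \<omega> powr r) \<le> 2 powr r"
      proof (intro AE_I2 impI)
        fix \<omega> assume \<omega>: "\<omega> \<in> ?J"
        have "?g \<omega> powr r \<le> 2 powr r" using g[OF \<omega>] r by (intro powr_mono2) auto
        then show "norm (indicator ?J \<omega> *\<^sub>R ?g \<omega> powr r) \<le> 2 powr r" using \<omega> by simp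
      qed
    qed (use I in auto)
    then show "set_integrable lborel ?J (\<lambda>\<omega>. ?g \<omega> powr r * moment_const r)" by (simp add: set_integrable_mult_left)
    show "set_integrable lborel ?J (\<lambda>\<omega>. X \<omega> powr r)"
      unfolding set_integrable_def
    proof (rule integrableI_bounded_set[where A = ?J and B = "3 powr r"])
      show "(\<lambda>\<omega>. indicator ?J \<omega> *\<^sub>R X \<omega> powr r) \<in> borel_measurable lborel" by measurable
      show "AE \<omega> in lborel. \<omega> \<in> ?J \<longrightarrow> norm (indicator ?J \<omega> *\<^sub>R X \<omega> powr r) \<le> 3 powr r"
      proof (intro AE_I2 impI)
        fix \<omega> assume \<omega>: "\<omega> \<in> ?J"
        have "X \<omega> powr r \<le> 3 powr r" using X(2,3)[OF \<omega>] r by (intro powr_mono2) auto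
        then show "norm (indicator ?J \<omega> *\<^sub>R X \<omega> powr r) \<le> 3 powr r" using \<omega> by simp
      qed
    qed (use I in auto)
  qed
  also have "(LINT \<omega>:?J|lborel. ?g \<omega> powr r * moment_const r) = moment_const r * (LINT \<omega>:?J|lborel. ?g \<omega> powr r)"
    by (simp add: mult.commute)
  also have "(LINT \<omega>:?J|lborel. X \<omega> powr r) = (LINT \<omega>:?J|lborel. \<epsilon> powr r * real (reflections \<epsilon> \<omega>) powr r)"
    by (rule set_lebesgue_integral_cong) (use X(1) \<epsilon> in \<open>auto simp: powr_mult\<close>)
  also have "\<dots> = \<epsilon> powr r * (LINT \<omega>:?J|lborel. real (reflections \<epsilon> \<omega>) powr r)" by simp
  finally have eq: "(LINT z|lborel. LINT \<omega>|lborel. f \<omega> z) =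
      moment_const r * (LINT \<omega>:?J|lborel. ?g \<omega> powr r) - \<epsilon> powr r * (LINT \<omega>:?J|lborel. real (reflections \<epsilon> \<omega>) powr r)" .
  have "norm (LINT z|lborel. LINT \<omega>|lborel. f \<omega> z) \<le> (LINT z|lborel. norm (LINT \<omega>|lborel. f \<omega> z))"
    by (rule integral_norm_bound)
  also have "\<dots> \<le> (LINT z|lborel. indicator ?Z z * B)"
  proof (rule integral_mono)
    show "integrable lborel (\<lambda>z. norm (LINT \<omega>|lborel. f \<omega> z))"
      using lborel_pair.integrable_snd[OF f_int] by simp
    show "integrable lborel (\<lambda>z. indicator ?Z z * B)" by (intro integrable_mult_left integrable_real_indicator) auto
    show "norm (LINT \<omega>|lborel. f \<omega> z) \<le> indicator ?Z z * B" for z using inner_\<omega>[of z] by simp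
  qed
  also have "\<dots> = 3 powr r * B" by simp
  finally show ?thesis unfolding eq real_norm_def by (simp add: abs_minus_commute)
qed

lemma real_interval_endpoints:
  fixes I :: "real set"
  assumes "is_interval I" "I \<subseteq> {a..b}" "I \<noteq> {}"
  obtains \<alpha> \<beta> where "a \<le> \<alpha>" "\<alpha> \<le> \<beta>" "\<beta> \<le> b" "{\<alpha><..<\<beta>} \<subseteq> I" "I \<subseteq> {\<alpha>..\<beta>}"
proof -
  have bdd: "bdd_below I" "bdd_above I" using assms(2) by (auto intro: bdd_below_mono bdd_above_mono)
  have sub: "{Inf I<..<Sup I} \<subseteq> I"
  proof
    fix x assume "x \<in> {Inf I<..<Sup I}"
    then obtain u v where "u \<in> I" "u < x" "v \<in> I" "x < v"
      using cInf_lessD[OF assms(3)] less_cSupD[OF assms(3)] by (metis greaterThanLessThan_iff)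
    then show "x \<in> I" using assms(1) unfolding is_interval_1 by (meson less_imp_le)
  qed
  have sup: "I \<subseteq> {Inf I..Sup I}" using bdd by (auto intro: cInf_lower cSup_upper)
  obtain x where "x \<in> I" using assms(3) by blast
  then have "Inf I \<le> Sup I" using sup by force
  moreover have "a \<le> Inf I" using assms by (intro cInf_greatest) auto
  moreover have "Sup I \<le> b" using assms by (intro cSup_least) auto
  ultimately show thesis using that sub sup by blast
qed

lemma set_integral_interval_interior:
  fixes f :: "real \<Rightarrow> real"
  assumes "{\<alpha><..<\<beta>} \<subseteq> I" "I \<subseteq> {\<alpha>..\<beta>}"
  shows "(LINT x:I|lborel. f x) = (LINT x:{\<alpha><..<\<beta>}|lborel. f x)"
  unfolding set_lebesgue_integral_def
proof (rule integral_discrete_difference[where X = "{\<alpha>, \<beta>}"])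
  fix x assume "x \<notin> {\<alpha>, \<beta>}"
  then have "x \<in> I \<longleftrightarrow> x \<in> {\<alpha><..<\<beta>}" using assms by force
  then show "indicator I x *\<^sub>R f x = indicator {\<alpha><..<\<beta>} x *\<^sub>R f x" by (simp add: indicator_def)
qed auto

theorem theorem1p4:
  fixes r \<delta> :: real
  assumes "r > 0" and "\<delta> > 0"
  shows "\<exists>C. \<forall>\<^sub>F \<epsilon> in at_right (0::real). \<forall>I :: real set.
           is_interval I \<and> I \<subseteq> {0..pi / 4} \<longrightarrow>
           \<bar>\<epsilon> powr r * (LINT \<omega>:I|lborel. real (reflections \<epsilon> \<omega>) powr r)
             - moment_const r * (LINT x:I|lborel. (sin x + cos x) powr r)\<bar>
           \<le> C * \<epsilon> powr (1 / 8 - \<delta>)"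
proof -
  obtain C where C: "C > 0" and dist: "\<And>\<epsilon> y \<alpha> \<beta>. 0 < \<epsilon> \<Longrightarrow> \<epsilon> \<le> 1 / 8 \<Longrightarrow> 0 \<le> y \<Longrightarrow> y \<le> 3 \<Longrightarrow> 0 \<le> \<alpha> \<Longrightarrow> \<alpha> < \<beta> \<Longrightarrow> \<beta> \<le> pi / 4 \<Longrightarrow>
    \<bar>measure lborel (few_reflections \<epsilon> y \<inter> {\<alpha>..<\<beta>}) - integral {\<alpha>..\<beta>} (\<lambda>\<omega>. hit_cdf (y / (sin \<omega> + cos \<omega>)))\<bar> \<le> C * \<epsilon> powr (1 / 8 - \<delta>)"
    using distribution_of_reflections[OF assms(2)] by blast
  have bound: "\<bar>\<epsilon> powr r * (LINT \<omega>:I|lborel. real (reflections \<epsilon> \<omega>) powr r)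
             - moment_const r * (LINT x:I|lborel. (sin x + cos x) powr r)\<bar>
           \<le> (3 powr r * C) * \<epsilon> powr (1 / 8 - \<delta>)"
    if \<epsilon>: "0 < \<epsilon>" "\<epsilon> \<le> 1 / 8" and I: "is_interval I" "I \<subseteq> {0..pi / 4}" for \<epsilon> and I :: "real set"
  proof (cases "I = {}")
    case True
    then show ?thesis using C by (simp add: set_lebesgue_integral_def)
  next
    case False
    then obtain \<alpha> \<beta> where ab: "0 \<le> \<alpha>" "\<alpha> \<le> \<beta>" "\<beta> \<le> pi / 4" and sub: "{\<alpha><..<\<beta>} \<subseteq> I" "I \<subseteq> {\<alpha>..\<beta>}"
      using real_interval_endpoints[OF I] by blast
    show ?thesis
    proof (cases "\<alpha> = \<beta>")
      case True
      then show ?thesis unfolding set_integral_interval_interior[OF sub]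
        using C by (simp add: set_lebesgue_integral_def)
    next
      case False
      then have "\<alpha> < \<beta>" using ab by simp
      then show ?thesis unfolding set_integral_interval_interior[OF sub] mult.assoc
        using ab by (intro moment_difference_bound assms \<epsilon> dist) auto
    qed
  qed
  have "\<forall>\<^sub>F \<epsilon> in at_right (0::real). \<epsilon> \<in> {0<..<1 / 8}"
    by (rule eventually_at_right_real) simp
  then have "\<forall>\<^sub>F \<epsilon> in at_right (0::real). \<forall>I :: real set.
           is_interval I \<and> I \<subseteq> {0..pi / 4} \<longrightarrow>
           \<bar>\<epsilon> powr r * (LINT \<omega>:I|lborel. real (reflections \<epsilon> \<omega>) powr r)
             - moment_const r * (LINT x:I|lborel. (sin x + cos x) powr r)\<bar>
           \<le> (3 powr r * C) * \<epsilon> powr (1 / 8 - \<delta>)"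
    by eventually_elim (use bound in auto)
  then show ?thesis by blast
qed

end
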